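(* Let $\mathcal T^{A_1A_2\to E}$ be a completely positive trace non-increasing superoperator with Choi state $$\tau^{A'_1A'_2E}:=(\mathcal T^{A_1A_2\to E}\otimes\mathbb I^{A'_1A'_2})(\Phi^{A'_1A_1}\otimes\Phi^{A'_2A_2}).$$ Let $\rho^{A_1A_2R}$ be a subnormalised density matrix. Define $\hat A_1:=A_1\otimes\mathbb C^2$ and similarly $\hat A'_1,\hat A_2,\hat A'_2$. Define $$\rho^{\hat A_1\hat A_2R}:=\rho^{A_1A_2R}\otimes|0\rangle\langle0|^{\mathbb C^2}\otimes|0\rangle\langle0|^{\mathbb C^2},\qquad\tau^{\hat A'_1\hat A'_2E}:=\tau^{A'_1A'_2E}\otimes|0\rangle\langle0|^{\mathbb C^2}\otimes|0\rangle\langle0|^{\mathbb C^2}.$$ Let $\mathcal T^{\hat A_1\hat A_2\to E}$ be the completely positive superoperator that is the inverse Choi image of $\tau^{\hat A'_1\hat A'_2E}$. Then $\mathcal T^{\hat A_1\hat A_2\to E}$ is the completely positive superoperator corresponding to projecting from $\hat A_1\otimes\hat A_2$ onto $(A_1\otimes|0\rangle\langle0|^{\mathbb C^2})\otimes(A_2\otimes|0\rangle\langle0|^{\mathbb C^2})$ followed by applying $4\,\mathcal T^{A_1A_2\to E}$. Let $0<\epsilon<1$. Then $$\mathbb E_{U^{\hat A_1}U^{\hat A_2}}\left[\left\|(\mathcal T^{\hat A_1\hat A_2\to E}\otimes\mathbb I^R)\big((U^{\hat A_1}\otimes U^{\hat A_2}\otimes 1^R)\circ\rho^{\hat A_1\hat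 A_2R}\big)-\tau^E\otimes\rho^R\right\|_1\right]\leq18\,\epsilon^{1/128}$$ if $$H^\epsilon_{\min}(A_1|R)_\rho+H^\epsilon_{\min}(A'_1|E)_\tau>\log\epsilon^{-1},$$ $$H^\epsilon_{\min}(A_2|R)_\rho+H^\epsilon_{\min}(A'_2|E)_\tau>\log\epsilon^{-1},$$ $$H^\epsilon_{\min}(A_1A_2|R)_\rho+H^\epsilon_{\min}(A'_1A'_2|E)_\tau>\log\epsilon^{-1},$$ $$|A_1|^2>\epsilon^{-1},\qquad|A_2|^2>\epsilon^{-1},$$ where the expectation is over independent choices of unitaries $U^{\hat A_1},U^{\hat A_2}$ from the Haar measures on the unitary groups of $\hat A_1,\hat A_2$.
   Context: Hilbert spaces are finite dimensional; $|A|$ is the dimension of $A$; $\log$ is base 2; $\mathbb I$ is the identity superoperator and $1$ the identity matrix; $U\circ\rho:=U\rho U^\dagger$. A subnormalised density matrix is a positive semidefinite matrix of trace at most one. $A'$ denotes a Hilbert space of the same dimension as $A$, and $\Phi^{A'A}:=|A|^{-1}\sum_{a_1,a_2=1}^{|A|}|a_1,a_1\rangle\langle a_2,a_2|^{A'A}$. The inverse Choi image of $\tau^{\hat A'_1\hat A'_2E}$ is the unique superoperator $\mathcal T^{\hat A_1\hat A_2\to E}$ with $(\mathcal T^{\hat A_1\hat A_2\to E}\otimes\mathbb I^{\hat A'_1\hat A'_2})(\Phi^{\hat A'_1\hat A_1}\otimes\Phi^{\hat A'_2\hat A_2})=\tau^{\hat A'_1\hat A'_2E}$. Marginals are denoted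 by superscripts. For a subnormalised density matrix $\alpha$ and positive semidefinite $\beta$: $D_\infty(\alpha\|\beta):=\log\|\beta^{-1/2}\alpha\beta^{-1/2}\|_\infty$ (pseudoinverse) if $\mathrm{supp}(\alpha)\subseteq\mathrm{supp}(\beta)$, $+\infty$ otherwise; $D^\epsilon_\infty(\alpha\|\beta):=\min_{\alpha'}D_\infty(\alpha'\|\beta)$ over subnormalised density matrices $\alpha'$ with $\|\alpha'-\alpha\|_1\leq\epsilon(\mathrm{Tr}\,\alpha)$; $H^\epsilon_{\min}(A|R)_\rho:=-D^\epsilon_\infty(\rho^{AR}\|1^A\otimes\rho^R)$. *)

theory Defs
  imports "HOL-Probability.Probability"
begin

(* A Hilbert space of finite dimension is given by a finite index type (its computational
   basis), so that operators on it are square matrices and the tensor product of spaces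
   is the product of index types. A space and its primed copy share the same index type. *)

type_synonym 'n op = "complex^'n^'n"

definition mscale :: "complex \<Rightarrow> 'n::finite op \<Rightarrow> 'n op" where
  "mscale c M = map_matrix ((*) c) M"

definition adj :: "'n::finite op \<Rightarrow> 'n op" where
  "adj M = map_matrix cnj (transpose M)"

definition cinner :: "complex^'n::finite \<Rightarrow> complex^'n \<Rightarrow> complex" where
  "cinner v w = (\<Sum>i\<in>UNIV. cnj (v $ i) * w $ i)"

definition psd :: "'n::finite op \<Rightarrow> bool" where
  "psd A \<longleftrightarrow> adj A = A \<and> (\<forall>v. 0 \<le> Re (cinner v (A *v v)))"

definition subnormalised :: "'n::finite op \<Rightarrow> bool" where
  "subnormalised A \<longleftrightarrow> psd A \<and> Re (trace A) \<le> 1"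

definition ketbra :: "'n::finite \<Rightarrow> 'n \<Rightarrow> 'n op" where
  "ketbra i j = (\<chi> k l. if k = i \<and> l = j then 1 else 0)"

definition tensor :: "'m::finite op \<Rightarrow> 'n::finite op \<Rightarrow> ('m \<times> 'n) op" (infixr "\<otimes>\<^sub>m" 75) where
  "M \<otimes>\<^sub>m N = (\<chi> i j. M $ fst i $ fst j * N $ snd i $ snd j)"

(* For a bijection f this only permutes tensor factors; for an injection f it is the
   compression to the span of the basis vectors in the range of f. *)
definition reindex :: "('m::finite \<Rightarrow> 'n::finite) \<Rightarrow> 'n op \<Rightarrow> 'm op" where
  "reindex f M = (\<chi> i j. M $ f i $ f j)"

definition ptrace1 :: "('m::finite \<times> 'n::finite) op \<Rightarrow> 'n op" where
  "ptrace1 M = (\<chi> i j. \<Sum>k\<in>UNIV. M $ (k, i) $ (k, j))"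

definition marginal_1 :: "(('m::finite \<times> 'n::finite) \<times> 'x::finite) op \<Rightarrow> ('m \<times> 'x) op" where
  "marginal_1 M = ptrace1 (reindex (\<lambda>(b, (a, x)). ((a, b), x)) M)"

definition marginal_2 :: "(('m::finite \<times> 'n::finite) \<times> 'x::finite) op \<Rightarrow> ('n \<times> 'x) op" where
  "marginal_2 M = ptrace1 (reindex (\<lambda>(a, (b, x)). ((a, b), x)) M)"

definition mat_sqrt :: "'n::finite op \<Rightarrow> 'n op" where
  "mat_sqrt A = (THE B. psd B \<and> B ** B = A)"

definition trace_norm :: "'n::finite op \<Rightarrow> real" where
  "trace_norm M = Re (trace (mat_sqrt (adj M ** M)))"

definition op_norm :: "'n::finite op \<Rightarrow> real" where
  "op_norm M = onorm (\<lambda>v. M *v v)"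

definition pseudoinverse :: "'n::finite op \<Rightarrow> 'n op" where
  "pseudoinverse A = (THE X. A ** X ** A = A \<and> X ** A ** X = X \<and>
     adj (A ** X) = A ** X \<and> adj (X ** A) = X ** A)"

(* orthogonal complement of the kernel *)
definition supp :: "'n::finite op \<Rightarrow> (complex^'n) set" where
  "supp A = {v. \<forall>w. A *v w = 0 \<longrightarrow> cinner w v = 0}"

(* the value of log 2 at 0 would be 0 *)
definition log2_ereal :: "real \<Rightarrow> ereal" where
  "log2_ereal x = (if x = 0 then -\<infinity> else ereal (log 2 x))"

definition D_max :: "'n::finite op \<Rightarrow> 'n op \<Rightarrow> ereal" where
  "D_max \<alpha> \<beta> =
     (if supp \<alpha> \<subseteq> supp \<beta>
      then log2_ereal (op_norm (pseudoinverse (mat_sqrt \<beta>) ** \<alpha> ** pseudoinverse (mat_sqrt \<beta>)))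
      else \<infinity>)"

definition smooth_D_max :: "real \<Rightarrow> 'n::finite op \<Rightarrow> 'n op \<Rightarrow> ereal" where
  "smooth_D_max \<epsilon> \<alpha> \<beta> =
     (INF \<alpha>' \<in> {\<alpha>'. subnormalised \<alpha>' \<and> trace_norm (\<alpha>' - \<alpha>) \<le> \<epsilon> * Re (trace \<alpha>)}. D_max \<alpha>' \<beta>)"

(* The conditioning system is the second tensor factor. For subnormalised arguments the
   value is never -\<infinity>, so sums of such entropies are unambiguous in ereal. *)
definition H_min :: "real \<Rightarrow> ('a::finite \<times> 'r::finite) op \<Rightarrow> ereal" where
  "H_min \<epsilon> \<rho> = - smooth_D_max \<epsilon> \<rho> (mat 1 \<otimes>\<^sub>m ptrace1 \<rho>)"

definition superoperator :: "('a::finite op \<Rightarrow> 'b::finite op) \<Rightarrow> bool" where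
  "superoperator T \<longleftrightarrow> Vector_Spaces.linear mscale mscale T"

(* The k x k block matrix (X i j), viewed as an operator on the tensor product of
   C^k with the given space, is positive semidefinite. *)
definition block_psd :: "nat \<Rightarrow> (nat \<Rightarrow> nat \<Rightarrow> 'a::finite op) \<Rightarrow> bool" where
  "block_psd k X \<longleftrightarrow> (\<forall>i<k. \<forall>j<k. adj (X i j) = X j i) \<and>
     (\<forall>v. 0 \<le> Re (\<Sum>i<k. \<Sum>j<k. cinner (v i) (X i j *v v j)))"

(* T tensored with the identity on C^k is positive for every k; the reference dimension
   is quantified inside the formula, hence blocks instead of an index type. *)
definition completely_positive :: "('a::finite op \<Rightarrow> 'b::finite op) \<Rightarrow> bool" where
  "completely_positive T \<longleftrightarrow> superoperator T \<and>
     (\<forall>k X. block_psd k X \<longrightarrow> block_psd k (\<lambda>i j. T (X i j)))"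

definition trace_nonincreasing :: "('a::finite op \<Rightarrow> 'b::finite op) \<Rightarrow> bool" where
  "trace_nonincreasing T \<longleftrightarrow> (\<forall>X. psd X \<longrightarrow> Re (trace (T X)) \<le> Re (trace X))"

(* T tensored with the identity superoperator of the second factor, see tensor_id_tensor *)
definition tensor_id ::
    "('a::finite op \<Rightarrow> 'b::finite op) \<Rightarrow> ('a \<times> 'r::finite) op \<Rightarrow> ('b \<times> 'r) op" where
  "tensor_id T X =
     (\<chi> i j. T (\<chi> k l. X $ (k, snd i) $ (l, snd j)) $ fst i $ fst j)"

definition max_entangled :: "('a::finite \<times> 'a) op" where
  "max_entangled =
     mscale (1 / of_nat CARD('a)) (\<Sum>a\<^sub>1\<in>UNIV. \<Sum>a\<^sub>2\<in>UNIV. ketbra (a\<^sub>1, a\<^sub>1) (a\<^sub>2, a\<^sub>2))"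

(* The two reindexings order the factors A1' A1 A2' A2 as A1 A2 A1' A2', and
   E A1' A2' as A1' A2' E. *)
definition choi ::
    "(('a::finite \<times> 'b::finite) op \<Rightarrow> 'e::finite op) \<Rightarrow> (('a \<times> 'b) \<times> 'e) op" where
  "choi T =
     reindex (\<lambda>(a', e). (e, a'))
       (tensor_id T
         (reindex (\<lambda>((a, b), (a', b')). ((a', a), (b', b)))
           ((max_entangled :: ('a \<times> 'a) op) \<otimes>\<^sub>m (max_entangled :: ('b \<times> 'b) op))))"

definition inv_choi ::
    "(('a::finite \<times> 'b::finite) \<times> 'e::finite) op \<Rightarrow> (('a \<times> 'b) op \<Rightarrow> 'e op)" where
  "inv_choi \<tau> = (THE T. superoperator T \<and> choi T = \<tau>)"

(* M tensored with |0><0| and |0><0|, the two qubits being attached to the first and to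
   the second factor; C^2 has the index type 2, with elements 0 and 1. *)
definition hat ::
    "(('a::finite \<times> 'b::finite) \<times> 'x::finite) op \<Rightarrow> ((('a \<times> 2) \<times> ('b \<times> 2)) \<times> 'x) op" where
  "hat M = reindex (\<lambda>(((a, p), (b, q)), x). (((a, b), x), (p, q)))
     (M \<otimes>\<^sub>m ketbra 0 0 \<otimes>\<^sub>m ketbra 0 0)"

definition proj00 :: "(('a::finite \<times> 2) \<times> ('b::finite \<times> 2)) op" where
  "proj00 = (mat 1 \<otimes>\<^sub>m ketbra 0 0) \<otimes>\<^sub>m (mat 1 \<otimes>\<^sub>m ketbra 0 0)"

(* The reindexing identifies the range of proj00 with the space indexed by 'a * 'b. *)
definition project00 ::
    "(('a::finite \<times> 2) \<times> ('b::finite \<times> 2)) op \<Rightarrow> ('a \<times> 'b) op" where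
  "project00 X = reindex (\<lambda>(a, b). ((a, 0), (b, 0))) (proj00 ** X ** proj00)"

definition unitary_group :: "'n::finite op set" where
  "unitary_group = {U. adj U ** U = mat 1 \<and> U ** adj U = mat 1}"

definition haar_unitary :: "'n::finite op measure \<Rightarrow> bool" where
  "haar_unitary \<mu> \<longleftrightarrow> prob_space \<mu> \<and> space \<mu> = unitary_group \<and>
     sets \<mu> = sets (restrict_space borel unitary_group) \<and>
     (\<forall>V\<in>unitary_group. distr \<mu> \<mu> (\<lambda>U. V ** U) = \<mu>)"

definition conjugate :: "'n::finite op \<Rightarrow> 'n op \<Rightarrow> 'n op" (infixr "\<circ>\<^sub>m" 70) where
  "U \<circ>\<^sub>m \<rho> = U ** \<rho> ** adj U"

lemma vector_space_mscale: "vector_space (mscale :: complex \<Rightarrow> 'n::finite op \<Rightarrow> 'n op)"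
  by unfold_locales (auto simp: mscale_def vec_eq_iff algebra_simps)

lemma superoperator_iff:
  "superoperator T \<longleftrightarrow> (\<forall>X Y. T (X + Y) = T X + T Y) \<and> (\<forall>c X. T (mscale c X) = mscale c (T X))"
  by (auto simp: superoperator_def Vector_Spaces.linear_def module_hom_def module_hom_axioms_def
      vector_space_mscale vector_space.vector_space_assms
      module_iff_vector_space)

lemma superoperator_sum:
  assumes "superoperator T"
  shows "T (sum f A) = (\<Sum>x\<in>A. T (f x))"
proof -
  interpret Vector_Spaces.linear mscale mscale T
    using assms by (simp add: superoperator_def)
  show ?thesis by (rule sum)
qed

lemma tensor_id_tensor:
  assumes "superoperator T"
  shows "tensor_id T (M \<otimes>\<^sub>m N) = T M \<otimes>\<^sub>m N"
proof -
  have "(\<chi> k l. (M \<otimes>\<^sub>m N) $ (k, s) $ (l, t)) = mscale (N $ s $ t) M" for s t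
    by (simp add: tensor_def mscale_def vec_eq_iff)
  then show ?thesis
    using assms by (simp add: superoperator_iff tensor_id_def vec_eq_iff)
      (simp add: tensor_def mscale_def)
qed

lemma sum_sum_delta:
  "(\<Sum>i\<in>UNIV. \<Sum>j\<in>UNIV. if i = k then if j = l then c else 0 else 0) = (c :: complex)"
  for k :: "'a::finite" and l :: "'b::finite"
proof -
  have "(\<Sum>i\<in>UNIV. \<Sum>j\<in>UNIV. if i = k then if j = l then c else 0 else 0) =
      (\<Sum>i\<in>UNIV. if i = k then (\<Sum>j\<in>UNIV. if j = l then c else 0) else 0)"
    by (intro sum.cong refl) auto
  then show ?thesis by simp
qed

lemma max_entangled_nth:
  "(max_entangled :: ('a::finite \<times> 'a) op) $ i $ j =
     (if fst i = snd i \<and> fst j = snd j then 1 / of_nat CARD('a) else 0)"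
proof -
  have "(\<Sum>a\<^sub>1\<in>UNIV. \<Sum>a\<^sub>2\<in>UNIV. (if i = (a\<^sub>1, a\<^sub>1) \<and> j = (a\<^sub>2, a\<^sub>2) then 1 else (0::complex)))
      = (\<Sum>a\<^sub>1\<in>UNIV. \<Sum>a\<^sub>2\<in>UNIV. (if a\<^sub>1 = fst i then if a\<^sub>2 = fst j then
            if fst i = snd i \<and> fst j = snd j then 1 else 0 else 0 else 0))"
    by (intro sum.cong refl) (auto simp: prod_eq_iff)
  also have "\<dots> = (if fst i = snd i \<and> fst j = snd j then 1 else 0)"
    by (rule sum_sum_delta)
  finally have *: "(\<Sum>a\<^sub>1\<in>UNIV. \<Sum>a\<^sub>2\<in>UNIV. (if i = (a\<^sub>1, a\<^sub>1) \<and> j = (a\<^sub>2, a\<^sub>2) then 1 else (0::complex)))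
      = (if fst i = snd i \<and> fst j = snd j then 1 else 0)" .
  show ?thesis
    unfolding max_entangled_def mscale_def ketbra_def by (simp add: *)
qed

lemma choi_nth:
  fixes T :: "('a::finite \<times> 'b::finite) op \<Rightarrow> 'e::finite op"
  assumes "superoperator T"
  shows "choi T $ (i, e) $ (j, e') =
    T (ketbra i j) $ e $ e' / of_nat (CARD('a) * CARD('b))"
proof -
  have "(\<chi> k l. (reindex (\<lambda>((a, b), (a', b')). ((a', a), (b', b)))
           ((max_entangled :: ('a \<times> 'a) op) \<otimes>\<^sub>m (max_entangled :: ('b \<times> 'b) op))) $ (k, i) $ (l, j))
      = mscale (1 / of_nat (CARD('a) * CARD('b))) (ketbra i j)"
    by (auto simp: vec_eq_iff reindex_def tensor_def max_entangled_nth ketbra_def mscale_def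
        split: prod.splits)
  then show ?thesis
    using assms by (simp add: choi_def reindex_def tensor_id_def superoperator_iff)
      (simp add: mscale_def)
qed

lemma op_expand: "X = (\<Sum>i\<in>UNIV. \<Sum>j\<in>UNIV. mscale (X $ i $ j) (ketbra i j))"
proof -
  have "(\<Sum>i\<in>UNIV. \<Sum>j\<in>UNIV. X $ i $ j * (if k = i \<and> l = j then 1 else 0))
      = (\<Sum>i\<in>UNIV. \<Sum>j\<in>UNIV. if i = k then if j = l then X $ k $ l else 0 else 0)" for k l
    by (intro sum.cong refl) auto
  then show ?thesis
    by (simp add: vec_eq_iff mscale_def ketbra_def sum_sum_delta)
qed

lemma ex1_inv_choi:
  fixes \<tau> :: "(('a::finite \<times> 'b::finite) \<times> 'e::finite) op"
  shows "\<exists>!T. superoperator T \<and> choi T = \<tau>"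
proof (rule ex_ex1I)
  define N :: complex where "N = of_nat (CARD('a) * CARD('b))"
  have N: "N \<noteq> 0" by (simp add: N_def)
  define T :: "('a \<times> 'b) op \<Rightarrow> 'e op" where
    "T X = (\<chi> e e'. \<Sum>i\<in>UNIV. \<Sum>j\<in>UNIV. X $ i $ j * (N * \<tau> $ (i, e) $ (j, e')))" for X
  have T: "superoperator T"
    by (auto simp: superoperator_iff T_def mscale_def vec_eq_iff algebra_simps
        sum.distrib sum_distrib_left)
  have "T (ketbra i j) $ e $ e' = N * \<tau> $ (i, e) $ (j, e')" for i j e e'
  proof -
    have "T (ketbra i j) $ e $ e' =
        (\<Sum>k\<in>UNIV. \<Sum>l\<in>UNIV. if k = i then if l = j then N * \<tau> $ (i, e) $ (j, e') else 0 else 0)"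
      unfolding T_def ketbra_def by (auto intro!: sum.cong)
    also have "\<dots> = N * \<tau> $ (i, e) $ (j, e')"
      by (rule sum_sum_delta)
    finally show ?thesis .
  qed
  then have "choi T = \<tau>"
    using N by (simp add: vec_eq_iff choi_nth[OF T] N_def)
  with T show "\<exists>T. superoperator T \<and> choi T = \<tau>" by blast
next
  fix S T :: "('a \<times> 'b) op \<Rightarrow> 'e op"
  assume S: "superoperator S \<and> choi S = \<tau>" and T: "superoperator T \<and> choi T = \<tau>"
  have k: "S (ketbra i j) = T (ketbra i j)" for i j
  proof -
    have "S (ketbra i j) $ e $ e' / of_nat (CARD('a) * CARD('b)) =
        T (ketbra i j) $ e $ e' / of_nat (CARD('a) * CARD('b))" for e e'
      using S T choi_nth by metis
    then show ?thesis by (simp add: vec_eq_iff)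
  qed
  have "S X = T X" for X
  proof -
    have expand: "R X = (\<Sum>i\<in>UNIV. \<Sum>j\<in>UNIV. mscale (X $ i $ j) (R (ketbra i j)))"
      if R: "superoperator R" for R :: "('a \<times> 'b) op \<Rightarrow> 'e op"
      using R by (subst op_expand) (simp add: superoperator_sum superoperator_iff)
    show ?thesis using expand[of S] expand[of T] S T k by simp
  qed
  then show "S = T" by blast
qed

end

theory Submission
  imports Defs
begin

text \<open>
  The output of the padded map on the rotated input is a bilinear contraction of
  \<open>\<tau>\<close> and \<open>\<rho>\<close> with the kernel \<open>N\<^sub>1 \<otimes> N\<^sub>2\<close>, where \<open>N\<^sub>i\<close>
  is the normalised Choi matrix of the conjugation by \<open>U\<^sub>i\<close> and has mean \<open>1\<close>; the kernel \<open>1\<close>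
  gives \<open>\<tau>\<^sup>E \<otimes> \<rho>\<^sup>R\<close>.
  In \<open>N\<^sub>1 \<otimes> N\<^sub>2 - 1 = (N\<^sub>1 - 1) \<otimes> (N\<^sub>2 - 1) + (N\<^sub>1 - 1) \<otimes> 1 + 1 \<otimes> (N\<^sub>2 - 1)\<close>
  the last two summands only see the marginals of \<open>\<tau>\<close> and \<open>\<rho>\<close> on one of the two systems, so
  each summand can be smoothed on its own and no simultaneous smoothing is needed.
  A smoothed summand factors through the square roots of \<open>\<tau>\<^sup>E\<close> and \<open>\<rho>\<^sup>R\<close>, which reduces its
  trace norm to a Hilbert-Schmidt norm, and this one is controlled by the second moments of the
  Haar measure. The smoothing error is controlled by first moments, since
  \<open>N\<^sub>i - 1\<close> lies between \<open>- (N\<^sub>i + 1)\<close> and \<open>N\<^sub>i + 1\<close>.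
  This gives an error of order \<open>sqrt \<epsilon>\<close>, better than the claimed power.
\<close>

section \<open>Spectral theorem\<close>


text \<open>An entropy condition enters only through a factorisation: a state with max-relative
  entropy below c relative to 1 \<otimes> \<omega> is 1 \<otimes> sqrt \<omega> times a matrix of
  squared Hilbert-Schmidt norm at most 2^c. Here \<omega> is the marginal of the unsmoothed state,
  so the split-off factor acts on E and R alone and has squared Hilbert-Schmidt norm at most 1,
  whatever the smoothing state is. Splitting on one side is enough, because the unitary that attains
  the trace norm is absorbed into this factor. The arithmetic-geometric mean inequality with
  parameter sqrt \<epsilon> then gives a bound affine in the squared norm of the remaining
  contraction, and that norm has mean at most a constant times \<epsilon>. The padding qubits make
  the dimension n of each Haar unitary at least 2, so the covariance factor n^2 / (n^2 - 1) is at
  most 4/3; compression to the vector |0> keeps the mean and this bound. Trace norms are never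
  integrated exactly: each is bounded pointwise by a polynomial in the entries of the unitaries and
  their conjugates.\<close>

lemma adj_nth [simp]: "adj M $ i $ j = cnj (M $ j $ i)"
  by (simp add: adj_def transpose_def)

lemma adj_adj [simp]: "adj (adj M) = M"
  by (simp add: vec_eq_iff)

lemma adj_add: "adj (A + B) = adj A + adj B"
  by (simp add: vec_eq_iff)

lemma adj_diff: "adj (A - B) = adj A - adj B"
  by (simp add: vec_eq_iff)

lemma adj_mat_1 [simp]: "adj (mat 1) = mat 1"
  by (simp add: vec_eq_iff mat_def)

lemma adj_mult: "adj (A ** B) = adj B ** adj A"
  by (simp add: vec_eq_iff matrix_matrix_mult_def mult.commute)

lemma mscale_nth [simp]: "mscale c M $ i $ j = c * M $ i $ j"
  by (simp add: mscale_def)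

lemma tensor_nth [simp]: "(M \<otimes>\<^sub>m N) $ i $ j = M $ fst i $ fst j * N $ snd i $ snd j"
  by (simp add: tensor_def)

lemma reindex_nth [simp]: "reindex f M $ i $ j = M $ f i $ f j"
  by (simp add: reindex_def)

lemma cinner_commute: "cinner w v = cnj (cinner v w)"
  by (simp add: cinner_def mult.commute)

lemma cinner_mult_right: "cinner v (A *v w) = cinner (adj A *v v) w"
proof -
  have "cinner v (A *v w) = (\<Sum>i\<in>UNIV. \<Sum>j\<in>UNIV. cnj (v $ i) * (A $ i $ j * w $ j))"
    by (simp add: cinner_def matrix_vector_mult_def sum_distrib_left)
  also have "\<dots> = (\<Sum>j\<in>UNIV. \<Sum>i\<in>UNIV. cnj (v $ i) * (A $ i $ j * w $ j))"
    by (rule sum.swap)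
  also have "\<dots> = cinner (adj A *v v) w"
    by (simp add: cinner_def matrix_vector_mult_def sum_distrib_left sum_distrib_right algebra_simps)
  finally show ?thesis .
qed

lemma cinner_self: "cinner v v = of_real ((norm v)\<^sup>2)"
  by (simp add: cinner_def norm_vec_def L2_set_def sum_nonneg complex_norm_square mult.commute
      del: of_real_power)

lemma cinner_add_left: "cinner (u + v) w = cinner u w + cinner v w"
  by (simp add: cinner_def algebra_simps sum.distrib)

lemma cinner_add_right: "cinner w (u + v) = cinner w u + cinner w v"
  by (simp add: cinner_def algebra_simps sum.distrib)

lemma cinner_diff_right: "cinner w (u - v) = cinner w u - cinner w v"
  by (simp add: cinner_def algebra_simps sum_subtractf)

lemma cinner_scale_left: "cinner (c *s v) w = cnj c * cinner v w"
  by (simp add: cinner_def algebra_simps sum_distrib_left)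

lemma cinner_scale_right: "cinner v (c *s w) = c * cinner v w"
  by (simp add: cinner_def algebra_simps sum_distrib_left)

lemma cinner_zero [simp]: "cinner 0 v = 0" "cinner v 0 = 0"
  by (simp_all add: cinner_def)

lemma cinner_sum_mult:
  "cinner v (A *v v) = (\<Sum>i\<in>UNIV. \<Sum>j\<in>UNIV. cnj (v $ i) * A $ i $ j * v $ j)"
  by (simp add: cinner_def matrix_vector_mult_def sum_distrib_left algebra_simps)

lemma psd_hermitian: "psd A \<Longrightarrow> adj A = A"
  by (simp add: psd_def)

lemma psd_adj_mult: "psd (adj B ** B)"
  unfolding psd_def
proof safe
  fix v
  have "cinner v ((adj B ** B) *v v) = cinner (B *v v) (B *v v)"
    by (simp add: matrix_vector_mul_assoc[symmetric] cinner_mult_right)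
  then show "0 \<le> Re (cinner v ((adj B ** B) *v v))"
    by (simp add: cinner_self)
qed (simp add: adj_mult)

lemma psd_add: "psd A \<Longrightarrow> psd B \<Longrightarrow> psd (A + B)"
  by (simp add: psd_def adj_add matrix_vector_mult_add_rdistrib cinner_add_right)

lemma psd_mscale:
  assumes "psd A" "0 \<le> c"
  shows "psd (mscale (of_real c) A)"
proof -
  have "mscale (of_real c) A *v v = of_real c *s (A *v v)" for v
    by (simp add: vec_eq_iff matrix_vector_mult_def sum_distrib_left algebra_simps)
  moreover have "adj (mscale (of_real c) A) = mscale (of_real c) A"
    using psd_hermitian[OF assms(1)] by (simp add: vec_eq_iff)
  ultimately show ?thesis
    using assms by (simp add: psd_def cinner_scale_right)
qed

lemma psd_mat_1: "psd (mat 1)"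
  using psd_adj_mult[of "mat 1"] by simp

section \<open>Functional calculus in a fixed eigenbasis\<close>

definition real_diag :: "('n::finite \<Rightarrow> real) \<Rightarrow> 'n op" where
  "real_diag l = (\<chi> i j. if i = j then of_real (l i) else 0)"

text \<open>For a fixed unitary \<open>U\<close>, sums, products, square roots and pseudoinverses of
  such matrices are computed on the eigenvalue function \<open>l\<close> alone.\<close>

definition spectral_form :: "'n::finite op \<Rightarrow> ('n \<Rightarrow> real) \<Rightarrow> 'n op" where
  "spectral_form U l = U ** real_diag l ** adj U"

lemma if_mult_sum:
  "(\<Sum>j\<in>UNIV. (if i = j then f j else 0) * g j) = f i * (g i :: complex)"
  "(\<Sum>j\<in>UNIV. g j * (if j = i then f j else 0)) = g i * (f i :: complex)"
  for i :: "'n::finite"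
proof -
  have "(\<Sum>j\<in>UNIV. (if i = j then f j else 0) * g j) = (\<Sum>j\<in>UNIV. if i = j then f j * g j else 0)"
    by (intro sum.cong) auto
  then show "(\<Sum>j\<in>UNIV. (if i = j then f j else 0) * g j) = f i * (g i :: complex)"
    by simp
  have "(\<Sum>j\<in>UNIV. g j * (if j = i then f j else 0)) = (\<Sum>j\<in>UNIV. if j = i then g j * f j else 0)"
    by (intro sum.cong) auto
  then show "(\<Sum>j\<in>UNIV. g j * (if j = i then f j else 0)) = g i * (f i :: complex)"
    by simp
qed

lemma real_diag_mult_left: "(real_diag l ** A) $ i $ j = of_real (l i) * A $ i $ j"
  by (simp add: matrix_matrix_mult_def real_diag_def if_mult_sum)

lemma real_diag_mult_right: "(A ** real_diag l) $ i $ j = A $ i $ j * of_real (l j)"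
  by (simp add: matrix_matrix_mult_def real_diag_def if_mult_sum)

lemma adj_real_diag [simp]: "adj (real_diag l) = real_diag l"
  by (simp add: vec_eq_iff real_diag_def)

lemma unitaryD: "U \<in> unitary_group \<Longrightarrow> adj U ** U = mat 1" "U \<in> unitary_group \<Longrightarrow> U ** adj U = mat 1"
  by (simp_all add: unitary_group_def)

lemma unitaryI: "adj U ** U = mat 1 \<Longrightarrow> U \<in> unitary_group"
  unfolding unitary_group_def using matrix_left_right_inverse[of "adj U" U] by blast

lemma unitary_mult: "U \<in> unitary_group \<Longrightarrow> V \<in> unitary_group \<Longrightarrow> U ** V \<in> unitary_group"
proof (rule unitaryI)
  assume U: "U \<in> unitary_group" and V: "V \<in> unitary_group"
  have "adj (U ** V) ** (U ** V) = adj V ** (adj U ** U) ** V"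
    by (simp add: adj_mult matrix_mul_assoc)
  then show "adj (U ** V) ** (U ** V) = mat 1"
    by (simp add: unitaryD[OF U] unitaryD[OF V])
qed

lemma unitary_adj: "U \<in> unitary_group \<Longrightarrow> adj U \<in> unitary_group"
  by (simp add: unitary_group_def)

lemma adj_spectral_form [simp]: "adj (spectral_form U l) = spectral_form U l"
  by (simp add: spectral_form_def adj_mult matrix_mul_assoc)

lemma spectral_form_mult:
  assumes "U \<in> unitary_group"
  shows "spectral_form U l ** spectral_form U m = spectral_form U (\<lambda>i. l i * m i)"
proof -
  have "spectral_form U l ** spectral_form U m = U ** real_diag l ** (adj U ** U) ** real_diag m ** adj U"
    by (simp add: spectral_form_def matrix_mul_assoc)
  also have "\<dots> = U ** (real_diag l ** real_diag m) ** adj U"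
    using assms by (simp add: unitaryD matrix_mul_assoc)
  also have "real_diag l ** real_diag m = real_diag (\<lambda>i. l i * m i)"
    by (auto simp: vec_eq_iff real_diag_mult_left) (auto simp: real_diag_def)
  finally show ?thesis by (simp add: spectral_form_def)
qed

lemma matrix_add_rdistrib: "((B + C) ** A) = (B ** A) + (C ** A)"
  by (simp add: vec_eq_iff matrix_matrix_mult_def sum.distrib algebra_simps)

lemma spectral_form_add: "spectral_form U l + spectral_form U m = spectral_form U (\<lambda>i. l i + m i)"
proof -
  have "real_diag (\<lambda>i. l i + m i) = real_diag l + real_diag m"
    by (simp add: vec_eq_iff real_diag_def)
  then show ?thesis
    by (simp add: spectral_form_def matrix_add_ldistrib matrix_add_rdistrib)
qed

lemma spectral_form_diff: "spectral_form U l - spectral_form U m = spectral_form U (\<lambda>i. l i - m i)"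
  using spectral_form_add[of U "\<lambda>i. l i - m i" m] by (simp add: algebra_simps)

lemma spectral_form_1: "U \<in> unitary_group \<Longrightarrow> spectral_form U (\<lambda>_. 1) = mat 1"
proof -
  have "real_diag (\<lambda>_. 1) = (mat 1 :: 'a op)" by (simp add: vec_eq_iff real_diag_def mat_def)
  then show "U \<in> unitary_group \<Longrightarrow> spectral_form U (\<lambda>_. 1) = mat 1" by (simp add: spectral_form_def unitaryD)
qed

lemma trace_unitary_conj:
  assumes "U \<in> unitary_group"
  shows "trace (U ** A ** adj U) = trace A"
  using assms by (metis matrix_mul_assoc matrix_mul_lid trace_mul_sym unitaryD(1))

lemma trace_spectral_form: "U \<in> unitary_group \<Longrightarrow> trace (spectral_form U l) = of_real (\<Sum>i\<in>UNIV. l i)"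
  by (simp add: spectral_form_def trace_unitary_conj) (simp add: trace_def real_diag_def)

lemma psd_spectral_form:
  assumes "\<And>i. 0 \<le> l i" "U \<in> unitary_group"
  shows "psd (spectral_form U l)"
proof -
  have "spectral_form U l = spectral_form U (\<lambda>i. sqrt (l i)) ** spectral_form U (\<lambda>i. sqrt (l i))"
    using assms by (simp add: spectral_form_mult)
  then show ?thesis using psd_adj_mult[of "spectral_form U (\<lambda>i. sqrt (l i))"] by simp
qed

lemma spectral_form_eigenvalue:
  assumes "U \<in> unitary_group"
  shows "cinner (U *v axis i 1) (spectral_form U l *v (U *v axis i 1)) = of_real (l i)"
proof -
  have "adj U *v (spectral_form U l *v (U *v axis i 1)) = real_diag l *v axis i 1"
    using assms by (simp add: spectral_form_def matrix_vector_mul_assoc matrix_mul_assoc unitaryD)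
      (simp add: matrix_mul_assoc[symmetric] unitaryD)
  moreover have "cinner (axis i 1) (real_diag l *v axis i 1) = of_real (l i)"
  proof -
    have "real_diag l *v axis i 1 = (of_real (l i) *s axis i 1)"
      by (auto simp: vec_eq_iff matrix_vector_mult_def real_diag_def axis_def if_mult_sum)
    then show ?thesis
      by (simp add: cinner_def axis_def if_distrib[of cnj] if_distrib[of "\<lambda>x. x * _"] cong: if_cong)
  qed
  ultimately show ?thesis
    using cinner_mult_right[of "axis i 1" "adj U"] by (metis adj_adj)
qed

lemma spectral_form_psdD:
  assumes "psd (spectral_form U l)" "U \<in> unitary_group"
  shows "0 \<le> l i"
  using assms by (metis Re_complex_of_real psd_def spectral_form_eigenvalue)

section \<open>Existence of an orthonormal eigenbasis\<close>

text \<open>The matrix with rows \<open>f j\<close> (conjugated) for \<open>j\<close> in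
  \<open>J\<close> and zero rows elsewhere has a zero row at \<open>i\<close>, so it is not
  invertible and has a nonzero kernel vector.\<close>

lemma exists_orthogonal:
  fixes f :: "'n::finite \<Rightarrow> complex^'n"
  assumes "i \<notin> J"
  shows "\<exists>v. v \<noteq> 0 \<and> (\<forall>j\<in>J. cinner (f j) v = 0)"
proof (rule ccontr)
  define A :: "'n op" where "A = (\<chi> j k. if j \<in> J then cnj (f j $ k) else 0)"
  assume "\<not> ?thesis"
  then have *: "v = 0" if "\<forall>j\<in>J. cinner (f j) v = 0" for v using that by blast
  have "v = 0" if "A *v v = 0" for v
  proof (rule *, rule ballI)
    fix j assume "j \<in> J"
    then have "(A *v v) $ j = cinner (f j) v"
      by (simp add: A_def matrix_vector_mult_def cinner_def)
    then show "cinner (f j) v = 0" using that by simp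
  qed
  then obtain B where "B ** A = mat 1"
    using matrix_left_invertible_ker[of A] by blast
  then have "A ** B = mat 1" by (simp add: matrix_left_right_inverse)
  then have "(A ** B) $ i $ i = 1" by (simp add: mat_def)
  then show False using assms by (simp add: A_def matrix_matrix_mult_def)
qed

lemma Re_cinner_inner: "Re (cinner v w) = v \<bullet> w"
  by (simp add: cinner_def inner_vec_def inner_complex_def)

text \<open>The new eigenvector maximises the quadratic form of \<open>A\<close> on the unit sphere of the
  orthogonal complement of the given ones.\<close>

lemma exists_eigenvector:
  fixes A :: "'n::finite op" and f :: "'n \<Rightarrow> complex^'n"
  assumes A: "adj A = A" and i: "i \<notin> J"
    and f: "\<And>j. j \<in> J \<Longrightarrow> A *v f j = of_real (l j) *s f j"
  shows "\<exists>v m. norm v = 1 \<and> (\<forall>j\<in>J. cinner (f j) v = 0) \<and> A *v v = of_real m *s v"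
proof -
  define W where "W = {v. \<forall>j\<in>J. cinner (f j) v = 0}"
  have W_scale: "c *s v \<in> W" if "v \<in> W" for c v using that by (simp add: W_def cinner_scale_right)
  have W_add: "v + w \<in> W" if "v \<in> W" "w \<in> W" for v w using that by (simp add: W_def cinner_add_right)
  \<comment> \<open>The complement \<open>W\<close> is invariant because \<open>A\<close> is
    self-adjoint and the \<open>f j\<close> are eigenvectors.\<close>
  have W_A: "A *v v \<in> W" if "v \<in> W" for v
    using that A f by (auto simp: W_def cinner_mult_right cinner_scale_left)
  have scaleR: "r *\<^sub>R v = of_real r *s v" for r and v :: "complex^'n"
    unfolding vec_eq_iff vector_scaleR_component vector_smult_component
    by (simp add: scaleR_conv_of_real)
  have cont: "continuous_on S (\<lambda>v. cinner (g v) (h v))"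
    if "continuous_on S g" "continuous_on S h" for S and g h :: "complex^'n \<Rightarrow> complex^'n"
    unfolding cinner_def using that by (intro continuous_intros)
  have contA: "continuous_on S (\<lambda>v. A *v v)" for S
    by (simp add: linear_continuous_on)
  obtain v0 where v0: "v0 \<noteq> 0" "v0 \<in> W" using exists_orthogonal[OF i] unfolding W_def by blast
  have closedW: "closed W"
  proof -
    have "W = (\<Inter>j\<in>J. {v. cinner (f j) v = 0})" by (auto simp: W_def)
    moreover have "closed {v. cinner (f j) v = 0}" for j
      by (intro closed_Collect_eq cont continuous_intros)
    ultimately show ?thesis by auto
  qed
  have comp: "compact (W \<inter> sphere 0 1)"
    using closedW by (simp add: closed_Int_compact)
  have unit: "(1 / norm w) *\<^sub>R w \<in> W" "norm ((1 / norm w) *\<^sub>R w) = 1" if "w \<noteq> 0" "w \<in> W" for w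
  proof -
    show "(1 / norm w) *\<^sub>R w \<in> W" unfolding scaleR by (rule W_scale[OF that(2)])
    show "norm ((1 / norm w) *\<^sub>R w) = 1" using that by simp
  qed
  have "(1 / norm v0) *\<^sub>R v0 \<in> W \<inter> sphere 0 1"
    using unit[OF v0] by simp
  then have ne: "W \<inter> sphere 0 1 \<noteq> {}" by blast
  have "continuous_on (W \<inter> sphere 0 1) (\<lambda>v. Re (cinner v (A *v v)))"
    by (intro continuous_on_Re cont contA continuous_intros)
  from continuous_attains_sup[OF comp ne this] obtain v where v': "v \<in> W \<inter> sphere 0 1"
    and max': "\<forall>w\<in>W \<inter> sphere 0 1. Re (cinner w (A *v w)) \<le> Re (cinner v (A *v v))"
    by blast
  have v: "v \<in> W" "norm v = 1"
    and max: "\<And>w. w \<in> W \<Longrightarrow> norm w = 1 \<Longrightarrow> Re (cinner w (A *v w)) \<le> Re (cinner v (A *v v))"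
    using v' max' by auto
  define m where "m = Re (cinner v (A *v v))"
  \<comment> \<open>By maximality of \<open>m\<close>, the form \<open>q\<close> of
    \<open>m - A\<close> is nonnegative on \<open>W\<close> and vanishes at \<open>v\<close>; the
    rest shows that this forces \<open>B v = 0\<close>.\<close>
  define B where "B w = of_real m *s w - A *v w" for w
  define q where "q w = Re (cinner w (B w))" for w
  have q_pos: "0 \<le> q w" if "w \<in> W" for w
  proof (cases "w = 0")
    case True
    then show ?thesis by (simp add: q_def)
  next
    case False
    define u where "u = (1 / norm w) *\<^sub>R w"
    have u: "u \<in> W" "norm u = 1" using unit[OF False that] by (simp_all add: u_def)
    have w: "w = of_real (norm w) *s u"
      using False unfolding scaleR[symmetric] by (simp add: u_def)
    have "Re (cinner w (A *v w)) = (norm w)\<^sup>2 * Re (cinner u (A *v u))"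
    proof -
      have "A *v w = of_real (norm w) *s (A *v u)"
        by (subst w) (simp add: matrix_vector_mult_def vec_eq_iff sum_distrib_left algebra_simps)
      then have "cinner w (A *v w) = of_real (norm w) * (of_real (norm w) * cinner u (A *v u))"
        by (subst w) (simp add: cinner_scale_left cinner_scale_right)
      then show ?thesis by (simp add: power2_eq_square)
    qed
    also have "\<dots> \<le> (norm w)\<^sup>2 * m" using max[OF u] by (simp add: m_def mult_left_mono)
    finally show ?thesis
      by (simp add: q_def B_def cinner_diff_right cinner_scale_right cinner_self algebra_simps flip: of_real_power)
  qed
  have qv: "q v = 0"
    using v by (simp add: q_def B_def cinner_diff_right cinner_scale_right cinner_self m_def)
  have B_add: "B (x + y) = B x + B y" for x y
    by (simp add: B_def matrix_vector_right_distrib vector_add_ldistrib algebra_simps)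
  have B_scale: "B (c *s x) = c *s B x" for c x
    by (simp add: B_def vec_eq_iff matrix_vector_mult_def sum_distrib_left algebra_simps)
  have B_sym: "cinner x (B y) = cinner (B x) y" for x y
    by (simp add: B_def cinner_diff_right cinner_scale_right cinner_mult_right A)
       (simp add: cinner_def algebra_simps sum_subtractf sum_distrib_left)
  define w where "w = B v"
  have wW: "w \<in> W"
    using v W_A[OF v(1)] by (auto simp: w_def B_def W_def cinner_diff_right cinner_scale_right)
  \<comment> \<open>Perturb the minimiser \<open>v\<close> of \<open>q\<close> in the direction
    \<open>w = B v\<close>, which stays in \<open>W\<close>. The linear coefficient is a multiple of
    the squared norm of \<open>w\<close>, so it must vanish.\<close>
  have "q (v + of_real t *s w) = 2 * t * (norm w)\<^sup>2 + t\<^sup>2 * q w" for t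
  proof -
    have "cinner (v + of_real t *s w) (B (v + of_real t *s w)) =
       cinner v (B v) + of_real t * cinner v (B w) + of_real t * cinner w (B v)
         + of_real (t\<^sup>2) * cinner w (B w)"
      by (simp add: B_add B_scale cinner_add_left cinner_add_right cinner_scale_left cinner_scale_right
          power2_eq_square algebra_simps)
    also have "cinner v (B w) = of_real ((norm w)\<^sup>2)"
      unfolding B_sym w_def[symmetric] by (rule cinner_self)
    also have "cinner w (B v) = of_real ((norm w)\<^sup>2)"
      unfolding w_def[symmetric] by (rule cinner_self)
    finally have eq: "cinner (v + of_real t *s w) (B (v + of_real t *s w)) =
       cinner v (B v) + of_real t * of_real ((norm w)\<^sup>2) + of_real t * of_real ((norm w)\<^sup>2)
         + of_real (t\<^sup>2) * cinner w (B w)" .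
    show ?thesis
      unfolding q_def eq using qv by (simp add: q_def)
  qed
  moreover have "0 \<le> q (v + of_real t *s w)" for t
    by (intro q_pos W_add W_scale v wW)
  ultimately have *: "0 \<le> 2 * t * (norm w)\<^sup>2 + t\<^sup>2 * q w" for t by simp
  have "w = 0"
  proof (rule ccontr)
    assume "w \<noteq> 0"
    then have b: "0 < (norm w)\<^sup>2" by simp
    have c: "0 \<le> q w" using q_pos wW by blast
    \<comment> \<open>At this negative \<open>t\<close> the quadratic term is too small to
      compensate the linear one: the value is \<open>t * (norm w)\<^sup>2 - t\<^sup>2\<close>, which
      is negative.\<close>
    define t where "t = - (norm w)\<^sup>2 / (q w + 1)"
    have "t * (q w + 1) = - (norm w)\<^sup>2" using c by (simp add: t_def)
    then have "t * (t * (q w + 1)) = t * - (norm w)\<^sup>2" by simp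
    then have "t\<^sup>2 * q w = - t * (norm w)\<^sup>2 - t\<^sup>2"
      unfolding power2_eq_square[of t] by (simp add: distrib_left algebra_simps)
    then have "0 \<le> t * (norm w)\<^sup>2 - t\<^sup>2" using *[of t] by simp
    moreover have "t < 0" using b c by (simp add: t_def)
    moreover have "t * (norm w)\<^sup>2 < 0" using b \<open>t < 0\<close> by (rule mult_neg_pos[rotated])
    ultimately show False using zero_le_power2[of t] by linarith
  qed
  then have "A *v v = of_real m *s v" by (simp add: w_def B_def)
  then show ?thesis using v by (auto simp: W_def)
qed

text \<open>Orthonormal eigenvectors are collected by induction over subsets of the index type. At
  \<open>UNIV\<close> they carry the indices of the columns of a square matrix, which becomes
  \<open>U\<close>.\<close>

lemma spectral_theorem:
  fixes A :: "'n::finite op"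
  assumes A: "adj A = A"
  obtains U l where "U \<in> unitary_group" "A = spectral_form U l"
proof -
  have "\<exists>f l. \<forall>j\<in>J. A *v f j = of_real (l j) *s f j \<and>
      (\<forall>k\<in>J. cinner (f j) (f k) = (if j = k then 1 else 0))" for J :: "'n set"
  proof (induction J rule: finite_induct[OF finite])
    case 1
    then show ?case by simp
  next
    case (2 i J)
    then obtain f l where fl: "\<And>j. j \<in> J \<Longrightarrow> A *v f j = of_real (l j) *s f j"
      "\<And>j k. j \<in> J \<Longrightarrow> k \<in> J \<Longrightarrow> cinner (f j) (f k) = (if j = k then 1 else 0)" by blast
    obtain v m where v: "norm v = 1" "\<forall>j\<in>J. cinner (f j) v = 0" "A *v v = of_real m *s v"
      using exists_eigenvector[of A i J f l] A 2(2) fl(1) by blast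
    have vv: "cinner v v = 1" using v(1) by (simp add: cinner_self)
    have "\<forall>j\<in>J. cinner v (f j) = 0" using v(2) by (metis cinner_commute complex_cnj_zero)
    then have "\<forall>j\<in>insert i J. A *v (f(i := v)) j = of_real ((l(i := m)) j) *s (f(i := v)) j \<and>
      (\<forall>k\<in>insert i J. cinner ((f(i := v)) j) ((f(i := v)) k) = (if j = k then 1 else 0))"
      using fl v 2(2) vv by auto
    then show ?case by blast
  qed
  from this[of UNIV] obtain f l where "\<forall>j\<in>UNIV::'n set. A *v f j = of_real (l j) *s f j \<and>
      (\<forall>k\<in>UNIV. cinner (f j) (f k) = (if j = k then 1 else 0))"
    by (elim exE)
  then have f: "\<And>j. A *v f j = of_real (l j) *s f j"
    and o: "\<And>j k. cinner (f j) (f k) = (if j = k then 1 else 0)"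
    by simp_all
  define U :: "'n op" where "U = (\<chi> a j. f j $ a)"
  have "adj U ** U = mat 1"
    using o by (auto simp: vec_eq_iff matrix_matrix_mult_def U_def mat_def cinner_def)
  then have U: "U \<in> unitary_group" by (rule unitaryI)
  have "A ** U = U ** real_diag l"
    using f by (simp add: vec_eq_iff real_diag_mult_right) (simp add: U_def matrix_matrix_mult_def matrix_vector_mult_def algebra_simps)
  then have "A = spectral_form U l"
    unfolding spectral_form_def by (metis unitaryD(2)[OF U] matrix_mul_assoc matrix_mul_rid)
  with U show ?thesis by (rule that)
qed

section \<open>Trace norm and positive square roots\<close>


lemma psd_obtain_spectral_form:
  assumes "psd A"
  obtains U l where "U \<in> unitary_group" "A = spectral_form U l" "\<And>i. 0 \<le> l i"
proof -
  obtain U l where "U \<in> unitary_group" "A = spectral_form U l"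
    using spectral_theorem[OF psd_hermitian[OF assms]] .
  with assms spectral_form_psdD show ?thesis by (intro that) auto
qed

lemma psd_congruence:
  assumes "psd A"
  shows "psd (adj B ** A ** B)"
proof -
  have "cinner v ((adj B ** A ** B) *v v) = cinner (B *v v) (A *v (B *v v))" for v
    by (simp add: matrix_vector_mul_assoc[symmetric] cinner_mult_right[of v])
  then show ?thesis
    using assms by (simp add: psd_def adj_mult matrix_mul_assoc)
qed

lemma trace_psd_nonneg: "psd A \<Longrightarrow> 0 \<le> Re (trace A)"
  by (erule psd_obtain_spectral_form) (simp add: trace_spectral_form sum_nonneg)

text \<open>Uniqueness of the positive square root, on which the description by \<open>THE\<close>
  rests. The overlap matrix \<open>X\<close> of the two eigenbases intertwines the squared
  eigenvalues; since these come from nonnegative numbers, each nonzero entry of \<open>X\<close>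
  also identifies the eigenvalues themselves.\<close>

lemma psd_square_inject:
  assumes "psd B" "psd C" and eq: "B ** B = C ** C"
  shows "B = C"
proof -
  obtain V d where V: "V \<in> unitary_group" and B: "B = spectral_form V d" and d: "\<And>i. 0 \<le> d i"
    by (rule psd_obtain_spectral_form[OF assms(1)]) blast
  obtain W e where W: "W \<in> unitary_group" and C: "C = spectral_form W e" and e: "\<And>i. 0 \<le> e i"
    by (rule psd_obtain_spectral_form[OF assms(2)]) blast
  define X where "X = adj W ** V"
  have eq': "V ** real_diag (\<lambda>i. d i * d i) ** adj V = W ** real_diag (\<lambda>i. e i * e i) ** adj W"
    using eq by (simp add: B C spectral_form_mult[OF V] spectral_form_mult[OF W]) (simp add: spectral_form_def)
  have "X ** real_diag (\<lambda>i. d i * d i) = adj W ** (V ** real_diag (\<lambda>i. d i * d i) ** adj V) ** V"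
    by (simp add: X_def matrix_mul_assoc[symmetric] unitaryD[OF V])
  also have "\<dots> = (adj W ** W) ** real_diag (\<lambda>i. e i * e i) ** (adj W ** V)"
    unfolding eq' by (simp add: matrix_mul_assoc)
  finally have *: "X ** real_diag (\<lambda>i. d i * d i) = real_diag (\<lambda>i. e i * e i) ** X"
    by (simp add: unitaryD[OF W] X_def)
  have "X $ i $ j * of_real (d j) = of_real (e i) * X $ i $ j" for i j
  proof -
    have "X $ i $ j * of_real (d j * d j) = of_real (e i * e i) * X $ i $ j"
      using arg_cong[OF *, of "\<lambda>M. M $ i $ j"] unfolding real_diag_mult_left real_diag_mult_right .
    then have "X $ i $ j = 0 \<or> complex_of_real (d j * d j) = of_real (e i * e i)" by auto
    then have "X $ i $ j = 0 \<or> d j * d j = e i * e i" by (simp only: of_real_eq_iff)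
    then have "X $ i $ j = 0 \<or> d j = e i"
      using d e power2_eq_iff_nonneg[of "d j" "e i"] by (simp add: power2_eq_square)
    then show ?thesis by auto
  qed
  then have X: "X ** real_diag d = real_diag e ** X"
    by (simp add: vec_eq_iff real_diag_mult_left real_diag_mult_right)
  have "B = (W ** adj W) ** V ** real_diag d ** adj V"
    by (simp add: B spectral_form_def unitaryD[OF W])
  also have "\<dots> = W ** (X ** real_diag d) ** adj V"
    by (simp add: X_def matrix_mul_assoc)
  also have "\<dots> = W ** real_diag e ** adj W ** (V ** adj V)"
    unfolding X by (simp add: X_def matrix_mul_assoc)
  also have "\<dots> = C"
    by (simp add: C spectral_form_def unitaryD[OF V])
  finally show ?thesis .
qed

lemma mat_sqrt_eqI:
  assumes "psd B" "B ** B = A"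
  shows "mat_sqrt A = B"
  unfolding mat_sqrt_def using assms psd_square_inject by (intro the_equality) blast+

lemma mat_sqrt_spectral_form:
  assumes "\<And>i. 0 \<le> l i" "U \<in> unitary_group"
  shows "mat_sqrt (spectral_form U l) = spectral_form U (\<lambda>i. sqrt (l i))"
  using assms by (intro mat_sqrt_eqI psd_spectral_form) (simp_all add: spectral_form_mult)

lemma mat_sqrt:
  assumes "psd A"
  shows "psd (mat_sqrt A)" "mat_sqrt A ** mat_sqrt A = A"
proof -
  obtain U l where "U \<in> unitary_group" "A = spectral_form U l" "\<And>i. 0 \<le> l i"
    by (rule psd_obtain_spectral_form[OF assms]) blast
  then show "psd (mat_sqrt A)" "mat_sqrt A ** mat_sqrt A = A"
    by (simp_all add: mat_sqrt_spectral_form psd_spectral_form spectral_form_mult)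
qed

text \<open>The convention \<open>inverse 0 = 0\<close> makes the entrywise inverse satisfy the four
  Penrose equations on the kernel too. Uniqueness is Penrose's argument: the equations determine
  \<open>A ** X\<close> and \<open>X ** A\<close>, and these determine \<open>X\<close>.\<close>

lemma pseudoinverse_spectral_form:
  assumes U: "U \<in> unitary_group"
  shows "pseudoinverse (spectral_form U s) = spectral_form U (\<lambda>i. inverse (s i))"
  unfolding pseudoinverse_def
proof (rule the_equality)
  let ?A = "spectral_form U s" and ?P = "spectral_form U (\<lambda>i. inverse (s i))"
  have e: "s i * inverse (s i) * s i = s i" "inverse (s i) * s i * inverse (s i) = inverse (s i)" for i
    by (cases "s i = 0"; simp)+
  show P: "?A ** ?P ** ?A = ?A \<and> ?P ** ?A ** ?P = ?P \<and>
     adj (?A ** ?P) = ?A ** ?P \<and> adj (?P ** ?A) = ?P ** ?A"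
    unfolding spectral_form_mult[OF U] e by simp
  fix X
  assume X: "?A ** X ** ?A = ?A \<and> X ** ?A ** X = X \<and> adj (?A ** X) = ?A ** X \<and> adj (X ** ?A) = X ** ?A"
  have 1: "?A ** X = ?A ** ?P"
  proof -
    have "?A ** X = adj ((?A ** ?P ** ?A) ** X)" using X P by metis
    also have "\<dots> = adj (?A ** X) ** adj (?A ** ?P)"
      by (simp only: adj_mult matrix_mul_assoc)
    also have "\<dots> = (?A ** X ** ?A) ** ?P"
      using X P by (simp only: matrix_mul_assoc)
    finally show ?thesis using X by simp
  qed
  have 2: "X ** ?A = ?P ** ?A"
  proof -
    have "X ** ?A = adj (X ** (?A ** ?P ** ?A))" using X P by metis
    also have "\<dots> = adj (?P ** ?A) ** adj (X ** ?A)"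
      by (simp only: adj_mult matrix_mul_assoc)
    also have "\<dots> = ?P ** (?A ** X ** ?A)"
      using X P by (metis matrix_mul_assoc)
    finally show ?thesis using X by simp
  qed
  have "X = X ** (?A ** X)" using X by (simp only: matrix_mul_assoc)
  also have "\<dots> = (X ** ?A) ** ?P" unfolding 1 by (simp only: matrix_mul_assoc)
  also have "\<dots> = ?P" unfolding 2 using P by (simp only:)
  finally show "X = ?P" .
qed

section \<open>The trace norm of Hermitian matrices\<close>

lemma trace_norm_spectral_form:
  assumes U: "U \<in> unitary_group"
  shows "trace_norm (spectral_form U l) = (\<Sum>i\<in>UNIV. \<bar>l i\<bar>)"
  using U by (simp add: trace_norm_def spectral_form_mult mat_sqrt_spectral_form trace_spectral_form)

lemma trace_norm_psd: "psd A \<Longrightarrow> trace_norm A = Re (trace A)"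
  by (erule psd_obtain_spectral_form) (simp add: trace_norm_spectral_form trace_spectral_form)

lemma cmod_unitary_le_1:
  assumes "U \<in> unitary_group"
  shows "cmod (U $ i $ j) \<le> 1"
proof -
  have "(\<Sum>k\<in>UNIV. U $ i $ k * cnj (U $ i $ k)) = 1"
    using arg_cong[OF unitaryD(2)[OF assms], of "\<lambda>M. M $ i $ i"]
    by (simp add: matrix_matrix_mult_def mat_def)
  then have "complex_of_real (\<Sum>k\<in>UNIV. (cmod (U $ i $ k))\<^sup>2) = of_real 1"
    by (simp add: complex_norm_square del: of_real_power)
  then have "(\<Sum>k\<in>UNIV. (cmod (U $ i $ k))\<^sup>2) = 1" by (simp only: of_real_eq_iff)
  then have "(cmod (U $ i $ j))\<^sup>2 \<le> 1"
    using member_le_sum[of j UNIV "\<lambda>k. (cmod (U $ i $ k))\<^sup>2"] by simp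
  then show ?thesis by (simp add: power_le_one_iff abs_square_le_1)
qed

text \<open>One half of the variational formula for the trace norm. In the eigenbasis of
  \<open>M\<close> only the diagonal entries of the rotated unitary meet the eigenvalues, and they
  have modulus at most 1.\<close>

lemma Re_trace_unitary_le_trace_norm:
  assumes "adj M = M" "W \<in> unitary_group"
  shows "Re (trace (W ** M)) \<le> trace_norm M"
proof -
  obtain U l where U: "U \<in> unitary_group" and M: "M = spectral_form U l"
    using spectral_theorem[OF assms(1)] .
  define V where "V = adj U ** W ** U"
  have V: "V \<in> unitary_group"
    unfolding V_def by (intro unitary_mult unitary_adj U assms)
  have "trace (W ** M) = trace ((W ** U ** real_diag l) ** adj U)"
    by (simp add: M spectral_form_def matrix_mul_assoc)
  also have "\<dots> = trace (V ** real_diag l)"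
    by (subst trace_mul_sym) (simp add: V_def matrix_mul_assoc)
  also have "Re \<dots> = (\<Sum>i\<in>UNIV. Re (V $ i $ i) * l i)"
    by (simp add: trace_def real_diag_mult_right)
  also have "\<dots> \<le> (\<Sum>i\<in>UNIV. \<bar>l i\<bar>)"
  proof (rule sum_mono)
    fix i
    have "\<bar>Re (V $ i $ i)\<bar> \<le> 1"
      using cmod_unitary_le_1[OF V, of i i] abs_Re_le_cmod order_trans by blast
    then have "\<bar>Re (V $ i $ i)\<bar> * \<bar>l i\<bar> \<le> 1 * \<bar>l i\<bar>" by (intro mult_right_mono) auto
    then show "Re (V $ i $ i) * l i \<le> \<bar>l i\<bar>"
      by (metis abs_ge_self abs_mult mult_1 order_trans)
  qed
  finally show ?thesis by (simp add: M trace_norm_spectral_form U)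
qed

text \<open>The other half of the variational formula. The maximiser is the sign of
  \<open>M\<close>, with value 1 on the kernel so that it is unitary.\<close>

lemma trace_norm_attained:
  assumes "adj M = M"
  obtains W where "W \<in> unitary_group" "trace_norm M = Re (trace (W ** M))"
proof -
  obtain U l where U: "U \<in> unitary_group" and M: "M = spectral_form U l"
    using spectral_theorem[OF assms(1)] .
  define W where "W = spectral_form U (\<lambda>i. if 0 \<le> l i then 1 else - 1)"
  have "W ** W = spectral_form U (\<lambda>_. 1)"
    unfolding W_def spectral_form_mult[OF U] by (intro arg_cong[of _ _ "spectral_form U"]) auto
  then have "W \<in> unitary_group" by (intro unitaryI) (simp add: W_def spectral_form_1 U)
  moreover have "W ** M = spectral_form U (\<lambda>i. \<bar>l i\<bar>)"
    unfolding W_def M spectral_form_mult[OF U] by (intro arg_cong[of _ _ "spectral_form U"]) auto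
  then have "trace_norm M = Re (trace (W ** M))" by (simp add: M trace_norm_spectral_form trace_spectral_form U)
  ultimately show ?thesis by (rule that)
qed

lemma trace_norm_triangle:
  assumes "adj A = A" "adj B = B"
  shows "trace_norm (A + B) \<le> trace_norm A + trace_norm B"
proof -
  have "adj (A + B) = A + B" by (simp add: adj_add assms)
  then obtain W where W: "W \<in> unitary_group" "trace_norm (A + B) = Re (trace (W ** (A + B)))"
    by (rule trace_norm_attained)
  then have "trace_norm (A + B) = Re (trace (W ** A)) + Re (trace (W ** B))"
    by (simp add: matrix_add_ldistrib trace_add)
  also have "\<dots> \<le> trace_norm A + trace_norm B"
    using Re_trace_unitary_le_trace_norm[OF assms(1) W(1)] Re_trace_unitary_le_trace_norm[OF assms(2) W(1)]
    by simp
  finally show ?thesis .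
qed

lemma trace_norm_uminus [simp]: "trace_norm (- A) = trace_norm A"
proof -
  have "adj (- A) ** (- A) = adj A ** A"
    by (simp add: vec_eq_iff matrix_matrix_mult_def)
  then show ?thesis by (simp add: trace_norm_def)
qed

lemma trace_norm_diff:
  assumes "adj A = A" "adj B = B"
  shows "trace_norm (A - B) \<le> trace_norm A + trace_norm B"
proof -
  have "adj (- B) = - B" using assms(2) by (simp add: vec_eq_iff)
  then show ?thesis using trace_norm_triangle[OF assms(1), of "- B"] by simp
qed

lemma trace_mscale: "trace (mscale c A) = c * trace A"
  by (simp add: trace_def sum_distrib_left)

text \<open>\<open>Z\<close> is the difference, and \<open>B\<close> the sum, of the positive
  matrices \<open>(B + Z) / 2\<close> and \<open>(B - Z) / 2\<close>. This replaces a trace norm by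
  a trace, which is linear and can be averaged exactly.\<close>

lemma trace_norm_dominated:
  assumes "psd (B + Z)" "psd (B - Z)"
  shows "trace_norm Z \<le> Re (trace B)" "adj Z = Z"
proof -
  define X where "X = mscale (of_real (1/2)) (B + Z)"
  define Y where "Y = mscale (of_real (1/2)) (B - Z)"
  have XY: "psd X" "psd Y" unfolding X_def Y_def by (intro psd_mscale assms; simp)+
  have Z: "Z = X - Y" and B: "B = X + Y" by (simp_all add: vec_eq_iff X_def Y_def field_simps)
  show "trace_norm Z \<le> Re (trace B)"
    unfolding Z B trace_add
    using trace_norm_diff[OF XY[THEN psd_hermitian]] XY by (simp add: trace_norm_psd)
  show "adj Z = Z" unfolding Z by (simp add: adj_diff XY[THEN psd_hermitian])
qed

lemma Jordan_decomposition:
  assumes "adj M = M"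
  obtains P N where "psd P" "psd N" "M = P - N" "Re (trace P) + Re (trace N) = trace_norm M"
proof -
  obtain U l where U: "U \<in> unitary_group" and M: "M = spectral_form U l"
    using spectral_theorem[OF assms(1)] .
  show ?thesis
  proof (rule that)
    show "psd (spectral_form U (\<lambda>i. max (l i) 0))" "psd (spectral_form U (\<lambda>i. max (- l i) 0))"
      by (intro psd_spectral_form U; simp)+
    show "M = spectral_form U (\<lambda>i. max (l i) 0) - spectral_form U (\<lambda>i. max (- l i) 0)"
      unfolding spectral_form_diff M by (intro arg_cong[of _ _ "spectral_form U"]) auto
    show "Re (trace (spectral_form U (\<lambda>i. max (l i) 0))) + Re (trace (spectral_form U (\<lambda>i. max (- l i) 0))) = trace_norm M"
      unfolding M trace_norm_spectral_form[OF U] trace_spectral_form[OF U]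
      by (simp flip: sum.distrib) (intro sum.cong, auto)
  qed
qed

section \<open>Hilbert-Schmidt norms and factorisation through a square root\<close>

text \<open>The Hilbert-Schmidt norm is kept squared, because its mean is then a second
  moment.\<close>

definition hs_sq :: "'n::finite op \<Rightarrow> real" where
  "hs_sq M = (\<Sum>i\<in>UNIV. \<Sum>j\<in>UNIV. (cmod (M $ i $ j))\<^sup>2)"

lemma hs_sq_nonneg: "0 \<le> hs_sq M"
  by (simp add: hs_sq_def sum_nonneg)

lemma trace_adj_mult: "trace (adj M ** M) = of_real (hs_sq M)"
proof -
  have "trace (adj M ** M) = (\<Sum>j\<in>UNIV. \<Sum>i\<in>UNIV. of_real ((cmod (M $ i $ j))\<^sup>2))"
    by (simp add: trace_def matrix_matrix_mult_def complex_norm_square mult.commute del: of_real_power)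
  also have "\<dots> = of_real (hs_sq M)"
    unfolding hs_sq_def by (subst sum.swap) simp
  finally show ?thesis .
qed

lemma hs_sq_unitary:
  assumes "W \<in> unitary_group"
  shows "hs_sq (W ** K) = hs_sq K"
proof -
  have "adj (W ** K) ** (W ** K) = adj K ** (adj W ** W) ** K"
    by (simp add: adj_mult matrix_mul_assoc)
  then have "complex_of_real (hs_sq (W ** K)) = of_real (hs_sq K)"
    using assms by (simp add: unitaryD flip: trace_adj_mult)
  then show ?thesis by (simp only: of_real_eq_iff)
qed

text \<open>Cauchy-Schwarz for the Hilbert-Schmidt inner product, after the maximising unitary has
  been absorbed into \<open>K\<close>. It is weakened by the arithmetic-geometric mean inequality
  with free parameter \<open>s\<close>, so that the bound is affine in \<open>hs_sq Y\<close> and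
  integrates without Jensen's inequality.\<close>

lemma trace_norm_mult_le:
  assumes "adj (K ** Y) = K ** Y" "hs_sq K \<le> 1" "0 < s"
  shows "trace_norm (K ** Y) \<le> (s + hs_sq Y / s) / 2"
proof -
  obtain W where W: "W \<in> unitary_group" "trace_norm (K ** Y) = Re (trace (W ** (K ** Y)))"
    using trace_norm_attained[OF assms(1)] .
  define V where "V = W ** K"
  have "trace_norm (K ** Y) = (\<Sum>i\<in>UNIV. \<Sum>j\<in>UNIV. Re (V $ i $ j * Y $ j $ i))"
    by (simp add: W(2) matrix_mul_assoc flip: V_def) (simp add: trace_def matrix_matrix_mult_def)
  also have "\<dots> \<le> (\<Sum>i\<in>UNIV. \<Sum>j\<in>UNIV. (s * (cmod (V $ i $ j))\<^sup>2 + (cmod (Y $ j $ i))\<^sup>2 / s) / 2)"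
  proof (intro sum_mono)
    fix i j
    define a b where "a = cmod (V $ i $ j)" and "b = cmod (Y $ j $ i)"
    have "Re (V $ i $ j * Y $ j $ i) \<le> a * b"
      unfolding a_def b_def norm_mult[symmetric] by (rule complex_Re_le_cmod)
    also have "a * b \<le> (s * a\<^sup>2 + b\<^sup>2 / s) / 2"
      using assms(3) zero_le_power2[of "s * a - b"] by (simp add: field_simps power2_eq_square)
    finally show "Re (V $ i $ j * Y $ j $ i) \<le> (s * (cmod (V $ i $ j))\<^sup>2 + (cmod (Y $ j $ i))\<^sup>2 / s) / 2"
      by (simp add: a_def b_def)
  qed
  also have "\<dots> = (s * hs_sq V + (\<Sum>i\<in>UNIV. \<Sum>j\<in>UNIV. (cmod (Y $ j $ i))\<^sup>2) / s) / 2"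
    by (simp add: hs_sq_def sum.distrib sum_distrib_left flip: sum_divide_distrib)
  also have "(\<Sum>i\<in>UNIV. \<Sum>j\<in>UNIV. (cmod (Y $ j $ i))\<^sup>2) = hs_sq Y"
    unfolding hs_sq_def by (rule sum.swap)
  also have "hs_sq V = hs_sq K" unfolding V_def by (rule hs_sq_unitary[OF W(1)])
  also have "s * hs_sq K \<le> s * 1" using assms by (intro mult_left_mono) auto
  finally show ?thesis by simp
qed

lemma matrix_sub_rdistrib: "((B - C) ** A) = (B ** A) - (C ** A :: 'n::finite op)"
  by (simp add: vec_eq_iff matrix_matrix_mult_def sum_subtractf algebra_simps)

lemma matrix_sub_ldistrib: "(A ** (B - C)) = (A ** B) - (A ** C :: 'n::finite op)"
  by (simp add: vec_eq_iff matrix_matrix_mult_def sum_subtractf algebra_simps)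

lemma norm_unitary: 
  assumes "U \<in> unitary_group"
  shows "norm (U *v v) = norm v"
proof -
  have "cinner (U *v v) (U *v v) = cinner v v"
    using assms by (simp add: cinner_mult_right matrix_vector_mul_assoc unitaryD)
  then have "complex_of_real ((norm (U *v v))\<^sup>2) = of_real ((norm v)\<^sup>2)"
    by (simp only: cinner_self)
  then show ?thesis by (simp only: of_real_eq_iff power2_eq_iff_nonneg norm_ge_zero)
qed

lemma eigenvalue_le_op_norm:
  assumes "U \<in> unitary_group"
  shows "l i \<le> op_norm (spectral_form U l)"
proof -
  let ?v = "U *v axis i 1"
  have n: "norm ?v = 1" using norm_unitary[OF assms] by simp
  have "l i = ?v \<bullet> (spectral_form U l *v ?v)"
    unfolding Re_cinner_inner[symmetric] spectral_form_eigenvalue[OF assms] by simp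
  also have "\<dots> \<le> norm ?v * norm (spectral_form U l *v ?v)" by (rule norm_cauchy_schwarz)
  also have "\<dots> \<le> op_norm (spectral_form U l)"
    unfolding n op_norm_def using onorm[OF matrix_vector_mul_bounded_linear, of "spectral_form U l" ?v] n by simp
  finally show ?thesis .
qed

lemma op_norm_nonneg: "0 \<le> op_norm M"
  unfolding op_norm_def by (rule onorm_pos_le[OF matrix_vector_mul_bounded_linear])

text \<open>With \<open>M = P ** \<alpha> ** P\<close>, the support condition gives \<alpha> = S M S
  and hence P \<alpha> = M S. The norm bound is the trace of S M^2 S \<le> x S M S, where x is the
  operator norm of \<open>M\<close>.\<close>

lemma supp_factorisation:
  fixes \<alpha> \<beta> :: "'n::finite op"
  assumes "psd \<alpha>" "psd \<beta>" and supp: "supp \<alpha> \<subseteq> supp \<beta>"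
  defines "S \<equiv> mat_sqrt \<beta>"
  defines "P \<equiv> pseudoinverse S"
  shows "\<alpha> = S ** (P ** \<alpha>)" "hs_sq (P ** \<alpha>) \<le> op_norm (P ** \<alpha> ** P) * Re (trace \<alpha>)"
proof -
  obtain U l where U: "U \<in> unitary_group" and \<beta>: "\<beta> = spectral_form U l" and l: "\<And>i. 0 \<le> l i"
    by (rule psd_obtain_spectral_form[OF assms(2)]) blast
  have S: "S = spectral_form U (\<lambda>i. sqrt (l i))" unfolding S_def \<beta> by (rule mat_sqrt_spectral_form[OF l U])
  have P: "P = spectral_form U (\<lambda>i. inverse (sqrt (l i)))" unfolding P_def S by (rule pseudoinverse_spectral_form[OF U])
  have adjS: "adj S = S" and adjP: "adj P = P" by (simp_all add: S P)
  have SP: "S ** P = P ** S" by (simp add: S P spectral_form_mult U mult.commute)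
  have PSP: "P ** S ** P = P"
    unfolding S P spectral_form_mult[OF U] by (intro arg_cong[of _ _ "spectral_form U"] ext) (metis left_inverse mult_1 mult_zero_right inverse_zero)
  \<comment> \<open>The projection onto the kernel of \<beta>; the support condition says that it
    annihilates \<alpha>.\<close>
  define Q where "Q = mat 1 - S ** P"
  have adjQ: "adj Q = Q" by (simp add: Q_def adj_diff adj_mult adjS adjP SP)
  have "\<beta> ** Q = spectral_form U (\<lambda>_. 0)"
  proof -
    have "l i * (1 - sqrt (l i) * inverse (sqrt (l i))) = 0" for i by (cases "l i = 0") auto
    then have "spectral_form U (\<lambda>i. l i * (1 - sqrt (l i) * inverse (sqrt (l i)))) = spectral_form U (\<lambda>_. 0)"
      by presburger
    then show ?thesis
      unfolding \<beta> Q_def S P spectral_form_1[OF U, symmetric] spectral_form_mult[OF U] spectral_form_diff .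
  qed
  also have "\<dots> = 0" using spectral_form_diff[of U "\<lambda>_. 0" "\<lambda>_. 0"] by simp
  finally have \<beta>Q: "\<beta> *v (Q *v w) = 0" for w by (simp add: matrix_vector_mul_assoc)
  have "Q *v (\<alpha> *v x) = 0" for x
  proof -
    have "\<alpha> *v x \<in> supp \<alpha>"
      by (simp add: supp_def cinner_mult_right psd_hermitian[OF assms(1)])
    then have "cinner (Q *v w) (\<alpha> *v x) = 0" for w using supp \<beta>Q by (auto simp: supp_def)
    then have "cinner w (Q *v (\<alpha> *v x)) = 0" for w by (simp add: cinner_mult_right[of w] adjQ)
    then have "cinner (Q *v (\<alpha> *v x)) (Q *v (\<alpha> *v x)) = 0" by blast
    then show ?thesis by (simp add: cinner_self)
  qed
  then have "(Q ** \<alpha>) *v x = 0 *v x" for x by (simp add: matrix_vector_mul_assoc)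
  then have "Q ** \<alpha> = 0" by (metis matrix_eq)
  moreover have "Q ** \<alpha> = \<alpha> - S ** (P ** \<alpha>)"
    unfolding Q_def by (simp add: vec_eq_iff matrix_mul_assoc matrix_sub_rdistrib)
  ultimately show 1: "\<alpha> = S ** (P ** \<alpha>)" by simp
  have "\<alpha> = adj (S ** (P ** \<alpha>))" using 1 psd_hermitian[OF assms(1)] by simp
  then have 2: "\<alpha> = \<alpha> ** P ** S"
    by (simp add: adj_mult adjS adjP psd_hermitian[OF assms(1)])
  define M where "M = P ** \<alpha> ** P"
  have psdM: "psd M" using psd_congruence[OF assms(1), of P] by (simp add: M_def adjP)
  have \<alpha>: "\<alpha> = S ** M ** S"
  proof -
    have "\<alpha> = S ** P ** (\<alpha> ** P ** S)" using 1 2 by (simp add: matrix_mul_assoc)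
    then show ?thesis by (simp add: M_def matrix_mul_assoc)
  qed
  have P\<alpha>: "P ** \<alpha> = M ** S"
    by (subst 2) (simp add: M_def matrix_mul_assoc)
  obtain V m where V: "V \<in> unitary_group" and M: "M = spectral_form V m" and m: "\<And>i. 0 \<le> m i"
    by (rule psd_obtain_spectral_form[OF psdM]) blast
  define x where "x = op_norm M"
  \<comment> \<open>This is x M - M^2 \<ge> 0, read off from the eigenvalues of \<open>M\<close>,
    which lie between 0 and x.\<close>
  have "psd (spectral_form V (\<lambda>i. (x - m i) * m i))"
    using eigenvalue_le_op_norm[OF V, of m] m by (intro psd_spectral_form V) (simp add: x_def M)
  also have "spectral_form V (\<lambda>i. (x - m i) * m i) = mscale (of_real x) M - M ** M"
  proof -
    have "mscale (of_real x) M = spectral_form V (\<lambda>_. x) ** M"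
    proof -
      have "spectral_form V (\<lambda>_. x) = mscale (of_real x) (spectral_form V (\<lambda>_. 1))"
        by (simp add: vec_eq_iff spectral_form_def matrix_matrix_mult_def[of _ "adj V"] real_diag_mult_right sum_distrib_left algebra_simps)
      then show ?thesis
        by (simp add: spectral_form_1 V vec_eq_iff matrix_matrix_mult_def mat_def if_mult_sum if_distrib[of "\<lambda>z. of_real x * z"] cong: if_cong)
    qed
    then show ?thesis by (simp add: M spectral_form_mult V spectral_form_diff algebra_simps)
  qed
  finally have "psd (adj S ** (mscale (of_real x) M - M ** M) ** S)" by (rule psd_congruence)
  then have "0 \<le> Re (trace (S ** (mscale (of_real x) M - M ** M) ** S))"
    using trace_psd_nonneg adjS by metis
  also have "S ** (mscale (of_real x) M - M ** M) ** S = mscale (of_real x) (S ** M ** S) - S ** (M ** M) ** S"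
    by (simp add: matrix_sub_rdistrib matrix_sub_ldistrib)
       (simp add: vec_eq_iff matrix_matrix_mult_def sum_distrib_left sum_distrib_right algebra_simps)
  also have "S ** (M ** M) ** S = adj (P ** \<alpha>) ** (P ** \<alpha>)"
    unfolding P\<alpha> by (simp add: adj_mult adjS psd_hermitian[OF psdM] matrix_mul_assoc)
  also have "Re (trace (mscale (of_real x) (S ** M ** S) - adj (P ** \<alpha>) ** (P ** \<alpha>)))
      = x * Re (trace \<alpha>) - hs_sq (P ** \<alpha>)"
    by (simp add: trace_sub trace_mscale trace_adj_mult flip: \<alpha>)
  finally show "hs_sq (P ** \<alpha>) \<le> op_norm (P ** \<alpha> ** P) * Re (trace \<alpha>)"
    by (simp add: x_def M_def)
qed

section \<open>Tensor products and kernels\<close>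


lemma sum_UNIV_prod: "(\<Sum>x\<in>UNIV. f x) = (\<Sum>a\<in>UNIV. \<Sum>b\<in>UNIV. f (a, b))"
  for f :: "'a::finite \<times> 'b::finite \<Rightarrow> 'c::comm_monoid_add"
  by (simp add: sum.cartesian_product UNIV_Times_UNIV[symmetric] del: UNIV_Times_UNIV)


lemma tensor_mult: "(A \<otimes>\<^sub>m B) ** (C \<otimes>\<^sub>m D) = (A ** C) \<otimes>\<^sub>m (B ** D)"
  by (simp add: vec_eq_iff matrix_matrix_mult_def sum_UNIV_prod sum_product algebra_simps)

lemma adj_tensor: "adj (A \<otimes>\<^sub>m B) = adj A \<otimes>\<^sub>m adj B"
  by (simp add: vec_eq_iff)

lemma trace_tensor: "trace (A \<otimes>\<^sub>m B) = trace A * trace B"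
  by (simp add: trace_def sum_UNIV_prod sum_product)

lemma psd_tensor:
  assumes "psd A" "psd B"
  shows "psd (A \<otimes>\<^sub>m B)"
proof -
  let ?S = "mat_sqrt A \<otimes>\<^sub>m mat_sqrt B"
  have "adj ?S ** ?S = A \<otimes>\<^sub>m B"
    using assms by (simp add: adj_tensor tensor_mult mat_sqrt psd_hermitian)
  then show ?thesis by (metis psd_adj_mult)
qed


text \<open>The result is a congruence of \<open>M\<close> by the matrix whose column
  \<open>x\<close> is the sum over \<open>p\<close> of the basis vectors \<open>g p x\<close>; the
  vector \<open>w\<close> below is the image of \<open>v\<close> under it. Positivity of
  reindexings, partial traces and contractions are all instances.\<close>

lemma psd_sum_compress:
  fixes M :: "'n::finite op" and g :: "'p::finite \<Rightarrow> 'x::finite \<Rightarrow> 'n"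
  assumes "psd M"
  shows "psd (\<chi> x y. \<Sum>p\<in>UNIV. \<Sum>q\<in>UNIV. M $ g p x $ g q y)"
proof -
  let ?Z = "\<chi> x y. \<Sum>p\<in>UNIV. \<Sum>q\<in>UNIV. M $ g p x $ g q y"
  have M: "cnj (M $ i $ j) = M $ j $ i" for i j
    using arg_cong[OF psd_hermitian[OF assms], of "\<lambda>M. M $ j $ i"] by simp
  have "adj ?Z = ?Z"
    by (simp add: vec_eq_iff M) (intro allI, rule sum.swap)
  moreover have "0 \<le> Re (cinner v (?Z *v v))" for v
  proof -
    define w :: "complex^'n" where
      "w = (\<chi> n. \<Sum>x\<in>UNIV. \<Sum>p\<in>UNIV. (if g p x = n then v $ x else 0))"
    have Mw: "(M *v w) $ n = (\<Sum>y\<in>UNIV. \<Sum>q\<in>UNIV. M $ n $ g q y * v $ y)" for n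
    proof -
      have "(M *v w) $ n = (\<Sum>m\<in>UNIV. \<Sum>y\<in>UNIV. \<Sum>q\<in>UNIV. M $ n $ m * (if g q y = m then v $ y else 0))"
        by (simp add: matrix_vector_mult_def w_def sum_distrib_left)
      also have "\<dots> = (\<Sum>y\<in>UNIV. \<Sum>q\<in>UNIV. \<Sum>m\<in>UNIV. M $ n $ m * (if g q y = m then v $ y else 0))"
        by (subst sum.swap, intro sum.cong refl, subst sum.swap, rule refl)
      also have "\<dots> = (\<Sum>y\<in>UNIV. \<Sum>q\<in>UNIV. M $ n $ g q y * v $ y)"
        by (simp add: if_distrib[of "\<lambda>z. M $ _ $ _ * z"] cong: if_cong)
      finally show ?thesis .
    qed
    have "cinner w z = (\<Sum>x\<in>UNIV. \<Sum>p\<in>UNIV. cnj (v $ x) * z $ g p x)" for z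
    proof -
      have "cinner w z = (\<Sum>m\<in>UNIV. \<Sum>y\<in>UNIV. \<Sum>q\<in>UNIV. (if g q y = m then cnj (v $ y) else 0) * z $ m)"
        by (simp add: cinner_def w_def sum_distrib_right if_distrib[of cnj] cong: if_cong)
      also have "\<dots> = (\<Sum>y\<in>UNIV. \<Sum>q\<in>UNIV. \<Sum>m\<in>UNIV. (if g q y = m then cnj (v $ y) else 0) * z $ m)"
        by (subst sum.swap, intro sum.cong refl, subst sum.swap, rule refl)
      also have "\<dots> = (\<Sum>y\<in>UNIV. \<Sum>q\<in>UNIV. cnj (v $ y) * z $ g q y)"
        by (simp add: if_distrib[of "\<lambda>z. z * _"] cong: if_cong)
      finally show ?thesis .
    qed
    then have "cinner w (M *v w) =
        (\<Sum>x\<in>UNIV. \<Sum>p\<in>UNIV. \<Sum>y\<in>UNIV. \<Sum>q\<in>UNIV. cnj (v $ x) * (M $ g p x $ g q y * v $ y))"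
      by (simp add: Mw sum_distrib_left)
    also have "\<dots> = (\<Sum>x\<in>UNIV. \<Sum>y\<in>UNIV. \<Sum>p\<in>UNIV. \<Sum>q\<in>UNIV. cnj (v $ x) * (M $ g p x $ g q y * v $ y))"
      by (intro sum.cong refl, subst sum.swap, rule refl)
    also have "\<dots> = cinner v (?Z *v v)"
      by (simp add: cinner_def matrix_vector_mult_def sum_distrib_left sum_distrib_right)
    finally show ?thesis
      using assms by (metis psd_def)
  qed
  ultimately show ?thesis by (simp add: psd_def)
qed

lemma psd_reindex: "psd M \<Longrightarrow> psd (reindex f M)"
  using psd_sum_compress[of M "\<lambda>_::1. f"] by (simp add: reindex_def)

text \<open>\<open>psd_sum_compress\<close> sums over two independent indices, whereas a partial
  trace has one. The tensor factor \<open>mat 1\<close>, evaluated at a copy of the traced index,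
  removes the off-diagonal terms.\<close>

lemma psd_ptrace1: "psd M \<Longrightarrow> psd (ptrace1 M)"
proof -
  assume "psd M"
  then have "psd (reindex (\<lambda>(k, x). (k, (k, x))) (mat 1 \<otimes>\<^sub>m M))"
    by (intro psd_reindex psd_tensor psd_mat_1)
  from psd_sum_compress[OF this, of "\<lambda>k x. (k, x)"]
  show "psd (ptrace1 M)"
    by (simp add: ptrace1_def mat_def if_distrib[of "\<lambda>z. z * _"] cong: if_cong)
qed

lemma trace_ptrace1: "trace (ptrace1 M) = trace M"
  unfolding trace_def ptrace1_def sum_UNIV_prod by (simp, rule sum.swap)


text \<open>The indices of the kernel \<open>N\<close> are pairs (output, input): \<open>N\<close> is the Choi matrix, up to order and
  normalisation, of the superoperator applied to \<open>\<rho>\<close> before contraction with the Choi matrix \<open>\<tau>\<close>.\<close>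

definition contract :: "('o::finite \<times> 'i::finite) op \<Rightarrow> ('o \<times> 'e::finite) op \<Rightarrow> ('i \<times> 'r::finite) op \<Rightarrow> ('e \<times> 'r) op" where
  "contract N \<tau> \<rho> = (\<chi> x y. \<Sum>p\<in>UNIV. \<Sum>q\<in>UNIV.
     N $ p $ q * \<tau> $ (fst p, fst x) $ (fst q, fst y) * \<rho> $ (snd p, snd x) $ (snd q, snd y))"

lemma contract_nth: "contract N \<tau> \<rho> $ x $ y = (\<Sum>p\<in>UNIV. \<Sum>q\<in>UNIV.
     N $ p $ q * \<tau> $ (fst p, fst x) $ (fst q, fst y) * \<rho> $ (snd p, snd x) $ (snd q, snd y))"
  by (simp add: contract_def)

lemma contract_add1: "contract (N + N') \<tau> \<rho> = contract N \<tau> \<rho> + contract N' \<tau> \<rho>"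
  by (simp add: vec_eq_iff contract_nth algebra_simps sum.distrib)

lemma contract_diff1: "contract (N - N') \<tau> \<rho> = contract N \<tau> \<rho> - contract N' \<tau> \<rho>"
  by (simp add: vec_eq_iff contract_nth algebra_simps sum_subtractf)

lemma contract_diff2: "contract N (\<tau> - \<tau>') \<rho> = contract N \<tau> \<rho> - contract N \<tau>' \<rho>"
  by (simp add: vec_eq_iff contract_nth algebra_simps sum_subtractf)

lemma contract_diff3: "contract N \<tau> (\<rho> - \<rho>') = contract N \<tau> \<rho> - contract N \<tau> \<rho>'"
  by (simp add: vec_eq_iff contract_nth algebra_simps sum_subtractf)

lemma psd_contract:
  assumes "psd N" "psd \<tau>" "psd \<rho>"
  shows "psd (contract N \<tau> \<rho>)"
  using psd_sum_compress[OF psd_tensor[OF assms(1) psd_tensor[OF assms(2,3)]],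
      of "\<lambda>p x. (p, ((fst p, fst x), (snd p, snd x)))"]
  by (simp add: contract_def algebra_simps)

lemma trace_contract:
  "trace (contract N \<tau> \<rho>) = (\<Sum>p\<in>UNIV. \<Sum>q\<in>UNIV. N $ p $ q *
     (\<Sum>x\<in>UNIV. \<tau> $ (fst p, fst x) $ (fst q, fst x) * \<rho> $ (snd p, snd x) $ (snd q, snd x)))"
proof -
  have "trace (contract N \<tau> \<rho>) = (\<Sum>x\<in>UNIV. \<Sum>p\<in>UNIV. \<Sum>q\<in>UNIV. N $ p $ q *
     (\<tau> $ (fst p, fst x) $ (fst q, fst x) * \<rho> $ (snd p, snd x) $ (snd q, snd x)))"
    by (simp add: trace_def contract_nth algebra_simps)
  also have "\<dots> = (\<Sum>p\<in>UNIV. \<Sum>q\<in>UNIV. \<Sum>x\<in>UNIV. N $ p $ q *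
     (\<tau> $ (fst p, fst x) $ (fst q, fst x) * \<rho> $ (snd p, snd x) $ (snd q, snd x)))"
    by (subst sum.swap, intro sum.cong refl, subst sum.swap, rule refl)
  finally show ?thesis by (simp add: sum_distrib_left)
qed

text \<open>\<open>mat 1\<close> is the kernel of the map X -> (trace X) 1, which erases every
  correlation with the reference.\<close>

lemma contract_mat_1: "contract (mat 1) \<tau> \<rho> = ptrace1 \<tau> \<otimes>\<^sub>m ptrace1 \<rho>"
proof -
  have "contract (mat 1) \<tau> \<rho> $ x $ y = (ptrace1 \<tau> \<otimes>\<^sub>m ptrace1 \<rho>) $ x $ y" for x y
  proof -
    have "contract (mat 1) \<tau> \<rho> $ x $ y = (\<Sum>p\<in>UNIV. \<Sum>q\<in>UNIV. (if p = q then 1 else 0) *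
      (\<tau> $ (fst p, fst x) $ (fst q, fst y) * \<rho> $ (snd p, snd x) $ (snd q, snd y)))"
      by (simp add: contract_nth mat_def mult.assoc)
    also have "\<dots> = (\<Sum>p\<in>UNIV. \<tau> $ (fst p, fst x) $ (fst p, fst y) * \<rho> $ (snd p, snd x) $ (snd p, snd y))"
      by (simp add: if_mult_sum(1)[of _ "\<lambda>_. 1"])
    also have "\<dots> = (ptrace1 \<tau> \<otimes>\<^sub>m ptrace1 \<rho>) $ x $ y"
      by (simp add: sum_UNIV_prod ptrace1_def sum_product)
    finally show ?thesis .
  qed
  then show ?thesis by (simp add: vec_eq_iff)
qed

lemma mat_1_tensor_mult_nth:
  "((mat 1 \<otimes>\<^sub>m K) ** G) $ (i, e) $ y = (\<Sum>f\<in>UNIV. K $ e $ f * G $ (i, f) $ y)"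
  by (simp add: matrix_matrix_mult_def sum_UNIV_prod mat_def sum_distrib_left[symmetric]
     if_distrib[of "\<lambda>z. z * _"] cong: if_cong) (subst sum.swap, simp)

text \<open>\<open>K\<close> and \<open>L\<close> act on the row indices belonging to E and R, which
  the contraction leaves free.\<close>

lemma contract_factor:
  "contract N ((mat 1 \<otimes>\<^sub>m K) ** G) ((mat 1 \<otimes>\<^sub>m L) ** H) = (K \<otimes>\<^sub>m L) ** contract N G H"
proof -
  have "contract N ((mat 1 \<otimes>\<^sub>m K) ** G) ((mat 1 \<otimes>\<^sub>m L) ** H) $ x $ y = ((K \<otimes>\<^sub>m L) ** contract N G H) $ x $ y" for x y
  proof -
    let ?t = "\<lambda>z p q. (K $ fst x $ fst z * L $ snd x $ snd z) * (N $ p $ q * G $ (fst p, fst z) $ (fst q, fst y) * H $ (snd p, snd z) $ (snd q, snd y))"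
    have "N $ p $ q * ((mat 1 \<otimes>\<^sub>m K) ** G) $ (fst p, fst x) $ (fst q, fst y) *
        ((mat 1 \<otimes>\<^sub>m L) ** H) $ (snd p, snd x) $ (snd q, snd y) = (\<Sum>z\<in>UNIV. ?t z p q)" for p q
      unfolding mat_1_tensor_mult_nth mult.assoc[of "N $ p $ q"] sum_UNIV_prod
      unfolding sum_product unfolding sum_distrib_left
      by (intro sum.cong refl) simp
    then have "contract N ((mat 1 \<otimes>\<^sub>m K) ** G) ((mat 1 \<otimes>\<^sub>m L) ** H) $ x $ y = (\<Sum>p\<in>UNIV. \<Sum>q\<in>UNIV. \<Sum>z\<in>UNIV. ?t z p q)"
      by (simp only: contract_nth)
    also have "\<dots> = (\<Sum>z\<in>UNIV. \<Sum>p\<in>UNIV. \<Sum>q\<in>UNIV. ?t z p q)"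
      by (rule sym, subst sum.swap, intro sum.cong refl, subst sum.swap, rule refl)
    also have "\<dots> = ((K \<otimes>\<^sub>m L) ** contract N G H) $ x $ y"
      by (simp add: matrix_matrix_mult_def contract_nth sum_distrib_left)
    finally show ?thesis .
  qed
  then show ?thesis by (simp add: vec_eq_iff)
qed

text \<open>As \<open>x\<close>, \<open>y\<close>, \<open>p\<close>, \<open>q\<close> vary, each
  pair of an entry of \<tau> and an entry of \<rho> occurs exactly once. The sum is the total weight
  of the linear functionals that produce the entries of a contraction from its kernel.\<close>

lemma sum_hs_sq_product:
  fixes \<tau> :: "('o::finite \<times> 'e::finite) op" and \<rho> :: "('i::finite \<times> 'r::finite) op"
  shows "(\<Sum>x\<in>UNIV. \<Sum>y\<in>UNIV. \<Sum>p\<in>UNIV. \<Sum>q\<in>UNIV.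
     (cmod (\<tau> $ (fst p, fst x) $ (fst q, fst y) * \<rho> $ (snd p, snd x) $ (snd q, snd y)))\<^sup>2) = hs_sq \<tau> * hs_sq \<rho>"
proof -
  let ?F = "\<lambda>a b. (cmod (\<tau> $ a $ b))\<^sup>2" and ?G = "\<lambda>a b. (cmod (\<rho> $ a $ b))\<^sup>2"
  have "(\<Sum>x\<in>UNIV. \<Sum>y\<in>UNIV. \<Sum>p\<in>UNIV. \<Sum>q\<in>UNIV.
     (cmod (\<tau> $ (fst p, fst x) $ (fst q, fst y) * \<rho> $ (snd p, snd x) $ (snd q, snd y)))\<^sup>2)
    = (\<Sum>(x, y, p, q)\<in>UNIV. ?F (fst p, fst x) (fst q, fst y) * ?G (snd p, snd x) (snd q, snd y))"
    by (simp add: sum_UNIV_prod[of "\<lambda>(x, y, p, q). _ x y p q"] sum_UNIV_prod[of "\<lambda>(y, p, q). _ y p q"]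
       sum_UNIV_prod[of "\<lambda>(p, q). _ p q"] norm_mult power_mult_distrib)
  also have "\<dots> = (\<Sum>(a, b, c, d)\<in>UNIV. ?F a b * ?G c d)"
    by (rule sum.reindex_bij_witness[of _
          "\<lambda>(a, b, c, d). ((snd a, snd c), (snd b, snd d), (fst a, fst c), (fst b, fst d))"
          "\<lambda>(x, y, p, q). ((fst p, fst x), (fst q, fst y), (snd p, snd x), (snd q, snd y))"]) auto
  also have "\<dots> = (\<Sum>a\<in>UNIV. \<Sum>b\<in>UNIV. \<Sum>c\<in>UNIV. \<Sum>d\<in>UNIV. ?F a b * ?G c d)"
    by (simp add: sum_UNIV_prod[of "\<lambda>(a, b, c, d). _ a b c d"] sum_UNIV_prod[of "\<lambda>(b, c, d). _ b c d"]
       sum_UNIV_prod[of "\<lambda>(c, d). _ c d"])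
  also have "\<dots> = hs_sq \<tau> * hs_sq \<rho>"
    by (simp add: hs_sq_def[of \<tau>] sum_distrib_right) (simp add: hs_sq_def sum_distrib_left)
  finally show ?thesis .
qed

lemma Im_trace_psd: "psd A \<Longrightarrow> Im (trace A) = 0"
  by (erule psd_obtain_spectral_form) (simp add: trace_spectral_form del: of_real_sum)

section \<open>Smooth min-entropy\<close>


lemma psd_cinner_eq_0:
  assumes "psd A" "Re (cinner v (A *v v)) = 0"
  shows "A *v v = 0"
proof -
  let ?S = "mat_sqrt A"
  have S: "adj ?S = ?S" "?S ** ?S = A" using mat_sqrt[OF assms(1)] psd_hermitian by auto
  have "cinner v (A *v v) = cinner v (?S *v (?S *v v))"
    by (simp add: matrix_vector_mul_assoc S)
  also have "\<dots> = of_real ((norm (?S *v v))\<^sup>2)"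
    by (simp add: cinner_mult_right[of v] S cinner_self)
  finally have "?S *v v = 0" using assms(2) by simp
  then have "(?S ** ?S) *v v = 0" by (simp add: matrix_vector_mul_assoc[symmetric])
  then show ?thesis by (simp add: S)
qed

text \<open>A kernel vector of 1 \<otimes> \<rho>^R has all its slices in the kernel of \<rho>^R.
  The expectation of \<rho>^R in a slice is a sum of nonnegative expectations of \<rho>, one for
  each position of the slice, so each of them vanishes.\<close>

lemma supp_subset_supp_marginal:
  fixes \<rho> :: "('a::finite \<times> 'r::finite) op"
  assumes "psd \<rho>"
  shows "supp \<rho> \<subseteq> supp (mat 1 \<otimes>\<^sub>m ptrace1 \<rho>)"
proof -
  have "\<rho> *v w = 0" if w: "(mat 1 \<otimes>\<^sub>m ptrace1 \<rho>) *v w = 0" for w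
  proof -
    \<comment> \<open>The slice of \<open>w\<close> at \<open>a\<close>, moved to position
      \<open>b\<close>. The sum over \<open>b\<close> produces the partial trace, while the vectors
      \<open>e a a\<close> add up to \<open>w\<close>.\<close>
    define e :: "'a \<Rightarrow> 'a \<Rightarrow> complex^('a \<times> 'r)" where
      "e a b = (\<chi> x. if fst x = b then w $ (a, snd x) else 0)" for a b
    have wa: "(\<Sum>s\<in>UNIV. ptrace1 \<rho> $ r $ s * w $ (a, s)) = 0" for a r
      using arg_cong[OF w, of "\<lambda>v. v $ (a, r)"]
      by (simp add: matrix_vector_mult_def sum_UNIV_prod mat_def if_distrib[of "\<lambda>z. z * _"] cong: if_cong)
        (subst (asm) sum.swap, simp)
    have e: "cinner (e a b) (\<rho> *v e a b) = (\<Sum>r\<in>UNIV. cnj (w $ (a, r)) * (\<Sum>s\<in>UNIV. \<rho> $ (b, r) $ (b, s) * w $ (a, s)))" for a b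
    proof -
      have "(\<rho> *v e a b) $ x = (\<Sum>s\<in>UNIV. \<rho> $ x $ (b, s) * w $ (a, s))" for x
        by (simp add: matrix_vector_mult_def sum_UNIV_prod e_def if_distrib[of "\<lambda>z. _ * z"] cong: if_cong)
           (subst sum.swap, simp)
      then show ?thesis
        by (simp add: cinner_def sum_UNIV_prod e_def if_distrib[of cnj] if_distrib[of "\<lambda>z. z * _"] cong: if_cong)
           (subst sum.swap, simp)
    qed
    have "(\<Sum>b\<in>UNIV. cinner (e a b) (\<rho> *v e a b)) = 0" for a
    proof -
      have "(\<Sum>b\<in>UNIV. cinner (e a b) (\<rho> *v e a b)) =
         (\<Sum>r\<in>UNIV. cnj (w $ (a, r)) * (\<Sum>s\<in>UNIV. (\<Sum>b\<in>UNIV. \<rho> $ (b, r) $ (b, s)) * w $ (a, s)))"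
        unfolding e by (subst sum.swap) (simp add: sum_distrib_left[symmetric] sum_distrib_right, subst sum.swap, simp)
      also have "\<dots> = 0"
        using wa[of _ a] by (simp add: ptrace1_def)
      finally show ?thesis .
    qed
    then have "(\<Sum>b\<in>UNIV. Re (cinner (e a b) (\<rho> *v e a b))) = 0" for a
      by (metis Re_sum zero_complex.simps(1))
    moreover have "0 \<le> Re (cinner v (\<rho> *v v))" for v using assms by (simp add: psd_def)
    ultimately have "Re (cinner (e a b) (\<rho> *v e a b)) = 0" for a b
      by (simp add: sum_nonneg_eq_0_iff)
    then have *: "\<rho> *v e a b = 0" for a b by (rule psd_cinner_eq_0[OF assms])
    have "w = (\<Sum>a\<in>UNIV. e a a)"
      by (simp add: vec_eq_iff e_def)
    then have "\<rho> *v w = (\<Sum>a\<in>UNIV. \<rho> *v e a a)"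
      by (metis vec.sum)
    then show ?thesis using * by simp
  qed
  then show ?thesis by (auto simp: supp_def)
qed

lemma psd_0: "psd 0"
  using psd_mscale[OF psd_mat_1, of 0] by (simp add: mscale_def map_matrix_def vec_eq_iff zero_vec_def[symmetric])

lemma mat_sqrt_mat_1_tensor:
  assumes "psd \<omega>"
  shows "mat_sqrt (mat 1 \<otimes>\<^sub>m \<omega>) = mat 1 \<otimes>\<^sub>m mat_sqrt \<omega>"
  using mat_sqrt[OF assms] by (intro mat_sqrt_eqI psd_tensor psd_mat_1) (simp_all add: tensor_mult)

text \<open>The operator norm inside \<open>D_max\<close> is at most 2^c and the trace of \<alpha>
  is at most 1, so \<open>supp_factorisation\<close> bounds the squared Hilbert-Schmidt norm of the
  second factor.\<close>

lemma D_max_factorisation: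
  fixes \<alpha> :: "('a::finite \<times> 'r::finite) op"
  assumes "subnormalised \<alpha>" "psd \<omega>" and D: "D_max \<alpha> (mat 1 \<otimes>\<^sub>m \<omega>) < ereal c"
  obtains G where "\<alpha> = (mat 1 \<otimes>\<^sub>m mat_sqrt \<omega>) ** G" "hs_sq G \<le> 2 powr c"
proof -
  let ?\<beta> = "mat 1 \<otimes>\<^sub>m \<omega> :: ('a \<times> 'r) op"
  let ?P = "pseudoinverse (mat_sqrt ?\<beta>)"
  let ?x = "op_norm (?P ** \<alpha> ** ?P)"
  have \<alpha>: "psd \<alpha>" "Re (trace \<alpha>) \<le> 1" using assms(1) by (simp_all add: subnormalised_def)
  have supp: "supp \<alpha> \<subseteq> supp ?\<beta>" using D by (auto simp: D_max_def split: if_splits)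
  have "log2_ereal ?x < ereal c" using D supp by (simp add: D_max_def)
  \<comment> \<open>Norm 0 is a separate case, since its logarithm is set to -\<infinity>.\<close>
  then have x: "?x \<le> 2 powr c"
    using op_norm_nonneg[of "?P ** \<alpha> ** ?P"]
    by (auto simp: log2_ereal_def less_eq_real_def log_less_iff split: if_splits)
  note f = supp_factorisation[OF \<alpha>(1) psd_tensor[OF psd_mat_1 assms(2)] supp]
  have "hs_sq (?P ** \<alpha>) \<le> 2 powr c"
  proof -
    have "?x * Re (trace \<alpha>) \<le> ?x * 1" using \<alpha> op_norm_nonneg by (intro mult_left_mono)
    then show ?thesis using f(2) x by simp
  qed
  with f(1) show ?thesis
    unfolding mat_sqrt_mat_1_tensor[OF assms(2)] by (intro that)
qed

text \<open>The product bound is the entropy condition exponentiated. The two states are smoothed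
  independently; only the sum of their entropies is constrained.\<close>

lemma H_min_smoothing:
  fixes \<rho> :: "('a::finite \<times> 'r::finite) op" and \<tau> :: "('b::finite \<times> 'e::finite) op"
  assumes "subnormalised \<rho>" "subnormalised \<tau>" and \<epsilon>: "0 < \<epsilon>"
    and H: "H_min \<epsilon> \<rho> + H_min \<epsilon> \<tau> > ereal (log 2 (1 / \<epsilon>))"
  obtains \<rho>' \<tau>' G H where "subnormalised \<rho>'" "subnormalised \<tau>'"
    "trace_norm (\<rho>' - \<rho>) \<le> \<epsilon>" "trace_norm (\<tau>' - \<tau>) \<le> \<epsilon>"
    "\<tau>' = (mat 1 \<otimes>\<^sub>m mat_sqrt (ptrace1 \<tau>)) ** G" "\<rho>' = (mat 1 \<otimes>\<^sub>m mat_sqrt (ptrace1 \<rho>)) ** H"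
    "hs_sq G * hs_sq H \<le> \<epsilon>"
proof -
  define a b where "a = smooth_D_max \<epsilon> \<rho> (mat 1 \<otimes>\<^sub>m ptrace1 \<rho>)"
    and "b = smooth_D_max \<epsilon> \<tau> (mat 1 \<otimes>\<^sub>m ptrace1 \<tau>)"
  \<comment> \<open>In \<open>ereal\<close> the sum of \<infinity> and -\<infinity> is \<infinity>,
    so the entropy condition says something only after an entropy -\<infinity> is excluded. The
    state \<sigma> itself is an admissible competitor whose divergence is below \<infinity>.\<close>
  have fin: "smooth_D_max \<epsilon> \<sigma> (mat 1 \<otimes>\<^sub>m ptrace1 \<sigma>) \<noteq> \<infinity>" if "subnormalised \<sigma>"
    for \<sigma> :: "('c::finite \<times> 'd::finite) op"
  proof -
    have psd: "psd \<sigma>" using that by (simp add: subnormalised_def)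
    have "trace_norm (\<sigma> - \<sigma>) \<le> \<epsilon> * Re (trace \<sigma>)"
      using trace_psd_nonneg[OF psd] \<epsilon> by (simp add: trace_norm_psd[OF psd_0]) (simp add: trace_def)
    then have "smooth_D_max \<epsilon> \<sigma> (mat 1 \<otimes>\<^sub>m ptrace1 \<sigma>) \<le> D_max \<sigma> (mat 1 \<otimes>\<^sub>m ptrace1 \<sigma>)"
      unfolding smooth_D_max_def using that by (intro INF_lower) simp
    also have "\<dots> < \<infinity>" using supp_subset_supp_marginal[OF psd] by (simp add: D_max_def log2_ereal_def)
    finally show ?thesis by simp
  qed
  have "a \<noteq> \<infinity>" "b \<noteq> \<infinity>" unfolding a_def b_def by (intro fin assms)+
  moreover have "- a + - b > ereal (log 2 (1 / \<epsilon>))"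
    using H by (simp add: H_min_def a_def b_def)
  moreover have "log 2 (1 / \<epsilon>) = - log 2 \<epsilon>" using \<epsilon> by (simp add: log_divide)
  ultimately obtain r s where rs: "a < ereal r" "b < ereal s" "r + s \<le> log 2 \<epsilon>"
  proof (cases a; cases b)
    fix a' b'
    assume *: "a = ereal a'" "b = ereal b'"
    \<comment> \<open>The strict inequality leaves a gap, half of which goes to each state: a
      competitor strictly below \<open>r\<close> or \<open>s\<close> exists whether or not the
      infimum is attained.\<close>
    let ?d = "(log 2 \<epsilon> - a' - b') / 2"
    assume "ereal (log 2 (1 / \<epsilon>)) < - a + - b" "log 2 (1 / \<epsilon>) = - log 2 \<epsilon>"
    then have "0 < ?d" using * by simp
    then show ?thesis using * by (intro that[of "a' + ?d" "b' + ?d"]) auto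
  next
    fix a' assume "a = ereal a'" "b = -\<infinity>"
    then show ?thesis by (intro that[of "a' + 1" "log 2 \<epsilon> - a' - 1"]) auto
  next
    fix b' assume "b = ereal b'" "a = -\<infinity>"
    then show ?thesis by (intro that[of "log 2 \<epsilon> - b' - 1" "b' + 1"]) auto
  next
    assume "b = -\<infinity>" "a = -\<infinity>"
    then show ?thesis by (intro that[of "log 2 \<epsilon>" 0]) auto
  qed auto
  have smooth: "\<exists>\<sigma>' G. subnormalised \<sigma>' \<and> trace_norm (\<sigma>' - \<sigma>) \<le> \<epsilon> \<and>
      \<sigma>' = (mat 1 \<otimes>\<^sub>m mat_sqrt (ptrace1 \<sigma>)) ** G \<and> hs_sq G \<le> 2 powr c"
    if D: "smooth_D_max \<epsilon> \<sigma> (mat 1 \<otimes>\<^sub>m ptrace1 \<sigma>) < ereal c" and sub: "subnormalised \<sigma>"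
    for c and \<sigma> :: "('c::finite \<times> 'd::finite) op"
  proof -
    obtain \<sigma>' where \<sigma>': "subnormalised \<sigma>'" "trace_norm (\<sigma>' - \<sigma>) \<le> \<epsilon> * Re (trace \<sigma>)"
      "D_max \<sigma>' (mat 1 \<otimes>\<^sub>m ptrace1 \<sigma>) < ereal c"
      using D unfolding smooth_D_max_def INF_less_iff by auto
    have "psd (ptrace1 \<sigma>)" using sub by (simp add: subnormalised_def psd_ptrace1)
    from D_max_factorisation[OF \<sigma>'(1) this \<sigma>'(3)] obtain G where
      "\<sigma>' = (mat 1 \<otimes>\<^sub>m mat_sqrt (ptrace1 \<sigma>)) ** G" "hs_sq G \<le> 2 powr c" .
    moreover have "\<epsilon> * Re (trace \<sigma>) \<le> \<epsilon> * 1"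
      using sub \<epsilon> by (intro mult_left_mono) (auto simp: subnormalised_def)
    ultimately show ?thesis using \<sigma>' by (intro exI[of _ \<sigma>'] exI[of _ G]) simp
  qed
  obtain \<rho>' H where \<rho>': "subnormalised \<rho>'" "trace_norm (\<rho>' - \<rho>) \<le> \<epsilon>"
      "\<rho>' = (mat 1 \<otimes>\<^sub>m mat_sqrt (ptrace1 \<rho>)) ** H" "hs_sq H \<le> 2 powr r"
    using smooth[OF rs(1)[unfolded a_def] assms(1)] by blast
  obtain \<tau>' G where \<tau>': "subnormalised \<tau>'" "trace_norm (\<tau>' - \<tau>) \<le> \<epsilon>"
      "\<tau>' = (mat 1 \<otimes>\<^sub>m mat_sqrt (ptrace1 \<tau>)) ** G" "hs_sq G \<le> 2 powr s"
    using smooth[OF rs(2)[unfolded b_def] assms(2)] by blast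
  have "hs_sq G * hs_sq H \<le> 2 powr s * 2 powr r"
    using \<rho>' \<tau>' by (intro mult_mono hs_sq_nonneg) auto
  also have "\<dots> \<le> 2 powr (log 2 \<epsilon>)" using rs(3) by (simp flip: powr_add add: add.commute)
  also have "\<dots> = \<epsilon>" using \<epsilon> by simp
  finally show ?thesis using \<rho>' \<tau>' by (intro that) auto
qed

section \<open>Moments of random kernels\<close>

text \<open>A class closed under the ring operations and conjugation and contained in the integrable
  functions of a finite measure; polynomials in the entries of a Haar unitary and their conjugates
  belong to it.\<close>

definition bounded_measurable :: "'u measure \<Rightarrow> ('u \<Rightarrow> complex) \<Rightarrow> bool" where
  "bounded_measurable M f \<longleftrightarrow> f \<in> borel_measurable M \<and> (\<exists>B. \<forall>u\<in>space M. cmod (f u) \<le> B)"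

lemma bounded_measurable_const [simp, intro]: "bounded_measurable M (\<lambda>_. c)"
  by (auto simp: bounded_measurable_def)

lemma bounded_measurable_mult [intro]:
  assumes "bounded_measurable M f" "bounded_measurable M g"
  shows "bounded_measurable M (\<lambda>u. f u * g u)"
proof -
  obtain B C where "\<forall>u\<in>space M. cmod (f u) \<le> B" "\<forall>u\<in>space M. cmod (g u) \<le> C"
    using assms by (auto simp: bounded_measurable_def)
  then have "\<forall>u\<in>space M. cmod (f u * g u) \<le> B * C"
    unfolding norm_mult by (intro ballI mult_mono) (auto intro: order_trans[OF norm_ge_zero])
  with assms show ?thesis by (auto simp: bounded_measurable_def)
qed

lemma bounded_measurable_add [intro]:
  assumes "bounded_measurable M f" "bounded_measurable M g"
  shows "bounded_measurable M (\<lambda>u. f u + g u)"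
proof -
  obtain B C where "\<forall>u\<in>space M. cmod (f u) \<le> B" "\<forall>u\<in>space M. cmod (g u) \<le> C"
    using assms by (auto simp: bounded_measurable_def)
  then have "\<forall>u\<in>space M. cmod (f u + g u) \<le> B + C"
    by (auto intro!: order_trans[OF norm_triangle_ineq] add_mono)
  with assms show ?thesis by (auto simp: bounded_measurable_def)
qed

lemma bounded_measurable_sum [intro]: "(\<And>x. x \<in> A \<Longrightarrow> bounded_measurable M (f x)) \<Longrightarrow> bounded_measurable M (\<lambda>u. \<Sum>x\<in>A. f x u)"
  by (induction A rule: infinite_finite_induct) (auto intro!: bounded_measurable_add)

lemma bounded_measurable_diff [intro]: "bounded_measurable M f \<Longrightarrow> bounded_measurable M g \<Longrightarrow> bounded_measurable M (\<lambda>u. f u - g u)"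
  using bounded_measurable_add[of M f "\<lambda>u. - 1 * g u", OF _ bounded_measurable_mult[OF bounded_measurable_const]] by simp

lemma bounded_measurable_cnj [intro]: "bounded_measurable M f \<Longrightarrow> bounded_measurable M (\<lambda>u. cnj (f u))"
  by (auto simp: bounded_measurable_def intro!: borel_measurable_continuous_on[of cnj] continuous_intros)

lemma (in finite_measure) bounded_measurable_integrable: "bounded_measurable M f \<Longrightarrow> integrable M f"
  unfolding bounded_measurable_def by (auto intro!: integrable_const_bound)

lemma (in finite_measure) bounded_measurable_integrable_Re:
  "bounded_measurable M f \<Longrightarrow> integrable M (\<lambda>u. Re (f u))" "bounded_measurable M f \<Longrightarrow> (\<integral>u. Re (f u) \<partial>M) = Re (\<integral>u. f u \<partial>M)"
  by (simp_all add: bounded_measurable_integrable integrable_Re integral_Re)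

lemma cmod_sq: "(cmod z)\<^sup>2 = Re (z * cnj z)"
  unfolding cmod_power2 by (simp add: power2_eq_square)

lemma (in finite_measure) bounded_measurable_integrable_cmod_sq: "bounded_measurable M f \<Longrightarrow> integrable M (\<lambda>u. (cmod (f u))\<^sup>2)"
  unfolding cmod_sq by (intro bounded_measurable_integrable_Re(1) bounded_measurable_mult bounded_measurable_cnj)

text \<open>The second-moment operator of the entries of \<open>N\<close> is at most \<kappa>; it is
  the covariance when \<open>N\<close> has mean 0. It is tested against linear functionals because
  every entry of a contraction is one.\<close>

definition bounded_covariance :: "'u measure \<Rightarrow> ('u \<Rightarrow> 'n::finite op) \<Rightarrow> real \<Rightarrow> bool" where
  "bounded_covariance M N \<kappa> \<longleftrightarrow> (\<forall>p q. bounded_measurable M (\<lambda>u. N u $ p $ q)) \<and>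
     (\<forall>l. (\<integral>u. (cmod (\<Sum>p\<in>UNIV. \<Sum>q\<in>UNIV. l p q * N u $ p $ q))\<^sup>2 \<partial>M)
        \<le> \<kappa> * (\<Sum>p\<in>UNIV. \<Sum>q\<in>UNIV. (cmod (l p q))\<^sup>2))"

lemma bounded_measurable_contract: "(\<And>p q. bounded_measurable M (\<lambda>u. N u $ p $ q)) \<Longrightarrow> bounded_measurable M (\<lambda>u. contract (N u) \<tau> \<rho> $ x $ y)"
  unfolding contract_nth by (intro bounded_measurable_sum bounded_measurable_mult bounded_measurable_const)

lemma bounded_measurable_trace_contract: "(\<And>p q. bounded_measurable M (\<lambda>u. N u $ p $ q)) \<Longrightarrow> bounded_measurable M (\<lambda>u. trace (contract (N u) \<tau> \<rho>))"
  unfolding trace_def by (intro bounded_measurable_sum bounded_measurable_contract)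

text \<open>The second-moment bound is applied to each entry of the contraction, and the
  coefficients of all these functionals are summed by \<open>sum_hs_sq_product\<close>.\<close>

lemma (in finite_measure) integral_hs_sq_contract:
  assumes "bounded_covariance M N \<kappa>"
  shows "integrable M (\<lambda>u. hs_sq (contract (N u) G H))"
    and "(\<integral>u. hs_sq (contract (N u) G H) \<partial>M) \<le> \<kappa> * (hs_sq G * hs_sq H)"
proof -
  have bounded_measurable: "bounded_measurable M (\<lambda>u. contract (N u) G H $ x $ y)" for x y
    using assms unfolding bounded_covariance_def by (intro bounded_measurable_contract) blast
  have int: "integrable M (\<lambda>u. (cmod (contract (N u) G H $ x $ y))\<^sup>2)" for x y
    by (intro bounded_measurable_integrable_cmod_sq bounded_measurable)
  then show "integrable M (\<lambda>u. hs_sq (contract (N u) G H))"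
    unfolding hs_sq_def by (intro Bochner_Integration.integrable_sum)
  let ?l = "\<lambda>x y p q. G $ (fst p, fst x) $ (fst q, fst y) * H $ (snd p, snd x) $ (snd q, snd y)"
  have "(\<integral>u. (cmod (contract (N u) G H $ x $ y))\<^sup>2 \<partial>M) \<le> \<kappa> * (\<Sum>p\<in>UNIV. \<Sum>q\<in>UNIV. (cmod (?l x y p q))\<^sup>2)" for x y
  proof -
    have "contract (N u) G H $ x $ y = (\<Sum>p\<in>UNIV. \<Sum>q\<in>UNIV. ?l x y p q * N u $ p $ q)" for u
      by (simp add: contract_nth algebra_simps)
    then show ?thesis using assms by (simp add: bounded_covariance_def)
  qed
  then have "(\<Sum>x\<in>UNIV. \<Sum>y\<in>UNIV. \<integral>u. (cmod (contract (N u) G H $ x $ y))\<^sup>2 \<partial>M) \<le>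
     (\<Sum>x\<in>UNIV. \<Sum>y\<in>UNIV. \<kappa> * (\<Sum>p\<in>UNIV. \<Sum>q\<in>UNIV. (cmod (?l x y p q))\<^sup>2))"
    by (intro sum_mono)
  also have "\<dots> = \<kappa> * (hs_sq G * hs_sq H)"
    by (simp add: sum_distrib_left[symmetric] sum_hs_sq_product)
  finally show "(\<integral>u. hs_sq (contract (N u) G H) \<partial>M) \<le> \<kappa> * (hs_sq G * hs_sq H)"
    unfolding hs_sq_def using int by (simp add: Bochner_Integration.integrable_sum)
qed

text \<open>The trace of a contraction is linear in the kernel, so only the mean of the kernel
  matters, and the mean is a multiple of \<open>mat 1\<close>.\<close>

lemma (in finite_measure) integral_trace_contract:
  fixes D :: "'a \<Rightarrow> ('o::finite \<times> 'i::finite) op"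
  assumes "\<And>p q. bounded_measurable M (\<lambda>u. D u $ p $ q)"
    and "\<And>p q. (\<integral>u. D u $ p $ q \<partial>M) = (if p = q then of_real c else 0)"
    and "psd \<tau>" "psd \<rho>"
  shows "integrable M (\<lambda>u. Re (trace (contract (D u) \<tau> \<rho>)))"
    and "(\<integral>u. Re (trace (contract (D u) \<tau> \<rho>)) \<partial>M) = c * Re (trace \<tau>) * Re (trace \<rho>)"
proof -
  have bounded_measurable: "bounded_measurable M (\<lambda>u. trace (contract (D u) \<tau> \<rho>))" by (intro bounded_measurable_trace_contract assms)
  show "integrable M (\<lambda>u. Re (trace (contract (D u) \<tau> \<rho>)))" by (rule bounded_measurable_integrable_Re(1)[OF bounded_measurable])
  have "(\<integral>u. trace (contract (D u) \<tau> \<rho>) \<partial>M) = trace (contract (\<chi> p q. if p = q then of_real c else 0) \<tau> \<rho>)"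
    unfolding trace_contract using assms(1,2)
    by (simp add: Bochner_Integration.integrable_sum bounded_measurable_integrable cong: sum.cong)
  also have "(\<chi> p q. if p = q then of_real c else 0) = mscale (of_real c) (mat 1 :: ('o \<times> 'i) op)"
    by (simp add: vec_eq_iff mat_def)
  also have "trace (contract (mscale (of_real c) (mat 1)) \<tau> \<rho>) = of_real c * (trace \<tau> * trace \<rho>)"
  proof -
    have "contract (mscale (of_real c) (mat 1)) \<tau> \<rho> = mscale (of_real c) (contract (mat 1) \<tau> \<rho>)"
      by (simp add: vec_eq_iff contract_nth sum_distrib_left mult.assoc)
    then show ?thesis by (simp add: trace_mscale contract_mat_1 trace_tensor trace_ptrace1)
  qed
  finally show "(\<integral>u. Re (trace (contract (D u) \<tau> \<rho>)) \<partial>M) = c * Re (trace \<tau>) * Re (trace \<rho>)"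
    using Im_trace_psd[OF assms(3)] by (simp add: bounded_measurable_integrable_Re(2)[OF bounded_measurable])
qed

section \<open>Smoothed bounds and invariant tensors\<close>


lemma trace_norm_contract_dominated:
  assumes "psd (D + N)" "psd (D - N)" "psd \<tau>" "psd \<rho>"
  shows "trace_norm (contract N \<tau> \<rho>) \<le> Re (trace (contract D \<tau> \<rho>))"
    and "adj (contract N \<tau> \<rho>) = contract N \<tau> \<rho>"
proof -
  have "psd (contract D \<tau> \<rho> + contract N \<tau> \<rho>)" "psd (contract D \<tau> \<rho> - contract N \<tau> \<rho>)"
    unfolding contract_add1[symmetric] contract_diff1[symmetric] by (intro psd_contract assms)+
  from trace_norm_dominated[OF this]
  show "trace_norm (contract N \<tau> \<rho>) \<le> Re (trace (contract D \<tau> \<rho>))"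
    and "adj (contract N \<tau> \<rho>) = contract N \<tau> \<rho>" .
qed

lemma hs_sq_mat_sqrt_tensor:
  assumes "psd A" "psd B"
  shows "hs_sq (mat_sqrt A \<otimes>\<^sub>m mat_sqrt B) = Re (trace A) * Re (trace B)"
proof -
  let ?K = "mat_sqrt A \<otimes>\<^sub>m mat_sqrt B"
  have "of_real (hs_sq ?K) = trace (adj ?K ** ?K)" by (simp add: trace_adj_mult)
  also have "\<dots> = trace A * trace B"
    using assms by (simp add: adj_tensor tensor_mult mat_sqrt psd_hermitian trace_tensor)
  finally have "hs_sq ?K = Re (trace A * trace B)" by (metis Re_complex_of_real)
  then show ?thesis using Im_trace_psd[OF assms(1)] by simp
qed

text \<open>The error of replacing \<open>\<tau>\<close> and \<open>\<rho>\<close> by smoothing states is bounded by the dominating kernel \<open>D\<close>,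
  whose mean is known; the smoothed term is bounded in Hilbert-Schmidt norm after splitting off
  the square roots of the marginals.\<close>

lemma (in prob_space) smoothed_trace_norm_bound:
  fixes N D :: "'a \<Rightarrow> ('o::finite \<times> 'i::finite) op"
    and \<tau> :: "('o \<times> 'e::finite) op" and \<rho> :: "('i \<times> 'r::finite) op"
  assumes cov: "bounded_covariance M N \<kappa>" and \<kappa>: "0 \<le> \<kappa>" and c: "0 \<le> c"
    and D: "\<And>p q. bounded_measurable M (\<lambda>u. D u $ p $ q)"
    and ED: "\<And>p q. (\<integral>u. D u $ p $ q \<partial>M) = (if p = q then of_real c else 0)"
    and dom: "\<And>u. u \<in> space M \<Longrightarrow> psd (D u + N u)" "\<And>u. u \<in> space M \<Longrightarrow> psd (D u - N u)"
    and sub: "subnormalised \<tau>" "subnormalised \<rho>" and \<epsilon>: "0 < \<epsilon>"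
    and H: "H_min \<epsilon> \<rho> + H_min \<epsilon> \<tau> > ereal (log 2 (1 / \<epsilon>))"
  obtains q where "integrable M q" "\<And>u. u \<in> space M \<Longrightarrow> trace_norm (contract (N u) \<tau> \<rho>) \<le> q u"
    "(\<integral>u. q u \<partial>M) \<le> (1 + \<kappa>) / 2 * sqrt \<epsilon> + 2 * c * \<epsilon>"
proof -
  obtain \<rho>' \<tau>' G H where sub': "subnormalised \<rho>'" "subnormalised \<tau>'"
    and tn: "trace_norm (\<rho>' - \<rho>) \<le> \<epsilon>" "trace_norm (\<tau>' - \<tau>) \<le> \<epsilon>"
    and fac: "\<tau>' = (mat 1 \<otimes>\<^sub>m mat_sqrt (ptrace1 \<tau>)) ** G" "\<rho>' = (mat 1 \<otimes>\<^sub>m mat_sqrt (ptrace1 \<rho>)) ** H"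
    and GH: "hs_sq G * hs_sq H \<le> \<epsilon>"
    using H_min_smoothing[OF sub(2,1) \<epsilon> H] .
  note psds = sub[unfolded subnormalised_def, THEN conjunct1] sub'[unfolded subnormalised_def, THEN conjunct1]
  note traces = sub[unfolded subnormalised_def, THEN conjunct2] sub'[unfolded subnormalised_def, THEN conjunct2]
  \<comment> \<open>Domination of kernels passes to contractions only for positive arguments, so the
    smoothing errors are split into positive and negative parts.\<close>
  obtain P P' where P: "psd P" "psd P'" "\<tau>' - \<tau> = P - P'" "Re (trace P) + Re (trace P') = trace_norm (\<tau>' - \<tau>)"
    using Jordan_decomposition[of "\<tau>' - \<tau>"] psds by (auto simp: adj_diff psd_hermitian)
  obtain R R' where R: "psd R" "psd R'" "\<rho>' - \<rho> = R - R'" "Re (trace R) + Re (trace R') = trace_norm (\<rho>' - \<rho>)"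
    using Jordan_decomposition[of "\<rho>' - \<rho>"] psds by (auto simp: adj_diff psd_hermitian)
  \<comment> \<open>Makes \<open>s\<close> and the mean of
    \<open>hs_sq (contract (N u) G H) / s\<close>, which is at most
    \<open>\<kappa> * \<epsilon> / s\<close>, of the same order.\<close>
  define s where "s = sqrt \<epsilon>"
  have s: "0 < s" "s * s = \<epsilon>" using \<epsilon> by (simp_all add: s_def)
  let ?t = "\<lambda>u A B. Re (trace (contract (D u) A B))"
  define q where "q u = (s + hs_sq (contract (N u) G H) / s) / 2
    + ?t u P \<rho>' + ?t u P' \<rho>' + ?t u \<tau> R + ?t u \<tau> R'" for u
  note it = integral_trace_contract[of D c, OF D ED]
  note ih = integral_hs_sq_contract[OF cov, of G H]
  show ?thesis
  proof (rule that)
    show "integrable M q"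
      unfolding q_def using ih(1) it(1) P R psds by (intro Bochner_Integration.integrable_add) auto
    have "(\<integral>u. q u \<partial>M) = (s + (\<integral>u. hs_sq (contract (N u) G H) \<partial>M) / s) / 2
      + c * Re (trace P) * Re (trace \<rho>') + c * Re (trace P') * Re (trace \<rho>')
      + c * Re (trace \<tau>) * Re (trace R) + c * Re (trace \<tau>) * Re (trace R')"
    proof -
      have i: "integrable M (\<lambda>u. (s + hs_sq (contract (N u) G H) / s) / 2)"
        "(\<integral>u. (s + hs_sq (contract (N u) G H) / s) / 2 \<partial>M) = (s + (\<integral>u. hs_sq (contract (N u) G H) \<partial>M) / s) / 2"
        using ih(1) by (simp_all add: prob_space)
      have i': "integrable M (\<lambda>u. ?t u P \<rho>')" "integrable M (\<lambda>u. ?t u P' \<rho>')"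
        "integrable M (\<lambda>u. ?t u \<tau> R)" "integrable M (\<lambda>u. ?t u \<tau> R')"
        by (intro it(1) P R psds)+
      show ?thesis unfolding q_def
        by (simp only: Bochner_Integration.integral_add Bochner_Integration.integrable_add i i'
            it(2)[OF P(1) psds(3)] it(2)[OF P(2) psds(3)] it(2)[OF psds(1) R(1)] it(2)[OF psds(1) R(2)])
    qed
    also have "\<dots> = (s + (\<integral>u. hs_sq (contract (N u) G H) \<partial>M) / s) / 2
      + c * trace_norm (\<tau>' - \<tau>) * Re (trace \<rho>') + c * Re (trace \<tau>) * trace_norm (\<rho>' - \<rho>)"
      unfolding P(4)[symmetric] R(4)[symmetric] by (simp add: algebra_simps)
    also have "\<dots> \<le> (s + (\<kappa> * \<epsilon>) / s) / 2 + c * \<epsilon> * 1 + c * 1 * \<epsilon>"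
    proof (intro add_mono divide_right_mono)
      show "(\<integral>u. hs_sq (contract (N u) G H) \<partial>M) \<le> \<kappa> * \<epsilon>"
        using ih(2) mult_left_mono[OF GH \<kappa>] by linarith
      have "0 \<le> trace_norm (\<tau>' - \<tau>)" using P(1,2,4) trace_psd_nonneg by (metis add_nonneg_nonneg)
      then show "c * trace_norm (\<tau>' - \<tau>) * Re (trace \<rho>') \<le> c * \<epsilon> * 1"
        using c tn \<epsilon> traces psds by (intro mult_mono) (auto simp: trace_psd_nonneg)
      have "0 \<le> trace_norm (\<rho>' - \<rho>)" using R(1,2,4) trace_psd_nonneg by (metis add_nonneg_nonneg)
      then show "c * Re (trace \<tau>) * trace_norm (\<rho>' - \<rho>) \<le> c * 1 * \<epsilon>"
        using c tn \<epsilon> traces psds by (intro mult_mono) (auto simp: trace_psd_nonneg)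
    qed (use s in auto)
    also have "(\<kappa> * \<epsilon>) / s = \<kappa> * s" using s by (simp flip: s(2))
    also have "(s + \<kappa> * s) / 2 + c * \<epsilon> * 1 + c * 1 * \<epsilon> = (1 + \<kappa>) / 2 * sqrt \<epsilon> + 2 * c * \<epsilon>"
      by (simp add: s_def field_simps)
    finally show "(\<integral>u. q u \<partial>M) \<le> (1 + \<kappa>) / 2 * sqrt \<epsilon> + 2 * c * \<epsilon>" .
  next
    fix u assume u: "u \<in> space M"
    note d = trace_norm_contract_dominated[OF dom[OF u]]
    let ?C = "contract (N u)"
    \<comment> \<open>The states are exchanged one at a time, so each error term pairs one
      difference with one state of trace at most 1.\<close>
    have "?C \<tau> \<rho> = ?C \<tau>' \<rho>' - (?C (\<tau>' - \<tau>) \<rho>' + ?C \<tau> (\<rho>' - \<rho>))"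
      by (simp add: contract_diff2 contract_diff3)
    also have "\<dots> = ?C \<tau>' \<rho>' - ((?C P \<rho>' - ?C P' \<rho>') + (?C \<tau> R - ?C \<tau> R'))"
      unfolding P(3) R(3) contract_diff2 contract_diff3 ..
    finally have "trace_norm (?C \<tau> \<rho>) \<le> trace_norm (?C \<tau>' \<rho>') + ((trace_norm (?C P \<rho>') + trace_norm (?C P' \<rho>'))
        + (trace_norm (?C \<tau> R) + trace_norm (?C \<tau> R')))"
      by (simp only:) (intro order_trans[OF trace_norm_diff] order_trans[OF trace_norm_triangle] add_mono
         trace_norm_diff order_refl; simp add: adj_add adj_diff d(2) P R psds)
    also have "trace_norm (?C \<tau>' \<rho>') \<le> (s + hs_sq (?C G H) / s) / 2"
    proof -
      let ?K = "mat_sqrt (ptrace1 \<tau>) \<otimes>\<^sub>m mat_sqrt (ptrace1 \<rho>)"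
      have K: "?C \<tau>' \<rho>' = ?K ** ?C G H" unfolding fac by (rule contract_factor)
      have "hs_sq ?K = Re (trace \<tau>) * Re (trace \<rho>)"
        using psds by (simp add: hs_sq_mat_sqrt_tensor psd_ptrace1 trace_ptrace1)
      also have "\<dots> \<le> 1 * 1" using traces psds by (intro mult_mono) (auto simp: trace_psd_nonneg)
      finally have "hs_sq ?K \<le> 1" by simp
      moreover have "adj (?C \<tau>' \<rho>') = ?C \<tau>' \<rho>'" by (intro d psds)
      ultimately show ?thesis unfolding K using s by (intro trace_norm_mult_le)
    qed
    also have "trace_norm (?C P \<rho>') \<le> ?t u P \<rho>'" by (intro d P psds)
    also have "trace_norm (?C P' \<rho>') \<le> ?t u P' \<rho>'" by (intro d P psds)
    also have "trace_norm (?C \<tau> R) \<le> ?t u \<tau> R" by (intro d R psds)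
    also have "trace_norm (?C \<tau> R') \<le> ?t u \<tau> R'" by (intro d R psds)
    finally show "trace_norm (?C \<tau> \<rho>) \<le> q u" by (simp add: q_def algebra_simps)
  qed
qed

section \<open>Tensors invariant under conjugation by unitaries\<close>

lemma phase_unitary:
  assumes "\<And>a. \<theta> a * cnj (\<theta> a) = 1"
  shows "(\<chi> a b. if a = b then \<theta> a else 0) \<in> unitary_group"
proof (rule unitaryI)
  show "adj (\<chi> a b. if a = b then \<theta> a else 0) ** (\<chi> a b. if a = b then \<theta> a else 0) = mat 1"
    using assms
    by (auto simp: vec_eq_iff matrix_matrix_mult_def mat_def if_distrib[of cnj] if_distrib[of "\<lambda>z. z * _"]
        mult.commute cong: if_cong)
qed

lemma permutation_unitary:
  assumes "bij \<pi>"
  shows "(\<chi> a b. if b = \<pi> a then 1 else 0) \<in> unitary_group"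
proof (rule unitaryI)
  have "(\<Sum>k\<in>UNIV. cnj (if i = \<pi> k then 1 else 0) * (if j = \<pi> k then 1 else 0)) = (if i = j then 1 else (0::complex))" for i j
  proof -
    have "(\<Sum>k\<in>UNIV. cnj (if i = \<pi> k then 1 else 0) * (if j = \<pi> k then 1 else (0::complex)))
       = (\<Sum>k\<in>UNIV. cnj (if i = k then 1 else 0) * (if j = k then 1 else 0))"
      by (rule sum.reindex_bij_betw[OF assms])
    also have "\<dots> = (if i = j then 1 else 0)"
      by (simp add: if_distrib[of cnj] if_distrib[of "\<lambda>z. z * _"] cong: if_cong)
    finally show ?thesis .
  qed
  then show "adj (\<chi> a b. if b = \<pi> a then 1 else 0) ** (\<chi> a b. if b = \<pi> a then 1 else 0) = mat 1"
    by (simp add: vec_eq_iff matrix_matrix_mult_def mat_def)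
qed

text \<open>The reflection in \<open>(1, - 2)\<close> acts on the coordinates \<open>p\<close>, \<open>q\<close> as
  the matrix with rows \<open>(3/5, 4/5)\<close> and \<open>(4/5, - 3/5)\<close>.\<close>

lemma ex_reflection:
  fixes p q :: "'d::finite"
  assumes "p \<noteq> q"
  obtains V :: "'d op" where "V \<in> unitary_group" "\<And>a b. cnj (V $ a $ b) = V $ a $ b"
    "\<And>F. (\<Sum>a\<in>UNIV. V $ p $ a * F a) = 3/5 * F p + 4/5 * F q"
    "\<And>F. (\<Sum>a\<in>UNIV. V $ q $ a * F a) = 4/5 * F p - 3/5 * F q"
proof -
  define w :: "'d \<Rightarrow> complex" where "w a = (if a = p then 1 else 0) - 2 * (if a = q then 1 else 0)" for a
  define V :: "'d op" where "V = (\<chi> a b. (if a = b then 1 else 0) - 2/5 * (w a * w b))"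
  have wsum: "(\<Sum>a\<in>UNIV. w a * F a) = F p - 2 * F q" for F
  proof -
    have "(\<Sum>a\<in>UNIV. w a * F a) = (\<Sum>a\<in>UNIV. (if a = p then F a else 0) - 2 * (if a = q then F a else 0))"
      by (intro sum.cong) (auto simp: w_def algebra_simps)
    then show ?thesis by (simp add: sum_subtractf sum_distrib_left[symmetric])
  qed
  have w: "w p = 1" "w q = - 2" using assms by (simp_all add: w_def)
  have real: "cnj (w a) = w a" for a by (simp add: w_def)
  have Vsum: "(\<Sum>b\<in>UNIV. V $ a $ b * F b) = F a - 2/5 * w a * (F p - 2 * F q)" for a F
  proof -
    have "(\<Sum>b\<in>UNIV. V $ a $ b * F b) = (\<Sum>b\<in>UNIV. (if a = b then F b else 0) - 2/5 * w a * (w b * F b))"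
      by (intro sum.cong) (auto simp: V_def algebra_simps)
    also have "\<dots> = F a - 2/5 * w a * (F p - 2 * F q)"
      unfolding sum_subtractf sum_distrib_left[symmetric] wsum by simp
    finally show ?thesis .
  qed
  have cnjV: "cnj (V $ a $ b) = V $ a $ b" for a b
    by (simp add: V_def real if_distrib[of cnj] cong: if_cong)
  have sym: "V $ a $ b = V $ b $ a" for a b by (auto simp: V_def)
  have Vpq: "V $ p $ j - 2 * V $ q $ j = - w j" for j
    using assms by (auto simp: V_def w) (auto simp: w_def)
  have "V ** V = mat 1"
    by (simp add: vec_eq_iff matrix_matrix_mult_def Vsum Vpq) (auto simp: V_def w mat_def)
  moreover have "adj V = V" by (simp add: vec_eq_iff cnjV) (metis sym)
  ultimately have "V \<in> unitary_group" by (intro unitaryI) simp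
  then show ?thesis using cnjV
    by (rule that) (simp_all add: Vsum w, simp_all add: field_simps)
qed

lemma ex_bij_map_pair:
  fixes i j k l :: 'd
  assumes "i \<noteq> j" "k \<noteq> l"
  obtains \<pi> where "bij \<pi>" "\<pi> i = k" "\<pi> j = l"
proof
  define \<sigma> where "\<sigma> = Transposition.transpose i k"
  have ne: "\<sigma> j \<noteq> k" using assms by (auto simp: \<sigma>_def Transposition.transpose_def)
  show "bij (Transposition.transpose (\<sigma> j) l \<circ> \<sigma>)" by (simp add: \<sigma>_def bij_comp)
  show "(Transposition.transpose (\<sigma> j) l \<circ> \<sigma>) i = k" using ne assms by (simp add: \<sigma>_def Transposition.transpose_def)
  show "(Transposition.transpose (\<sigma> j) l \<circ> \<sigma>) j = l" by (simp add: Transposition.transpose_def)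
qed

text \<open>The matrix \<open>m\<close> satisfies m = V m V^\<dagger> for every unitary V; Haar
  first moments inherit this from left invariance.\<close>

definition twirl2_invariant :: "('d::finite \<Rightarrow> 'd \<Rightarrow> complex) \<Rightarrow> bool" where
  "twirl2_invariant m \<longleftrightarrow> (\<forall>V\<in>unitary_group. \<forall>i j.
     m i j = (\<Sum>a\<in>UNIV. \<Sum>b\<in>UNIV. V $ i $ a * (cnj (V $ j $ b) * m a b)))"

text \<open>The conjugations follow the moment \<open>g i j k l\<close> = E[Y_ij cnj(Y_kl)] of a
  random matrix Y whose law is invariant under Y -> V Y V^\<dagger>.\<close>

definition twirl4_invariant :: "('d::finite \<Rightarrow> 'd \<Rightarrow> 'd \<Rightarrow> 'd \<Rightarrow> complex) \<Rightarrow> bool" where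
  "twirl4_invariant g \<longleftrightarrow> (\<forall>V\<in>unitary_group. \<forall>i j k l.
     g i j k l = (\<Sum>a\<in>UNIV. \<Sum>b\<in>UNIV. \<Sum>c\<in>UNIV. \<Sum>d\<in>UNIV.
       V $ i $ a * (cnj (V $ j $ b) * (cnj (V $ k $ c) * (V $ l $ d * g a b c d)))))"

lemma sum_delta_mult:
  "(\<Sum>b\<in>UNIV. (if a = b then c else 0) * F b) = (c * F a :: complex)"
  "(\<Sum>b\<in>UNIV. (if b = a then c else 0) * F b) = (c * F a :: complex)"
  for a :: "'d::finite"
  by (simp_all add: if_distrib[of "\<lambda>z. z * _"] cong: if_cong)

text \<open>Schur's lemma with explicit unitaries: a phase at one coordinate kills the off-diagonal
  entries, and transpositions make the diagonal constant.\<close>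

lemma twirl2_invariant_eq:
  fixes m :: "'d::finite \<Rightarrow> 'd \<Rightarrow> complex"
  assumes inv: "twirl2_invariant m"
  shows "m i j = (if i = j then (\<Sum>a\<in>UNIV. m a a) / of_nat CARD('d) else 0)"
proof -
  have off: "m i j = 0" if "i \<noteq> j"
  proof -
    define \<theta> where "\<theta> a = (if a = i then \<i> else 1)" for a
    have "(\<chi> a b. if a = b then \<theta> a else 0) \<in> unitary_group" by (rule phase_unitary) (simp add: \<theta>_def)
    from inv[unfolded twirl2_invariant_def, rule_format, OF this, of i j]
    have "m i j = \<theta> i * (cnj (\<theta> j) * m i j)"
      by (simp add: if_distrib[of cnj] sum_distrib_left[symmetric] sum_delta_mult if_mult_sum(1) cong: if_cong)
    then have "m i j = \<i> * m i j" using that by (simp add: \<theta>_def)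
    then have "(1 - \<i>) * m i j = 0" by (simp add: algebra_simps)
    then show ?thesis by (auto simp: complex_eq_iff)
  qed
  have diag: "m a a = m i i" for a
  proof -
    have "(\<chi> x b. if b = Transposition.transpose a i x then 1 else 0) \<in> unitary_group" by (rule permutation_unitary) simp
    from inv[unfolded twirl2_invariant_def, rule_format, OF this, of a a]
    show ?thesis
      by (simp add: if_distrib[of cnj] sum_distrib_left[symmetric] sum_delta_mult if_mult_sum(1) cong: if_cong)
  qed
  have "(\<Sum>a\<in>UNIV. m a a) = (\<Sum>a\<in>(UNIV :: 'd set). m i i)" by (rule sum.cong[OF refl diag])
  also have "\<dots> = of_nat CARD('d) * m i i" by simp
  finally have mi: "m i i = (\<Sum>a\<in>UNIV. m a a) / of_nat CARD('d)" by (simp add: field_simps)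
  show ?thesis using off mi by auto
qed

text \<open>Diagonal unitaries kill all components except \<open>g i j i j\<close> and \<open>g i i k k\<close>, permutations
  leave three constants, and a reflection together with the trace condition determines
  their ratios.\<close>

lemma twirl4_invariant_eq:
  fixes g :: "'d::finite \<Rightarrow> 'd \<Rightarrow> 'd \<Rightarrow> 'd \<Rightarrow> complex"
  assumes inv: "twirl4_invariant g" and d: "2 \<le> CARD('d)"
    and tr: "\<And>k l. (\<Sum>i\<in>UNIV. g i i k l) = 0"
  defines "S \<equiv> \<Sum>i\<in>UNIV. \<Sum>j\<in>UNIV. g i j i j"
  shows "g i j k l = S / (of_nat CARD('d) ^ 2 - 1) *
    ((if i = k \<and> j = l then 1 else 0) - (if i = j \<and> k = l then 1 else 0) / of_nat CARD('d))"
proof -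
  note INV = inv[unfolded twirl4_invariant_def, rule_format]
  have phase: "g i j k l = \<theta> i * (cnj (\<theta> j) * (cnj (\<theta> k) * (\<theta> l * g i j k l)))"
    if "\<And>a. \<theta> a * cnj (\<theta> a) = 1" for \<theta> i j k l
    using INV[OF phase_unitary[OF that], of i j k l]
    by (simp add: if_distrib[of cnj] sum_distrib_left[symmetric] sum_delta_mult if_mult_sum(1) cong: if_cong)
  have perm: "g (\<pi> i) (\<pi> j) (\<pi> k) (\<pi> l) = g i j k l" if "bij \<pi>" for \<pi> i j k l
    using INV[OF permutation_unitary[OF that], of i j k l]
    by (simp add: if_distrib[of cnj] sum_distrib_left[symmetric] sum_delta_mult if_mult_sum(1) cong: if_cong)
  have zero: "g i j k l = 0" if "\<not> (i = k \<and> j = l)" "\<not> (i = j \<and> k = l)" for i j k l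
  proof -
    \<comment> \<open>The phase is \<i> rather than -1, since \<open>g i j j i\<close> is multiplied
      by squares of phases and a sign would not detect it.\<close>
    define \<theta> where "\<theta> m a = (if a = m then \<i> else 1)" for m a :: 'd
    have e: "g i j k l = (\<theta> m i * cnj (\<theta> m j) * cnj (\<theta> m k) * \<theta> m l) * g i j k l" for m
      using phase[of "\<theta> m" i j k l] by (simp add: \<theta>_def mult.assoc)
    have ex: "\<exists>m. \<theta> m i * cnj (\<theta> m j) * cnj (\<theta> m k) * \<theta> m l \<noteq> 1"
    proof (cases "i = k")
      case True
      then have "j \<noteq> l" using that by simp
      then have "\<theta> j i * cnj (\<theta> j j) * cnj (\<theta> j k) * \<theta> j l \<noteq> 1"
        using True by (auto simp: \<theta>_def complex_eq_iff)
      then show ?thesis ..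
    next
      case False
      then show ?thesis
      proof (cases "i = j")
        case True
        then have "k \<noteq> l" using that by simp
        then have "\<theta> k i * cnj (\<theta> k j) * cnj (\<theta> k k) * \<theta> k l \<noteq> 1"
          using True False by (auto simp: \<theta>_def complex_eq_iff)
        then show ?thesis ..
      next
        case ne: False
        have "\<theta> i i * cnj (\<theta> i j) * cnj (\<theta> i k) * \<theta> i l \<noteq> 1"
          using ne False by (auto simp: \<theta>_def complex_eq_iff)
        then show ?thesis ..
      qed
    qed
    then show ?thesis using e by (metis mult_cancel_right1)
  qed
  obtain p q :: 'd where pq: "p \<noteq> q" using d
    by (metis UNIV_I card_le_Suc0_iff_eq finite not_less_eq_eq numeral_2_eq_2)
  define C C1 C2 where "C = g p q p q" and "C1 = g p p p p" and "C2 = g p p q q"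
  have C: "g i j i j = C" "g i i j j = C2" if ij: "i \<noteq> j" for i j
  proof -
    obtain \<pi> where "bij \<pi>" "\<pi> p = i" "\<pi> q = j" using ex_bij_map_pair[OF pq ij] .
    then show "g i j i j = C" "g i i j j = C2" using perm[of \<pi>] by (auto simp: C_def C2_def)
  qed
  have C1: "g i i i i = C1" for i
    using perm[of "Transposition.transpose p i" p p p p] by (simp add: C1_def)
  obtain V :: "'d op" where V: "V \<in> unitary_group" "\<And>a b. cnj (V $ a $ b) = V $ a $ b"
    "\<And>F. (\<Sum>a\<in>UNIV. V $ p $ a * F a) = 3/5 * F p + 4/5 * F q"
    "\<And>F. (\<Sum>a\<in>UNIV. V $ q $ a * F a) = 4/5 * F p - 3/5 * F q"
    by (rule ex_reflection[OF pq]) blast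
  \<comment> \<open>The reflection contributes 337 = 9^2 + 16^2 from the two patterns of type
    \<open>g i j i j\<close>, and 288 = 2 * 12^2 from the two patterns \<open>g i i i i\<close> and
    from the two patterns \<open>g i i j j\<close>; the latter enter with a minus sign and are moved
    to the left.\<close>
  have "C + C2 * 288/625 = C1 * 288/625 + C * 337/625"
    using INV[OF V(1), of p q p q, unfolded V(2) sum_distrib_left[symmetric] V(3) V(4)] pq
    by (simp add: C1 C C[OF pq[symmetric]] zero[of p p p q] zero[of p p q p]
      zero[of p q p p] zero[of p q q p] zero[of p q q q] zero[of q p p p] zero[of q p p q] zero[of q p q q]
      zero[of q q p q] zero[of q q q p] C_def[symmetric] algebra_simps)
  then have "625 * (C + C2 * 288/625) = 625 * (C1 * 288/625 + C * 337/625)" by (rule arg_cong)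
  then have "288 * C1 = 288 * (C + C2)" by (simp add: algebra_simps)
  then have rel: "C1 = C + C2" by (simp only: mult_cancel_left) simp
  define n :: complex where "n = of_nat CARD('d)"
  have n: "n \<noteq> 0" "n\<^sup>2 - 1 \<noteq> 0"
  proof -
    show "n \<noteq> 0" by (simp add: n_def)
    have "CARD('d)\<^sup>2 \<noteq> 1" using d by (simp add: power_eq_1_iff)
    then have "n\<^sup>2 \<noteq> 1" unfolding n_def by (metis of_nat_eq_1_iff of_nat_power)
    then show "n\<^sup>2 - 1 \<noteq> 0" by simp
  qed
  have card: "of_nat (card (UNIV - {x :: 'd})) = n - 1" for x
    using d by (simp add: n_def card_Diff_singleton of_nat_diff)
  have "(\<Sum>i\<in>UNIV. g i i q q) = g q q q q + (\<Sum>i\<in>UNIV - {q}. g i i q q)"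
    by (rule sum.remove) auto
  also have "(\<Sum>i\<in>UNIV - {q}. g i i q q) = (n - 1) * C2" using C(2) card[of q] by simp
  finally have tr': "C1 + (n - 1) * C2 = 0" using tr C1 by simp
  then have "C + n * C2 = 0" unfolding rel by (simp add: algebra_simps)
  then have C2: "C2 = - C / n" using n by (simp add: field_simps add_eq_0_iff)
  have "(\<Sum>j\<in>UNIV. g i j i j) = C1 + (n - 1) * C" for i
  proof -
    have "(\<Sum>j\<in>UNIV. g i j i j) = g i i i i + (\<Sum>j\<in>UNIV - {i}. g i j i j)"
      by (rule sum.remove) auto
    also have "(\<Sum>j\<in>UNIV - {i}. g i j i j) = (n - 1) * C" using C(1)[of i] card[of i] by simp
    finally show ?thesis using C1 by simp
  qed
  then have "S = n * (C1 + (n - 1) * C)" by (simp add: S_def n_def)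
  also have "\<dots> = (n\<^sup>2 - 1) * C" unfolding rel C2 using n by (simp add: field_simps power2_eq_square)
  finally have S: "C = S / (n\<^sup>2 - 1)" using n by (simp add: field_simps)
  have "g i j k l = C * ((if i = k \<and> j = l then 1 else 0) - (if i = j \<and> k = l then 1 else 0) / n)"
  proof (cases "i = k \<and> j = l")
    case True
    then show ?thesis
      using C(1)[of i j] C1[of i] rel C2 by (cases "i = j") (auto simp: algebra_simps)
  next
    case False
    then show ?thesis
      using zero[of i k j l] C(2)[of i k] C2 by (cases "i = j \<and> k = l") auto
  qed
  then show ?thesis unfolding S n_def .
qed

section \<open>Moments of the Haar measure\<close>


lemma haar_prob_space: "haar_unitary \<mu> \<Longrightarrow> prob_space \<mu>"
  by (simp add: haar_unitary_def)

lemma haar_space: "haar_unitary \<mu> \<Longrightarrow> space \<mu> = unitary_group"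
  by (simp add: haar_unitary_def)

lemma haar_measurable:
  assumes "haar_unitary \<mu>" "f \<in> borel_measurable borel"
  shows "f \<in> borel_measurable \<mu>"
proof -
  have "sets \<mu> = sets (restrict_space borel unitary_group)" using assms by (simp add: haar_unitary_def)
  then have "measurable \<mu> borel = measurable (restrict_space borel unitary_group) (borel :: 'b measure)"
    by (rule measurable_cong_sets) simp
  then show ?thesis using measurable_restrict_space1[OF assms(2)] by simp
qed

lemma bounded_measurable_haar_entry:
  assumes "haar_unitary \<mu>"
  shows "bounded_measurable \<mu> (\<lambda>U. U $ i $ j)"
proof -
  have "(\<lambda>U :: 'a op. U $ i $ j) \<in> borel_measurable borel"
    by (intro borel_measurable_continuous_onI continuous_intros)
  then have "(\<lambda>U. U $ i $ j) \<in> borel_measurable \<mu>" by (rule haar_measurable[OF assms])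
  moreover have "\<forall>U\<in>space \<mu>. cmod (U $ i $ j) \<le> 1"
    using cmod_unitary_le_1 haar_space[OF assms] by blast
  ultimately show ?thesis unfolding bounded_measurable_def by blast
qed

lemma haar_left_invariant:
  fixes f :: "'d::finite op \<Rightarrow> complex"
  assumes \<mu>: "haar_unitary \<mu>" and V: "V \<in> unitary_group" and f: "f \<in> borel_measurable \<mu>"
  shows "(\<integral>U. f (V ** U) \<partial>\<mu>) = (\<integral>U. f U \<partial>\<mu>)"
proof -
  have sets: "sets \<mu> = sets (restrict_space borel unitary_group)" using \<mu> by (simp add: haar_unitary_def)
  have "continuous_on UNIV (\<lambda>U :: 'd op. V ** U)"
    unfolding matrix_matrix_mult_def
    by (intro continuous_on_vec_lambda continuous_intros)
  then have "(\<lambda>U. V ** U) \<in> measurable borel (borel :: 'd op measure)"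
    by (rule borel_measurable_continuous_onI)
  then have "(\<lambda>U. V ** U) \<in> measurable (restrict_space borel unitary_group) (restrict_space borel unitary_group)"
    by (intro measurable_restrict_space2 measurable_restrict_space1)
      (auto simp: space_restrict_space unitary_mult V)
  then have m: "(\<lambda>U. V ** U) \<in> measurable \<mu> \<mu>"
    using measurable_cong_sets[OF sets sets] by simp
  have "distr \<mu> \<mu> (\<lambda>U. V ** U) = \<mu>" using \<mu> V by (simp add: haar_unitary_def)
  then have "(\<integral>U. f U \<partial>\<mu>) = integral\<^sup>L (distr \<mu> \<mu> (\<lambda>U. V ** U)) f" by simp
  also have "\<dots> = (\<integral>U. f (V ** U) \<partial>\<mu>)" by (rule integral_distr[OF m f])
  finally show ?thesis by simp
qed

section \<open>The kernel of a random unitary conjugation\<close>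

definition haar_kernel :: "'d::finite op \<Rightarrow> ('d \<times> 'd) op" where
  "haar_kernel U = (\<chi> p q. of_nat CARD('d) * (U $ fst p $ snd p * cnj (U $ fst q $ snd q)))"

lemma haar_kernel_nth:
  "haar_kernel U $ p $ q = of_nat CARD('d) * (U $ fst p $ snd p * cnj (U $ fst q $ snd q))"
  for U :: "'d::finite op"
  by (simp add: haar_kernel_def)

text \<open>The kernel is a multiple of the rank-one matrix of the entries of \<open>U\<close>, read
  as a vector.\<close>

lemma psd_haar_kernel: "psd (haar_kernel U)"
proof -
  have "cinner v (haar_kernel U *v v) = of_real (of_nat CARD('a) * (cmod (\<Sum>p\<in>UNIV. cnj (v $ p) * U $ fst p $ snd p))\<^sup>2)" for v
  proof -
    have "cinner v (haar_kernel U *v v) = of_nat CARD('a) *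
      ((\<Sum>p\<in>UNIV. cnj (v $ p) * U $ fst p $ snd p) * (\<Sum>q\<in>UNIV. cnj (U $ fst q $ snd q) * v $ q))"
      unfolding cinner_sum_mult haar_kernel_nth sum_product unfolding sum_distrib_left
      by (intro sum.cong refl) (simp add: algebra_simps)
    also have "(\<Sum>q\<in>UNIV. cnj (U $ fst q $ snd q) * v $ q) = cnj (\<Sum>p\<in>UNIV. cnj (v $ p) * U $ fst p $ snd p)"
      by (simp add: mult.commute)
    finally show ?thesis by (simp only: complex_norm_square of_real_mult of_real_of_nat_eq)
  qed
  moreover have "adj (haar_kernel U) = haar_kernel U"
    by (simp add: vec_eq_iff haar_kernel_nth)
  ultimately show ?thesis by (simp add: psd_def)
qed


lemma unitary_sum:
  assumes "U \<in> unitary_group"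
  shows "(\<Sum>i\<in>UNIV. cnj (U $ i $ k) * U $ i $ l) = (if k = l then 1 else 0)"
    and "(\<Sum>i\<in>UNIV. U $ k $ i * cnj (U $ l $ i)) = (if k = l then 1 else 0)"
  using arg_cong[OF unitaryD(1)[OF assms], of "\<lambda>M. M $ k $ l"]
    arg_cong[OF unitaryD(2)[OF assms], of "\<lambda>M. M $ k $ l"]
  by (simp_all add: matrix_matrix_mult_def mat_def)

text \<open>For fixed input indices, left invariance makes the moment scalar in the output indices;
  orthonormality of the columns of \<open>U\<close> then determines its trace.\<close>

lemma haar_first_moment:
  fixes \<mu> :: "'d::finite op measure"
  assumes \<mu>: "haar_unitary \<mu>"
  shows "(\<integral>U. haar_kernel U $ p $ q \<partial>\<mu>) = (if p = q then 1 else 0)"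
proof -
  interpret prob_space \<mu> by (rule haar_prob_space[OF \<mu>])
  define m where "m i j = (\<integral>U. U $ i $ snd p * cnj (U $ j $ snd q) \<partial>\<mu>)" for i j
  have bounded_measurable: "bounded_measurable \<mu> (\<lambda>U. U $ i $ snd p * cnj (U $ j $ snd q))" for i j
    by (intro bounded_measurable_mult bounded_measurable_cnj bounded_measurable_haar_entry \<mu>)
  have "twirl2_invariant m"
    unfolding twirl2_invariant_def
  proof safe
    fix V :: "'d op" and i j assume V: "V \<in> unitary_group"
    have "m i j = (\<integral>U. (V ** U) $ i $ snd p * cnj ((V ** U) $ j $ snd q) \<partial>\<mu>)"
      unfolding m_def using bounded_measurable by (subst haar_left_invariant[OF \<mu> V]) (auto simp: bounded_measurable_def)
    also have "\<dots> = (\<integral>U. (\<Sum>a\<in>UNIV. \<Sum>b\<in>UNIV. V $ i $ a * (cnj (V $ j $ b) * (U $ a $ snd p * cnj (U $ b $ snd q)))) \<partial>\<mu>)"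
      by (simp add: matrix_matrix_mult_def sum_product algebra_simps)
    also have "\<dots> = (\<Sum>a\<in>UNIV. \<Sum>b\<in>UNIV. V $ i $ a * (cnj (V $ j $ b) * m a b))"
      unfolding m_def using bounded_measurable_integrable[OF bounded_measurable] by simp
    finally show "m i j = (\<Sum>a\<in>UNIV. \<Sum>b\<in>UNIV. V $ i $ a * (cnj (V $ j $ b) * m a b))" .
  qed
  from twirl2_invariant_eq[OF this]
  have m: "m i j = (if i = j then (\<Sum>a\<in>UNIV. m a a) / of_nat CARD('d) else 0)" for i j .
  have "(\<Sum>a\<in>UNIV. m a a) = (\<integral>U. (\<Sum>a\<in>UNIV. U $ a $ snd p * cnj (U $ a $ snd q)) \<partial>\<mu>)"
    unfolding m_def using bounded_measurable_integrable[OF bounded_measurable] by simp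
  also have "\<dots> = (\<integral>U. (if snd p = snd q then 1 else 0) \<partial>\<mu>)"
    using unitary_sum(1)[of _ "snd q" "snd p"]
    by (intro Bochner_Integration.integral_cong refl) (simp add: haar_space[OF \<mu>] mult.commute eq_commute)
  also have "\<dots> = (if snd p = snd q then 1 else 0)" by (simp add: prob_space)
  finally have s: "(\<Sum>a\<in>UNIV. m a a) = (if snd p = snd q then 1 else 0)" .
  have "(\<integral>U. haar_kernel U $ p $ q \<partial>\<mu>) = of_nat CARD('d) * m (fst p) (fst q)"
    by (simp add: haar_kernel_nth m_def)
  then show ?thesis unfolding m[of "fst p"] s by (auto simp: prod_eq_iff)
qed

text \<open>The trace-free part of the kernel at input indices \<open>k\<close>, \<open>l\<close>, viewed as a matrix
  in the output indices, is \<open>U X U\<^sup>\<dagger>\<close> for a traceless matrix \<open>X\<close>.\<close>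

definition centred_kernel :: "'d::finite op \<Rightarrow> 'd \<Rightarrow> 'd \<Rightarrow> 'd \<Rightarrow> 'd \<Rightarrow> complex" where
  "centred_kernel U k l i j =
     U $ i $ k * cnj (U $ j $ l) - (if i = j then 1 else 0) * (if k = l then 1 else 0) / of_nat CARD('d)"

lemma haar_kernel_diff_nth:
  "(haar_kernel U - mat 1) $ p $ q = of_nat CARD('d) * centred_kernel U (snd p) (snd q) (fst p) (fst q)"
  for U :: "'d::finite op"
  by (simp add: haar_kernel_nth centred_kernel_def mat_def right_diff_distrib prod_eq_iff)

lemma centred_kernel_mult:
  assumes "V \<in> unitary_group"
  shows "centred_kernel (V ** U) k l i j =
    (\<Sum>a\<in>UNIV. \<Sum>b\<in>UNIV. V $ i $ a * (cnj (V $ j $ b) * centred_kernel U k l a b))"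
proof -
  let ?c = "(if k = l then 1 else 0) / complex_of_nat CARD('a)"
  have "(\<Sum>a\<in>UNIV. \<Sum>b\<in>UNIV. V $ i $ a * (cnj (V $ j $ b) * centred_kernel U k l a b))
    = (\<Sum>a\<in>UNIV. \<Sum>b\<in>UNIV. (V $ i $ a * U $ a $ k) * (cnj (V $ j $ b) * cnj (U $ b $ l)))
      - (\<Sum>a\<in>UNIV. V $ i $ a * ((\<Sum>b\<in>UNIV. cnj (V $ j $ b) * (if b = a then 1 else 0)) * ?c))"
    unfolding sum_subtractf[symmetric] sum_distrib_left sum_distrib_right
    by (intro sum.cong refl) (auto simp: centred_kernel_def algebra_simps)
  also have "(\<Sum>a\<in>UNIV. V $ i $ a * ((\<Sum>b\<in>UNIV. cnj (V $ j $ b) * (if b = a then 1 else 0)) * ?c))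
     = (\<Sum>a\<in>UNIV. V $ i $ a * cnj (V $ j $ a)) * ?c"
    unfolding if_mult_sum(2) by (simp add: sum_distrib_right sum_divide_distrib algebra_simps)
  finally show ?thesis
    unfolding unitary_sum(2)[OF assms] sum_product[symmetric]
    by (simp add: centred_kernel_def matrix_matrix_mult_def)
qed

text \<open>Left invariance determines the dependence on the output indices up to the scalar S of
  \<open>twirl4_invariant_eq\<close>. This scalar is the mean Hilbert-Schmidt inner product of two
  rotated traceless matrices, which conjugation preserves, so the dependence on the input indices
  follows from unitarity.\<close>

lemma haar_second_moment:
  fixes \<mu> :: "'d::finite op measure"
  assumes \<mu>: "haar_unitary \<mu>" and d: "2 \<le> CARD('d)"
  shows "(\<integral>U. centred_kernel U k l i j * cnj (centred_kernel U k' l' i' j') \<partial>\<mu>) =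
    1 / (of_nat CARD('d) ^ 2 - 1) *
    ((if k = k' \<and> l = l' then 1 else 0) - (if k = l \<and> k' = l' then 1 else 0) / of_nat CARD('d)) *
    ((if i = i' \<and> j = j' then 1 else 0) - (if i = j \<and> i' = j' then 1 else 0) / of_nat CARD('d))"
proof -
  interpret prob_space \<mu> by (rule haar_prob_space[OF \<mu>])
  define n :: complex where "n = of_nat CARD('d)"
  have n: "n \<noteq> 0" by (simp add: n_def)
  have bm1: "bounded_measurable \<mu> (\<lambda>U. centred_kernel U k l i j)" for k l i j
    unfolding centred_kernel_def by (intro bounded_measurable_diff bounded_measurable_mult bounded_measurable_cnj bounded_measurable_haar_entry bounded_measurable_const \<mu>)
  define g where "g i j i' j' = (\<integral>U. centred_kernel U k l i j * cnj (centred_kernel U k' l' i' j') \<partial>\<mu>)" for i j i' j'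
  have bounded_measurable: "bounded_measurable \<mu> (\<lambda>U. centred_kernel U k l i j * cnj (centred_kernel U k' l' i' j'))" for i j i' j'
    by (intro bounded_measurable_mult bounded_measurable_cnj bm1)
  note int = bounded_measurable_integrable[OF bounded_measurable]
  have "twirl4_invariant g"
    unfolding twirl4_invariant_def
  proof safe
    fix V :: "'d op" and i j i' j' assume V: "V \<in> unitary_group"
    have "g i j i' j' = (\<integral>U. centred_kernel (V ** U) k l i j * cnj (centred_kernel (V ** U) k' l' i' j') \<partial>\<mu>)"
      unfolding g_def using bounded_measurable
      by (subst haar_left_invariant[OF \<mu> V, where f = "\<lambda>U. centred_kernel U k l i j * cnj (centred_kernel U k' l' i' j')"]) (auto simp: bounded_measurable_def)
    also have "\<dots> = (\<integral>U. (\<Sum>a\<in>UNIV. \<Sum>b\<in>UNIV. \<Sum>c\<in>UNIV. \<Sum>d\<in>UNIV.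
       V $ i $ a * (cnj (V $ j $ b) * (cnj (V $ i' $ c) * (V $ j' $ d *
        (centred_kernel U k l a b * cnj (centred_kernel U k' l' c d)))))) \<partial>\<mu>)"
      unfolding centred_kernel_mult[OF V] cnj_sum complex_cnj_mult complex_cnj_cnj
      unfolding sum_distrib_right unfolding sum_distrib_left by (simp add: algebra_simps)
    also have "\<dots> = (\<Sum>a\<in>UNIV. \<Sum>b\<in>UNIV. \<Sum>c\<in>UNIV. \<Sum>d\<in>UNIV.
       V $ i $ a * (cnj (V $ j $ b) * (cnj (V $ i' $ c) * (V $ j' $ d * g a b c d))))"
      unfolding g_def using int by simp
    finally show "g i j i' j' = (\<Sum>a\<in>UNIV. \<Sum>b\<in>UNIV. \<Sum>c\<in>UNIV. \<Sum>d\<in>UNIV.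
       V $ i $ a * (cnj (V $ j $ b) * (cnj (V $ i' $ c) * (V $ j' $ d * g a b c d))))" .
  qed
  moreover have tr: "(\<Sum>i\<in>UNIV. centred_kernel U k l i i) = 0" if "U \<in> unitary_group" for U k l
    using unitary_sum(1)[OF that, of l k] n
    by (simp add: centred_kernel_def sum_subtractf mult.commute)
  have "(\<Sum>i\<in>UNIV. g i i i' j') = 0" for i' j'
  proof -
    have "(\<Sum>i\<in>UNIV. g i i i' j') =
      (\<integral>U. (\<Sum>i\<in>UNIV. centred_kernel U k l i i) * cnj (centred_kernel U k' l' i' j') \<partial>\<mu>)"
      unfolding g_def sum_distrib_right using int by simp
    also have "\<dots> = (\<integral>U. 0 \<partial>\<mu>)"
      by (intro Bochner_Integration.integral_cong refl) (simp add: tr haar_space[OF \<mu>])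
    finally show ?thesis by simp
  qed
  ultimately have g: "g i j i' j' = (\<Sum>i\<in>UNIV. \<Sum>j\<in>UNIV. g i j i j) / (n ^ 2 - 1) *
    ((if i = i' \<and> j = j' then 1 else 0) - (if i = j \<and> i' = j' then 1 else 0) / n)" for i j i' j'
    unfolding n_def by (intro twirl4_invariant_eq d)
  have "(\<Sum>i\<in>UNIV. \<Sum>j\<in>UNIV. g i j i j) =
    (\<integral>U. (\<Sum>i\<in>UNIV. \<Sum>j\<in>UNIV. centred_kernel U k l i j * cnj (centred_kernel U k' l' i j)) \<partial>\<mu>)"
    unfolding g_def using int by simp
  \<comment> \<open>The integrand is constant on the unitary group: it is the inner product of the
    traceless parts of two matrix units.\<close>
  also have "\<dots> = (\<integral>U. (if k = k' \<and> l = l' then 1 else 0) - (if k = l \<and> k' = l' then 1 else 0) / n \<partial>\<mu>)"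
  proof (intro Bochner_Integration.integral_cong refl)
    fix U assume "U \<in> space \<mu>"
    then have U: "U \<in> unitary_group" by (simp add: haar_space[OF \<mu>])
    have "(\<Sum>i\<in>UNIV. \<Sum>j\<in>UNIV. centred_kernel U k l i j * cnj (centred_kernel U k' l' i j))
      = (\<Sum>i\<in>UNIV. \<Sum>j\<in>UNIV. centred_kernel U k l i j * (cnj (U $ i $ k') * U $ j $ l'))
        - (if k' = l' then 1 else 0) / n * (\<Sum>i\<in>UNIV. centred_kernel U k l i i)"
    proof -
      have "centred_kernel U k l i j * cnj (centred_kernel U k' l' i j) =
        centred_kernel U k l i j * (cnj (U $ i $ k') * U $ j $ l')
        - (if i = j then 1 else 0) * ((if k' = l' then 1 else 0) / n * centred_kernel U k l i j)" for i j
        unfolding centred_kernel_def[of U k'] by (simp add: n_def right_diff_distrib algebra_simps)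
      then show ?thesis
        by (simp only: sum_subtractf if_mult_sum(1)[of _ "\<lambda>_. 1"] sum_distrib_left mult_1)
    qed
    also have "\<dots> = (\<Sum>i\<in>UNIV. \<Sum>j\<in>UNIV. centred_kernel U k l i j * (cnj (U $ i $ k') * U $ j $ l'))"
      using tr[OF U] by simp
    also have "\<dots> = (\<Sum>i\<in>UNIV. \<Sum>j\<in>UNIV. (cnj (U $ i $ k') * U $ i $ k) * (cnj (U $ j $ l) * U $ j $ l')
        - (if i = j then 1 else 0) * ((if k = l then 1 else 0) / n * (cnj (U $ i $ k') * U $ j $ l')))"
      by (intro sum.cong refl) (simp add: centred_kernel_def n_def algebra_simps)
    also have "\<dots> = (\<Sum>i\<in>UNIV. cnj (U $ i $ k') * U $ i $ k) * (\<Sum>j\<in>UNIV. cnj (U $ j $ l) * U $ j $ l')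
        - (if k = l then 1 else 0) / n * (\<Sum>i\<in>UNIV. cnj (U $ i $ k') * U $ i $ l')"
      unfolding sum_product sum_subtractf if_mult_sum(1)[of _ "\<lambda>_. 1"] by (simp add: sum_distrib_left)
    also have "\<dots> = (if k = k' \<and> l = l' then 1 else 0) - (if k = l \<and> k' = l' then 1 else 0) / n"
      unfolding unitary_sum(1)[OF U] by auto
    finally show "(\<Sum>i\<in>UNIV. \<Sum>j\<in>UNIV. centred_kernel U k l i j * cnj (centred_kernel U k' l' i j)) = \<dots>" .
  qed
  also have "\<dots> = (if k = k' \<and> l = l' then 1 else 0) - (if k = l \<and> k' = l' then 1 else 0) / n"
    by (simp add: prob_space)
  finally have "g i j i' j' = ((if k = k' \<and> l = l' then 1 else 0) - (if k = l \<and> k' = l' then 1 else 0) / n) / (n ^ 2 - 1) *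
    ((if i = i' \<and> j = j' then 1 else 0) - (if i = j \<and> i' = j' then 1 else 0) / n)"
    using g[of i j i' j'] by simp
  then show ?thesis by (simp add: g_def n_def)
qed

lemma cmod_sum_sq_le:
  fixes f :: "'z::finite \<Rightarrow> complex"
  shows "(cmod (\<Sum>z\<in>UNIV. f z * B z))\<^sup>2 \<le> (\<Sum>z\<in>UNIV. (cmod (f z))\<^sup>2) * (\<Sum>z\<in>UNIV. (cmod (B z))\<^sup>2)"
proof -
  have "cmod (\<Sum>z\<in>UNIV. f z * B z) \<le> (\<Sum>z\<in>UNIV. cmod (f z) * cmod (B z))"
    unfolding norm_mult[symmetric] by (rule norm_sum)
  then have "(cmod (\<Sum>z\<in>UNIV. f z * B z))\<^sup>2 \<le> (\<Sum>z\<in>UNIV. cmod (f z) * cmod (B z))\<^sup>2"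
    by (rule power_mono) simp
  also have "\<dots> \<le> (\<Sum>z\<in>UNIV. (cmod (f z))\<^sup>2) * (\<Sum>z\<in>UNIV. (cmod (B z))\<^sup>2)"
    by (rule Cauchy_Schwarz_ineq_sum)
  finally show ?thesis .
qed

text \<open>The left-hand side is the squared norm of \<open>L\<close> projected, in each index, to the
  complement of the vector \<open>e\<close> respectively \<open>f\<close>, when these have squared norm \<open>n\<close>.\<close>

lemma projection_form_le:
  fixes L :: "'x::finite \<Rightarrow> 'z::finite \<Rightarrow> complex" and e :: "'x \<Rightarrow> real" and f :: "'z \<Rightarrow> real" and n :: real
  assumes n: "0 < n" and f: "(\<Sum>z\<in>UNIV. (f z)\<^sup>2) \<le> n"
  shows "Re (\<Sum>x\<in>UNIV. \<Sum>z\<in>UNIV. \<Sum>x'\<in>UNIV. \<Sum>z'\<in>UNIV. L x z * cnj (L x' z') *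
     (((if x = x' then 1 else 0) - of_real (e x * e x') / of_real n) *
      ((if z = z' then 1 else 0) - of_real (f z * f z') / of_real n)))
    \<le> (\<Sum>x\<in>UNIV. \<Sum>z\<in>UNIV. (cmod (L x z))\<^sup>2)"
proof -
  define A where "A x = (\<Sum>z\<in>UNIV. of_real (f z) * L x z)" for x
  define B where "B z = (\<Sum>x\<in>UNIV. of_real (e x) * L x z)" for z
  define h where "h x x' = (\<Sum>z\<in>UNIV. L x z * cnj (L x' z)) - A x * cnj (A x') / of_real n" for x x'
  have proj: "(\<Sum>z\<in>UNIV. \<Sum>z'\<in>UNIV. H z z' * ((if z = z' then 1 else 0) - of_real (w z * w z') / of_real n))
      = (\<Sum>z\<in>UNIV. H z z) - (\<Sum>z\<in>UNIV. \<Sum>z'\<in>UNIV. of_real (w z) * of_real (w z') * H z z') / of_real n"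
    for H :: "'y::finite \<Rightarrow> 'y \<Rightarrow> complex" and w :: "'y \<Rightarrow> real"
  proof -
    have "H z z' * ((if z = z' then 1 else 0) - of_real (w z * w z') / of_real n) =
       H z z' * (if z' = z then 1 else 0) - (of_real (w z) * of_real (w z') * H z z') / of_real n" for z z'
      by (auto simp: algebra_simps)
    then show ?thesis by (simp only: sum_subtractf if_mult_sum(2) sum_divide_distrib) simp
  qed
  have inner: "(\<Sum>z\<in>UNIV. \<Sum>z'\<in>UNIV. L x z * cnj (L x' z') * ((if z = z' then 1 else 0) - of_real (f z * f z') / of_real n)) = h x x'" for x x'
    unfolding proj h_def A_def cnj_sum sum_product by (simp add: algebra_simps)
  have "(\<Sum>x\<in>UNIV. \<Sum>z\<in>UNIV. \<Sum>x'\<in>UNIV. \<Sum>z'\<in>UNIV. L x z * cnj (L x' z') *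
     (((if x = x' then 1 else 0) - of_real (e x * e x') / of_real n) *
      ((if z = z' then 1 else 0) - of_real (f z * f z') / of_real n)))
    = (\<Sum>x\<in>UNIV. \<Sum>x'\<in>UNIV. h x x' * ((if x = x' then 1 else 0) - of_real (e x * e x') / of_real n))"
    unfolding inner[symmetric] sum_distrib_right
    by (rule sum.cong[OF refl], subst sum.swap, intro sum.cong refl) (simp only: mult_ac)
  also have "\<dots> = (\<Sum>x\<in>UNIV. h x x) - (\<Sum>x\<in>UNIV. \<Sum>x'\<in>UNIV. of_real (e x) * of_real (e x') * h x x') / of_real n"
    by (rule proj)
  also have "(\<Sum>x\<in>UNIV. \<Sum>x'\<in>UNIV. of_real (e x) * of_real (e x') * h x x') =
    (\<Sum>z\<in>UNIV. B z * cnj (B z)) - (\<Sum>z\<in>UNIV. of_real (f z) * B z) * cnj (\<Sum>z\<in>UNIV. of_real (f z) * B z) / of_real n"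
  proof -
    have "(\<Sum>x\<in>UNIV. \<Sum>x'\<in>UNIV. of_real (e x) * of_real (e x') * h x x') =
      (\<Sum>x\<in>UNIV. \<Sum>x'\<in>UNIV. \<Sum>z\<in>UNIV. (of_real (e x) * L x z) * (of_real (e x') * cnj (L x' z)))
      - (\<Sum>x\<in>UNIV. \<Sum>x'\<in>UNIV. (of_real (e x) * A x) * (of_real (e x') * cnj (A x'))) / of_real n"
      unfolding h_def sum_divide_distrib sum_subtractf[symmetric]
      by (intro sum.cong refl) (simp add: right_diff_distrib sum_distrib_left algebra_simps)
    also have "(\<Sum>x\<in>UNIV. \<Sum>x'\<in>UNIV. \<Sum>z\<in>UNIV. (of_real (e x) * L x z) * (of_real (e x') * cnj (L x' z)))
      = (\<Sum>z\<in>UNIV. \<Sum>x\<in>UNIV. \<Sum>x'\<in>UNIV. (of_real (e x) * L x z) * (of_real (e x') * cnj (L x' z)))"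
      by (rule sym, subst sum.swap, intro sum.cong refl, subst sum.swap, rule refl)
    also have "\<dots> = (\<Sum>z\<in>UNIV. B z * cnj (B z))"
      by (simp add: B_def sum_product)
    also have "(\<Sum>x\<in>UNIV. \<Sum>x'\<in>UNIV. (of_real (e x) * A x) * (of_real (e x') * cnj (A x')))
      = (\<Sum>x\<in>UNIV. of_real (e x) * A x) * cnj (\<Sum>x\<in>UNIV. of_real (e x) * A x)"
      by (simp add: sum_product)
    also have "(\<Sum>x\<in>UNIV. of_real (e x) * A x) = (\<Sum>z\<in>UNIV. of_real (f z) * B z)"
      unfolding A_def B_def sum_distrib_left by (subst sum.swap) (simp add: algebra_simps)
    finally show ?thesis .
  qed
  finally have "Re (\<Sum>x\<in>UNIV. \<Sum>z\<in>UNIV. \<Sum>x'\<in>UNIV. \<Sum>z'\<in>UNIV. L x z * cnj (L x' z') *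
     (((if x = x' then 1 else 0) - of_real (e x * e x') / of_real n) *
      ((if z = z' then 1 else 0) - of_real (f z * f z') / of_real n)))
    = (\<Sum>x\<in>UNIV. \<Sum>z\<in>UNIV. (cmod (L x z))\<^sup>2) - (\<Sum>x\<in>UNIV. (cmod (A x))\<^sup>2) / n
      - ((\<Sum>z\<in>UNIV. (cmod (B z))\<^sup>2) - (cmod (\<Sum>z\<in>UNIV. of_real (f z) * B z))\<^sup>2 / n) / n"
    unfolding h_def by (simp add: sum_subtractf cmod_sq sum_divide_distrib diff_divide_distrib)
  \<comment> \<open>By Cauchy-Schwarz the only positive correction to the squared norm of
    \<open>L\<close> is absorbed by the negative \<open>B\<close> term.\<close>
  moreover have "(cmod (\<Sum>z\<in>UNIV. of_real (f z) * B z))\<^sup>2 / n \<le> (\<Sum>z\<in>UNIV. (cmod (B z))\<^sup>2)"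
  proof -
    have "(cmod (\<Sum>z\<in>UNIV. of_real (f z) * B z))\<^sup>2 \<le> (\<Sum>z\<in>UNIV. (f z)\<^sup>2) * (\<Sum>z\<in>UNIV. (cmod (B z))\<^sup>2)"
      using cmod_sum_sq_le[of "\<lambda>z. of_real (f z)" B] by simp
    also have "\<dots> \<le> n * (\<Sum>z\<in>UNIV. (cmod (B z))\<^sup>2)"
      using f by (intro mult_right_mono sum_nonneg) auto
    finally show ?thesis using n by (simp add: field_simps)
  qed
  moreover have "0 \<le> (\<Sum>x\<in>UNIV. (cmod (A x))\<^sup>2) / n" using n by (simp add: sum_nonneg)
  ultimately show ?thesis using n
    by (smt (verit) divide_nonneg_pos)
qed

section \<open>Products of kernels\<close>


text \<open>Translates between pairs grouped by system and pairs grouped by role (both outputs, then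
  both inputs). \<open>contract\<close> uses the second grouping, tensor products of kernels the
  first.\<close>

definition interleave :: "'a \<times> 'b \<Rightarrow> 'c \<times> 'd \<Rightarrow> ('a \<times> 'c) \<times> ('b \<times> 'd)" where
  "interleave p q = ((fst p, fst q), (snd p, snd q))"

lemma interleave_simps [simp]: "fst (interleave p q) = (fst p, fst q)" "snd (interleave p q) = (snd p, snd q)"
  by (simp_all add: interleave_def)

lemma sum_interleave:
  fixes F :: "('a::finite \<times> 'c::finite) \<times> ('b::finite \<times> 'd::finite) \<Rightarrow> 'e::comm_monoid_add"
  shows "(\<Sum>p\<in>UNIV. F p) = (\<Sum>x\<in>UNIV. \<Sum>y\<in>UNIV. F (interleave x y))"
proof -
  have "(\<Sum>p\<in>UNIV. F p) = (\<Sum>z\<in>UNIV. F (interleave (fst z) (snd z)))"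
    by (rule sum.reindex_bij_witness[of _ "\<lambda>z. interleave (fst z) (snd z)" "\<lambda>p. interleave (fst p) (snd p)"])
      (auto simp: interleave_def)
  then show ?thesis by (simp add: sum_UNIV_prod[of "\<lambda>z. F (interleave (fst z) (snd z))"])
qed

lemma sum_sum_interleave:
  fixes F :: "'a::finite \<times> 'c::finite \<Rightarrow> 'b::finite \<times> 'd::finite \<Rightarrow> 'e::comm_monoid_add"
  shows "(\<Sum>p\<in>UNIV. \<Sum>q\<in>UNIV. F p q) = (\<Sum>x\<in>UNIV. \<Sum>y\<in>UNIV. F (fst x, fst y) (snd x, snd y))"
  using sum_interleave[of "\<lambda>z. F (fst z) (snd z)"] by (simp add: sum_UNIV_prod[of "\<lambda>z. F (fst z) (snd z)"])

text \<open>The second moment of the centred kernel is 1 / (n^2 - 1) times a tensor product of two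
  projections onto traceless matrices, one for the outputs and one for the inputs. The normalisation
  of the kernel contributes n^2, and n^2 / (n^2 - 1) is at most 4/3 for n \<ge> 2.\<close>

lemma haar_bounded_covariance:
  fixes \<mu> :: "'d::finite op measure"
  assumes \<mu>: "haar_unitary \<mu>" and d: "2 \<le> CARD('d)"
  shows "bounded_covariance \<mu> (\<lambda>U. haar_kernel U - mat 1) (4/3)"
  unfolding bounded_covariance_def
proof (intro conjI allI)
  interpret prob_space \<mu> by (rule haar_prob_space[OF \<mu>])
  have bounded_measurable_c: "bounded_measurable \<mu> (\<lambda>U. centred_kernel U k l i j)" for k l i j
    unfolding centred_kernel_def by (intro bounded_measurable_diff bounded_measurable_mult bounded_measurable_cnj bounded_measurable_haar_entry bounded_measurable_const \<mu>)
  show "bounded_measurable \<mu> (\<lambda>U. (haar_kernel U - mat 1) $ p $ q)" for p q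
    unfolding haar_kernel_diff_nth by (intro bounded_measurable_mult bounded_measurable_const bounded_measurable_c)
  fix l :: "'d \<times> 'd \<Rightarrow> 'd \<times> 'd \<Rightarrow> complex"
  define n :: real where "n = of_nat CARD('d)"
  have n: "2 \<le> n" using d by (simp add: n_def)
  define L where "L x z = l (fst x, fst z) (snd x, snd z)" for x z
  define y where "y U x z = centred_kernel U (fst z) (snd z) (fst x) (snd x)" for U :: "'d op" and x z
  \<comment> \<open>The identity matrix read as a vector, of squared norm n: the direction removed
    by the projections onto traceless matrices.\<close>
  define e where "e x = (if fst x = snd x then 1 else 0 :: real)" for x :: "'d \<times> 'd"
  have expand: "(\<Sum>p\<in>UNIV. \<Sum>q\<in>UNIV. l p q * (haar_kernel U - mat 1) $ p $ q) = of_real n * (\<Sum>x\<in>UNIV. \<Sum>z\<in>UNIV. L x z * y U x z)" for U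
    unfolding haar_kernel_diff_nth sum_distrib_left
    by (subst sum_sum_interleave) (simp add: L_def y_def n_def algebra_simps)
  have bounded_measurable: "bounded_measurable \<mu> (\<lambda>U. y U x z * cnj (y U x' z'))" for x z x' z'
    unfolding y_def by (intro bounded_measurable_mult bounded_measurable_cnj bounded_measurable_c)
  have moment: "(\<integral>U. y U x z * cnj (y U x' z') \<partial>\<mu>) = of_real (1 / (n\<^sup>2 - 1)) *
     (((if x = x' then 1 else 0) - of_real (e x * e x') / of_real n) *
      ((if z = z' then 1 else 0) - of_real (e z * e z') / of_real n))" for x z x' z'
    unfolding y_def haar_second_moment[OF \<mu> d]
    by (simp add: e_def n_def prod_eq_iff)
  have sq: "(\<Sum>x\<in>UNIV. \<Sum>z\<in>UNIV. L x z * y U x z) * cnj (\<Sum>x\<in>UNIV. \<Sum>z\<in>UNIV. L x z * y U x z)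
    = (\<Sum>x\<in>UNIV. \<Sum>z\<in>UNIV. \<Sum>x'\<in>UNIV. \<Sum>z'\<in>UNIV. L x z * cnj (L x' z') * (y U x z * cnj (y U x' z')))" for U
    unfolding cnj_sum sum_distrib_right unfolding sum_distrib_left
    by (intro sum.cong refl) (simp add: algebra_simps)
  have bounded_measurable_S: "bounded_measurable \<mu> (\<lambda>U. (\<Sum>x\<in>UNIV. \<Sum>z\<in>UNIV. L x z * y U x z) * cnj (\<Sum>x\<in>UNIV. \<Sum>z\<in>UNIV. L x z * y U x z))"
    unfolding sq by (intro bounded_measurable_sum bounded_measurable_mult[OF bounded_measurable_const bounded_measurable])
  have "(\<integral>U. (cmod (\<Sum>p\<in>UNIV. \<Sum>q\<in>UNIV. l p q * (haar_kernel U - mat 1) $ p $ q))\<^sup>2 \<partial>\<mu>)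
    = n\<^sup>2 * (\<integral>U. (cmod (\<Sum>x\<in>UNIV. \<Sum>z\<in>UNIV. L x z * y U x z))\<^sup>2 \<partial>\<mu>)"
    unfolding expand norm_mult power_mult_distrib by simp
  also have "(\<integral>U. (cmod (\<Sum>x\<in>UNIV. \<Sum>z\<in>UNIV. L x z * y U x z))\<^sup>2 \<partial>\<mu>) =
     Re (\<Sum>x\<in>UNIV. \<Sum>z\<in>UNIV. \<Sum>x'\<in>UNIV. \<Sum>z'\<in>UNIV. L x z * cnj (L x' z') * (\<integral>U. y U x z * cnj (y U x' z') \<partial>\<mu>))"
    unfolding cmod_sq bounded_measurable_integrable_Re(2)[OF bounded_measurable_S] unfolding sq
    using bounded_measurable_integrable[OF bounded_measurable] by simp
  also have "\<dots> = 1 / (n\<^sup>2 - 1) * Re (\<Sum>x\<in>UNIV. \<Sum>z\<in>UNIV. \<Sum>x'\<in>UNIV. \<Sum>z'\<in>UNIV. L x z * cnj (L x' z') *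
     (((if x = x' then 1 else 0) - of_real (e x * e x') / of_real n) *
      ((if z = z' then 1 else 0) - of_real (e z * e z') / of_real n)))"
    unfolding moment mult.left_commute[of _ "complex_of_real (1 / (n\<^sup>2 - 1))"] sum_distrib_left[symmetric]
    by (simp only: times_complex.simps Re_complex_of_real Im_complex_of_real)
  also have "\<dots> \<le> 1 / (n\<^sup>2 - 1) * (\<Sum>x\<in>UNIV. \<Sum>z\<in>UNIV. (cmod (L x z))\<^sup>2)"
  proof (intro mult_left_mono projection_form_le)
    have "(\<Sum>z\<in>UNIV. (e z)\<^sup>2) = n"
      by (simp add: e_def sum_UNIV_prod n_def if_distrib[of "\<lambda>x. x\<^sup>2"] cong: if_cong)
    then show "(\<Sum>z\<in>UNIV. (e z)\<^sup>2) \<le> n" by simp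
    have "1 \<le> n\<^sup>2" using n by (simp add: one_le_power)
    then show "0 \<le> 1 / (n\<^sup>2 - 1)" by simp
  qed (use n in auto)
  also have "(\<Sum>x\<in>UNIV. \<Sum>z\<in>UNIV. (cmod (L x z))\<^sup>2) = (\<Sum>p\<in>UNIV. \<Sum>q\<in>UNIV. (cmod (l p q))\<^sup>2)"
    unfolding L_def by (rule sum_sum_interleave[symmetric])
  finally have "(\<integral>U. (cmod (\<Sum>p\<in>UNIV. \<Sum>q\<in>UNIV. l p q * (haar_kernel U - mat 1) $ p $ q))\<^sup>2 \<partial>\<mu>)
    \<le> n\<^sup>2 * (1 / (n\<^sup>2 - 1) * (\<Sum>p\<in>UNIV. \<Sum>q\<in>UNIV. (cmod (l p q))\<^sup>2))"
    by (simp add: mult_left_mono)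
  also have "\<dots> = n\<^sup>2 / (n\<^sup>2 - 1) * (\<Sum>p\<in>UNIV. \<Sum>q\<in>UNIV. (cmod (l p q))\<^sup>2)" by simp
  also have "\<dots> \<le> 4/3 * (\<Sum>p\<in>UNIV. \<Sum>q\<in>UNIV. (cmod (l p q))\<^sup>2)"
  proof (intro mult_right_mono sum_nonneg)
    have "2\<^sup>2 \<le> n\<^sup>2" using n by (intro power_mono) auto
    then show "n\<^sup>2 / (n\<^sup>2 - 1) \<le> 4/3" by (simp add: field_simps)
  qed simp
  finally show "(\<integral>U. (cmod (\<Sum>p\<in>UNIV. \<Sum>q\<in>UNIV. l p q * (haar_kernel U - mat 1) $ p $ q))\<^sup>2 \<partial>\<mu>)
    \<le> 4/3 * (\<Sum>p\<in>UNIV. \<Sum>q\<in>UNIV. (cmod (l p q))\<^sup>2)" .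
qed

lemma sum_over_range:
  fixes f :: "'a::finite \<Rightarrow> 'b::finite"
  assumes "inj f"
  shows "(\<Sum>y\<in>UNIV. if y \<in> range f then g y else 0) = (\<Sum>x\<in>UNIV. g (f x) :: 'c::comm_monoid_add)"
proof -
  have "(\<Sum>y\<in>UNIV. if y \<in> range f then g y else 0) = (\<Sum>y\<in>range f. g y)"
    using sum.inter_restrict[of UNIV g "range f"] by simp
  then show ?thesis by (simp add: sum.reindex assms)
qed

text \<open>A linear functional of the compressed matrix is one of the full matrix with coefficients
  extended by zero, which has the same weight.\<close>

lemma bounded_covariance_reindex:
  fixes f :: "'c::finite \<Rightarrow> 'b::finite"
  assumes "bounded_covariance M N \<kappa>" and inj: "inj f"
  shows "bounded_covariance M (\<lambda>u. reindex f (N u)) \<kappa>"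
  unfolding bounded_covariance_def
proof (intro conjI allI)
  show "bounded_measurable M (\<lambda>u. reindex f (N u) $ p $ q)" for p q
    using assms(1) by (simp add: bounded_covariance_def)
  fix l :: "'c \<Rightarrow> 'c \<Rightarrow> complex"
  define l' where "l' p q = (if p \<in> range f then if q \<in> range f then l (inv f p) (inv f q) else 0 else 0)" for p q
  have e: "(\<Sum>p\<in>UNIV. \<Sum>q\<in>UNIV. h p q (l' p q)) = (\<Sum>p\<in>UNIV. \<Sum>q\<in>UNIV. h (f p) (f q) (l p q))"
    if "\<And>p q. h p q 0 = 0" for h :: "_ \<Rightarrow> _ \<Rightarrow> complex \<Rightarrow> 'z::comm_monoid_add"
  proof -
    have "(\<Sum>p\<in>UNIV. \<Sum>q\<in>UNIV. h p q (l' p q)) = (\<Sum>p\<in>UNIV. if p \<in> range f then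
       (\<Sum>q\<in>UNIV. if q \<in> range f then h p q (l (inv f p) (inv f q)) else 0) else 0)"
      using that by (intro sum.cong refl) (auto simp: l'_def intro!: sum.cong)
    then show ?thesis by (simp add: sum_over_range[OF inj] inv_f_f[OF inj])
  qed
  have "(\<Sum>p\<in>UNIV. \<Sum>q\<in>UNIV. l p q * reindex f (N u) $ p $ q) = (\<Sum>p\<in>UNIV. \<Sum>q\<in>UNIV. l' p q * N u $ p $ q)" for u
    using e[of "\<lambda>p q z. z * N u $ p $ q"] by simp
  moreover have "(\<Sum>p\<in>UNIV. \<Sum>q\<in>UNIV. (cmod (l' p q))\<^sup>2) = (\<Sum>p\<in>UNIV. \<Sum>q\<in>UNIV. (cmod (l p q))\<^sup>2)"
    using e[of "\<lambda>p q z. (cmod z)\<^sup>2"] by simp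
  moreover have "(\<integral>u. (cmod (\<Sum>p\<in>UNIV. \<Sum>q\<in>UNIV. l' p q * N u $ p $ q))\<^sup>2 \<partial>M)
        \<le> \<kappa> * (\<Sum>p\<in>UNIV. \<Sum>q\<in>UNIV. (cmod (l' p q))\<^sup>2)"
    using assms(1) unfolding bounded_covariance_def by blast
  ultimately show "(\<integral>u. (cmod (\<Sum>p\<in>UNIV. \<Sum>q\<in>UNIV. l p q * reindex f (N u) $ p $ q))\<^sup>2 \<partial>M)
        \<le> \<kappa> * (\<Sum>p\<in>UNIV. \<Sum>q\<in>UNIV. (cmod (l p q))\<^sup>2)"
    by (simp only:)
qed

section \<open>Independent kernels on two systems\<close>

lemma bounded_measurable_fst: "bounded_measurable M1 f \<Longrightarrow> bounded_measurable (M1 \<Otimes>\<^sub>M M2) (\<lambda>w. f (fst w))"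
  unfolding bounded_measurable_def by (auto simp: space_pair_measure)

lemma bounded_measurable_snd: "bounded_measurable M2 f \<Longrightarrow> bounded_measurable (M1 \<Otimes>\<^sub>M M2) (\<lambda>w. f (snd w))"
  unfolding bounded_measurable_def by (auto simp: space_pair_measure)

lemma (in pair_prob_space) integral_product_bounded_measurable:
  assumes "bounded_measurable M1 f" "bounded_measurable M2 g"
  shows "(\<integral>w. f (fst w) * g (snd w) \<partial>(M1 \<Otimes>\<^sub>M M2)) = (\<integral>u. f u \<partial>M1) * (\<integral>v. g v \<partial>M2)"
proof -
  have "integrable (M1 \<Otimes>\<^sub>M M2) (\<lambda>w. f (fst w) * g (snd w))"
    by (intro bounded_measurable_integrable bounded_measurable_mult bounded_measurable_fst bounded_measurable_snd assms)
  from integral_fst'[OF this] show ?thesis by simp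
qed

lemma (in pair_prob_space) integral_fst_comp:
  fixes q :: "'a \<Rightarrow> real"
  assumes "integrable M1 q"
  shows "integrable (M1 \<Otimes>\<^sub>M M2) (\<lambda>w. q (fst w))" "(\<integral>w. q (fst w) \<partial>(M1 \<Otimes>\<^sub>M M2)) = (\<integral>u. q u \<partial>M1)"
proof -
  have d: "distr (M1 \<Otimes>\<^sub>M M2) M1 fst = M1" by (rule M2.distr_pair_fst)
  show "integrable (M1 \<Otimes>\<^sub>M M2) (\<lambda>w. q (fst w))"
    using integrable_distr_eq[of fst "M1 \<Otimes>\<^sub>M M2" M1 q] assms unfolding d by simp
  show "(\<integral>w. q (fst w) \<partial>(M1 \<Otimes>\<^sub>M M2)) = (\<integral>u. q u \<partial>M1)"
    using integral_distr[of fst "M1 \<Otimes>\<^sub>M M2" M1 q] assms unfolding d by simp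
qed

lemma (in pair_prob_space) integral_snd_comp:
  fixes q :: "'b \<Rightarrow> real"
  assumes "integrable M2 q"
  shows "integrable (M1 \<Otimes>\<^sub>M M2) (\<lambda>w. q (snd w))" "(\<integral>w. q (snd w) \<partial>(M1 \<Otimes>\<^sub>M M2)) = (\<integral>u. q u \<partial>M2)"
proof -
  have d: "distr (M1 \<Otimes>\<^sub>M M2) M2 snd = M2"
  proof -
    interpret Q: pair_prob_space M2 M1 ..
    have "distr (M1 \<Otimes>\<^sub>M M2) M2 snd = distr (distr (M2 \<Otimes>\<^sub>M M1) (M1 \<Otimes>\<^sub>M M2) (\<lambda>(x, y). (y, x))) M2 snd"
      using distr_pair_swap by simp
    also have "\<dots> = distr (M2 \<Otimes>\<^sub>M M1) M2 fst"
      by (subst distr_distr) (auto simp: o_def case_prod_beta intro!: distr_cong)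
    finally show ?thesis using M1.distr_pair_fst[of M2] by simp
  qed
  show "integrable (M1 \<Otimes>\<^sub>M M2) (\<lambda>w. q (snd w))"
    using integrable_distr_eq[of snd "M1 \<Otimes>\<^sub>M M2" M2 q] assms unfolding d by simp
  show "(\<integral>w. q (snd w) \<partial>(M1 \<Otimes>\<^sub>M M2)) = (\<integral>u. q u \<partial>M2)"
    using integral_distr[of snd "M1 \<Otimes>\<^sub>M M2" M2 q] assms unfolding d by simp
qed

text \<open>By Fubini the bounds apply in turn. For a fixed value of \<open>N1\<close> the
  functional acts on \<open>N2\<close> with coefficients \<open>A u p q\<close>, and these are
  themselves linear functionals of \<open>N1\<close>.\<close>

lemma (in pair_prob_space) bounded_covariance_tensor:
  fixes N1 :: "'a \<Rightarrow> 'c::finite op" and N2 :: "'b \<Rightarrow> 'd::finite op"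
  assumes N1: "bounded_covariance M1 N1 \<kappa>\<^sub>1" and N2: "bounded_covariance M2 N2 \<kappa>\<^sub>2" and \<kappa>: "0 \<le> \<kappa>\<^sub>2"
  shows "bounded_covariance (M1 \<Otimes>\<^sub>M M2) (\<lambda>w. N1 (fst w) \<otimes>\<^sub>m N2 (snd w)) (\<kappa>\<^sub>1 * \<kappa>\<^sub>2)"
  unfolding bounded_covariance_def
proof (intro conjI allI)
  have bm1: "bounded_measurable M1 (\<lambda>u. N1 u $ p $ q)" for p q using N1 unfolding bounded_covariance_def by blast
  have bm2: "bounded_measurable M2 (\<lambda>u. N2 u $ p $ q)" for p q using N2 unfolding bounded_covariance_def by blast
  have bounded_measurable: "bounded_measurable (M1 \<Otimes>\<^sub>M M2) (\<lambda>w. (N1 (fst w) \<otimes>\<^sub>m N2 (snd w)) $ p $ q)" for p q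
    using bounded_measurable_mult[OF bounded_measurable_fst[OF bm1] bounded_measurable_snd[OF bm2]] by simp
  then show "bounded_measurable (M1 \<Otimes>\<^sub>M M2) (\<lambda>w. (N1 (fst w) \<otimes>\<^sub>m N2 (snd w)) $ p $ q)" for p q .
  fix l :: "'c \<times> 'd \<Rightarrow> 'c \<times> 'd \<Rightarrow> complex"
  define A where "A u p q = (\<Sum>x\<in>UNIV. \<Sum>y\<in>UNIV. l (x, p) (y, q) * N1 u $ x $ y)" for u p q
  define F where "F w = (cmod (\<Sum>p\<in>UNIV. \<Sum>q\<in>UNIV. l p q * (N1 (fst w) \<otimes>\<^sub>m N2 (snd w)) $ p $ q))\<^sup>2" for w
  have F: "F (u, v) = (cmod (\<Sum>p\<in>UNIV. \<Sum>q\<in>UNIV. A u p q * N2 v $ p $ q))\<^sup>2" for u v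
  proof -
    have "(\<Sum>p\<in>UNIV. \<Sum>q\<in>UNIV. l p q * (N1 u \<otimes>\<^sub>m N2 v) $ p $ q) =
      (\<Sum>x\<in>UNIV. \<Sum>p\<in>UNIV. \<Sum>y\<in>UNIV. \<Sum>q\<in>UNIV. l (x, p) (y, q) * N1 u $ x $ y * N2 v $ p $ q)"
      by (simp add: sum_UNIV_prod algebra_simps)
    also have "\<dots> = (\<Sum>p\<in>UNIV. \<Sum>x\<in>UNIV. \<Sum>q\<in>UNIV. \<Sum>y\<in>UNIV. l (x, p) (y, q) * N1 u $ x $ y * N2 v $ p $ q)"
      by (subst sum.swap, intro sum.cong refl, rule sum.swap)
    also have "\<dots> = (\<Sum>p\<in>UNIV. \<Sum>q\<in>UNIV. \<Sum>x\<in>UNIV. \<Sum>y\<in>UNIV. l (x, p) (y, q) * N1 u $ x $ y * N2 v $ p $ q)"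
      by (intro sum.cong refl, rule sum.swap)
    finally show ?thesis by (simp add: F_def A_def sum_distrib_right)
  qed
  have int: "integrable (M1 \<Otimes>\<^sub>M M2) F"
    unfolding F_def by (intro bounded_measurable_integrable_cmod_sq bounded_measurable_sum bounded_measurable_mult bounded_measurable_const bounded_measurable)
  have bmA: "bounded_measurable M1 (\<lambda>u. A u p q)" for p q
    unfolding A_def by (intro bounded_measurable_sum bounded_measurable_mult bounded_measurable_const bm1)
  note intA = M1.bounded_measurable_integrable_cmod_sq[OF bmA]
  have "(\<integral>w. F w \<partial>(M1 \<Otimes>\<^sub>M M2)) = (\<integral>u. (\<integral>v. F (u, v) \<partial>M2) \<partial>M1)"
    by (rule integral_fst'[OF int, symmetric])
  also have "\<dots> \<le> (\<integral>u. \<kappa>\<^sub>2 * (\<Sum>p\<in>UNIV. \<Sum>q\<in>UNIV. (cmod (A u p q))\<^sup>2) \<partial>M1)"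
  proof (rule integral_mono)
    show "integrable M1 (\<lambda>u. \<integral>v. F (u, v) \<partial>M2)" by (rule integrable_fst'[OF int])
    show "integrable M1 (\<lambda>u. \<kappa>\<^sub>2 * (\<Sum>p\<in>UNIV. \<Sum>q\<in>UNIV. (cmod (A u p q))\<^sup>2))"
      using intA by simp
    show "(\<integral>v. F (u, v) \<partial>M2) \<le> \<kappa>\<^sub>2 * (\<Sum>p\<in>UNIV. \<Sum>q\<in>UNIV. (cmod (A u p q))\<^sup>2)" for u
      unfolding F using N2 unfolding bounded_covariance_def by blast
  qed
  also have "\<dots> = \<kappa>\<^sub>2 * (\<Sum>p\<in>UNIV. \<Sum>q\<in>UNIV. \<integral>u. (cmod (A u p q))\<^sup>2 \<partial>M1)"
    using intA by simp
  also have "\<dots> \<le> \<kappa>\<^sub>2 * (\<Sum>p\<in>UNIV. \<Sum>q\<in>UNIV. \<kappa>\<^sub>1 * (\<Sum>x\<in>UNIV. \<Sum>y\<in>UNIV. (cmod (l (x, p) (y, q)))\<^sup>2))"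
  proof -
    have "(\<integral>u. (cmod (\<Sum>p\<in>UNIV. \<Sum>q\<in>UNIV. k p q * N1 u $ p $ q))\<^sup>2 \<partial>M1)
        \<le> \<kappa>\<^sub>1 * (\<Sum>p\<in>UNIV. \<Sum>q\<in>UNIV. (cmod (k p q))\<^sup>2)" for k
      using N1 unfolding bounded_covariance_def by blast
    then show ?thesis unfolding A_def by (intro mult_left_mono sum_mono \<kappa>)
  qed
  also have "\<dots> = \<kappa>\<^sub>1 * \<kappa>\<^sub>2 * (\<Sum>p\<in>UNIV. \<Sum>q\<in>UNIV. \<Sum>x\<in>UNIV. \<Sum>y\<in>UNIV. (cmod (l (x, p) (y, q)))\<^sup>2)"
    by (simp add: sum_distrib_left[symmetric])
  also have "(\<Sum>p\<in>UNIV. \<Sum>q\<in>UNIV. \<Sum>x\<in>UNIV. \<Sum>y\<in>UNIV. (cmod (l (x, p) (y, q)))\<^sup>2) =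
     (\<Sum>p\<in>UNIV. \<Sum>x\<in>UNIV. \<Sum>q\<in>UNIV. \<Sum>y\<in>UNIV. (cmod (l (x, p) (y, q)))\<^sup>2)"
    by (intro sum.cong refl, rule sum.swap)
  also have "\<dots> = (\<Sum>x\<in>UNIV. \<Sum>p\<in>UNIV. \<Sum>y\<in>UNIV. \<Sum>q\<in>UNIV. (cmod (l (x, p) (y, q)))\<^sup>2)"
    by (subst sum.swap, intro sum.cong refl, rule sum.swap)
  also have "\<dots> = (\<Sum>p\<in>UNIV. \<Sum>q\<in>UNIV. (cmod (l p q))\<^sup>2)"
    by (simp add: sum_UNIV_prod)
  finally show "(\<integral>w. (cmod (\<Sum>p\<in>UNIV. \<Sum>q\<in>UNIV. l p q * (N1 (fst w) \<otimes>\<^sub>m N2 (snd w)) $ p $ q))\<^sup>2 \<partial>(M1 \<Otimes>\<^sub>M M2))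
     \<le> \<kappa>\<^sub>1 * \<kappa>\<^sub>2 * (\<Sum>p\<in>UNIV. \<Sum>q\<in>UNIV. (cmod (l p q))\<^sup>2)"
    by (simp add: F_def)
qed

definition kernel_tensor :: "('a::finite \<times> 'b::finite) op \<Rightarrow> ('c::finite \<times> 'd::finite) op \<Rightarrow> (('a \<times> 'c) \<times> ('b \<times> 'd)) op" where
  "kernel_tensor A B = reindex (\<lambda>p. ((fst (fst p), fst (snd p)), (snd (fst p), snd (snd p)))) (A \<otimes>\<^sub>m B)"

lemma kernel_tensor_nth: "kernel_tensor A B $ p $ q =
    A $ (fst (fst p), fst (snd p)) $ (fst (fst q), fst (snd q)) * B $ (snd (fst p), snd (snd p)) $ (snd (fst q), snd (snd q))"
  by (simp add: kernel_tensor_def)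

lemma psd_kernel_tensor: "psd A \<Longrightarrow> psd B \<Longrightarrow> psd (kernel_tensor A B)"
  unfolding kernel_tensor_def by (intro psd_reindex psd_tensor)

lemma kernel_tensor_mat_1: "kernel_tensor (mat 1) (mat 1) = mat 1"
  by (auto simp: vec_eq_iff kernel_tensor_nth mat_def prod_eq_iff)

lemma marginal_1_nth: "marginal_1 M $ (a, x) $ (a', x') = (\<Sum>b\<in>UNIV. M $ ((a, b), x) $ ((a', b), x'))"
  by (simp add: marginal_1_def ptrace1_def)

lemma marginal_2_nth: "marginal_2 M $ (b, x) $ (b', x') = (\<Sum>a\<in>UNIV. M $ ((a, b), x) $ ((a, b'), x'))"
  by (simp add: marginal_2_def ptrace1_def)

text \<open>The factor \<open>mat 1\<close> sets the output indices of the second system equal, and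
  separately its input indices; this traces the system out of \<tau> and of \<rho>.\<close>

lemma contract_kernel_tensor_1:
  "contract (kernel_tensor A (mat 1)) \<tau> \<rho> = contract A (marginal_1 \<tau>) (marginal_1 \<rho>)"
proof -
  have "contract (kernel_tensor A (mat 1)) \<tau> \<rho> $ x $ y = contract A (marginal_1 \<tau>) (marginal_1 \<rho>) $ x $ y" for x y
  proof -
    let ?f = "\<lambda>p q s. A $ p $ q * (\<tau> $ ((fst p, fst s), fst x) $ ((fst q, fst s), fst y) * \<rho> $ ((snd p, snd s), snd x) $ ((snd q, snd s), snd y))"
    have "contract (kernel_tensor A (mat 1)) \<tau> \<rho> $ x $ y =
      (\<Sum>p\<in>UNIV. \<Sum>s\<in>UNIV. \<Sum>q\<in>UNIV. \<Sum>t\<in>UNIV. (if s = t then 1 else 0) *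
         (A $ p $ q * (\<tau> $ ((fst p, fst s), fst x) $ ((fst q, fst t), fst y) * \<rho> $ ((snd p, snd s), snd x) $ ((snd q, snd t), snd y))))"
      unfolding contract_nth sum_interleave kernel_tensor_nth
      by (intro sum.cong refl) (simp add: mat_def)
    also have "\<dots> = (\<Sum>p\<in>UNIV. \<Sum>s\<in>UNIV. \<Sum>q\<in>UNIV. ?f p q s)"
      by (simp only: if_mult_sum(1)[of _ "\<lambda>_. 1"] mult_1)
    also have "\<dots> = (\<Sum>p\<in>UNIV. \<Sum>q\<in>UNIV. \<Sum>s\<in>UNIV. ?f p q s)"
      by (intro sum.cong refl, rule sum.swap)
    also have "\<dots> = contract A (marginal_1 \<tau>) (marginal_1 \<rho>) $ x $ y"
      unfolding contract_nth marginal_1_nth mult.assoc[of "A $ _ $ _"] sum_product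
      by (simp add: sum_UNIV_prod[of "?f _ _"] sum_distrib_left)
    finally show ?thesis .
  qed
  then show ?thesis by (simp add: vec_eq_iff)
qed

lemma contract_kernel_tensor_2:
  "contract (kernel_tensor (mat 1) A) \<tau> \<rho> = contract A (marginal_2 \<tau>) (marginal_2 \<rho>)"
proof -
  have "contract (kernel_tensor (mat 1) A) \<tau> \<rho> $ x $ y = contract A (marginal_2 \<tau>) (marginal_2 \<rho>) $ x $ y" for x y
  proof -
    let ?f = "\<lambda>p q s. A $ p $ q * (\<tau> $ ((fst s, fst p), fst x) $ ((fst s, fst q), fst y) * \<rho> $ ((snd s, snd p), snd x) $ ((snd s, snd q), snd y))"
    have "contract (kernel_tensor (mat 1) A) \<tau> \<rho> $ x $ y =
      (\<Sum>s\<in>UNIV. \<Sum>p\<in>UNIV. \<Sum>t\<in>UNIV. \<Sum>q\<in>UNIV. (if s = t then 1 else 0) *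
         (A $ p $ q * (\<tau> $ ((fst s, fst p), fst x) $ ((fst t, fst q), fst y) * \<rho> $ ((snd s, snd p), snd x) $ ((snd t, snd q), snd y))))"
      unfolding contract_nth sum_interleave kernel_tensor_nth
      by (intro sum.cong refl) (simp add: mat_def)
    also have "\<dots> = (\<Sum>s\<in>UNIV. \<Sum>p\<in>UNIV. \<Sum>q\<in>UNIV. ?f p q s)"
      by (intro sum.cong refl, subst sum.swap) (simp only: if_mult_sum(1)[of _ "\<lambda>_. 1"] mult_1)
    also have "\<dots> = (\<Sum>p\<in>UNIV. \<Sum>q\<in>UNIV. \<Sum>s\<in>UNIV. ?f p q s)"
      by (subst sum.swap, intro sum.cong refl, rule sum.swap)
    also have "\<dots> = contract A (marginal_2 \<tau>) (marginal_2 \<rho>) $ x $ y"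
      unfolding contract_nth marginal_2_nth mult.assoc[of "A $ _ $ _"] sum_product
      by (simp add: sum_UNIV_prod[of "?f _ _"] sum_distrib_left)
    finally show ?thesis .
  qed
  then show ?thesis by (simp add: vec_eq_iff)
qed

lemma ptrace1_marginal_1: "ptrace1 (marginal_1 M) = ptrace1 M"
  by (simp add: vec_eq_iff ptrace1_def marginal_1_nth sum_UNIV_prod)

lemma ptrace1_marginal_2: "ptrace1 (marginal_2 M) = ptrace1 M"
  by (simp add: vec_eq_iff ptrace1_def marginal_2_nth sum_UNIV_prod) (intro allI, rule sum.swap)

lemma subnormalised_marginals:
  assumes "subnormalised M"
  shows "subnormalised (marginal_1 M)" "subnormalised (marginal_2 M)"
proof -
  have "trace (marginal_1 M) = trace M" "trace (marginal_2 M) = trace M"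
    by (metis trace_ptrace1 ptrace1_marginal_1) (metis trace_ptrace1 ptrace1_marginal_2)
  then show "subnormalised (marginal_1 M)" "subnormalised (marginal_2 M)"
    using assms by (simp_all add: subnormalised_def)
      (simp_all add: marginal_1_def marginal_2_def psd_ptrace1 psd_reindex)
qed

section \<open>The Choi matrix of the padded map\<close>


definition embed00 :: "'a \<times> 'b \<Rightarrow> ('a \<times> 2) \<times> ('b \<times> 2)" where
  "embed00 i = ((fst i, 0), (snd i, 0))"

lemma inj_embed00: "inj embed00"
  by (auto simp: inj_def embed00_def prod_eq_iff)

lemma range_embed00: "x \<in> range embed00 \<longleftrightarrow> snd (fst x) = 0 \<and> snd (snd x) = 0"
  by (auto simp: embed00_def image_iff prod_eq_iff)

lemma proj00_nth: "proj00 $ x $ y = (if x = y \<and> x \<in> range embed00 then 1 else 0)"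
  unfolding range_embed00 by (auto simp: proj00_def mat_def ketbra_def prod_eq_iff)

lemma project00_eq: "project00 X = reindex embed00 X"
proof -
  have "(proj00 ** X ** proj00) $ embed00 i $ embed00 j = X $ embed00 i $ embed00 j" for i j
  proof -
    have p: "proj00 $ embed00 i $ y = (if embed00 i = y then 1 else 0)"
      "proj00 $ y $ embed00 j = (if y = embed00 j then 1 else 0)" for y :: "('a \<times> 2) \<times> ('b \<times> 2)"
      by (auto simp: proj00_nth)
    have "(proj00 ** X) $ embed00 i $ y = X $ embed00 i $ y" for y
      by (simp add: matrix_matrix_mult_def p sum_delta_mult)
    then show ?thesis
      by (simp add: matrix_matrix_mult_def[of "proj00 ** X"] p if_distrib[of "\<lambda>z. _ * z"] cong: if_cong)
  qed
  from this[of "(a, b)" "(c, d)" for a b c d] show ?thesis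
    by (simp add: project00_def vec_eq_iff embed00_def)
qed

lemma superoperator_apply:
  assumes "superoperator T"
  shows "T X = (\<Sum>i\<in>UNIV. \<Sum>j\<in>UNIV. mscale (X $ i $ j) (T (ketbra i j)))"
  using assms by (subst op_expand) (simp add: superoperator_sum superoperator_iff)

lemma superoperator_hat:
  assumes "superoperator T"
  shows "superoperator (\<lambda>X. mscale 4 (T (project00 X)))"
  unfolding superoperator_iff project00_eq
proof (intro conjI allI)
  have add: "reindex embed00 (X + Y) = reindex embed00 X + reindex embed00 Y"
    and scale: "reindex embed00 (mscale c X) = mscale c (reindex embed00 X)" for c and X Y :: "(('a \<times> 2) \<times> ('b \<times> 2)) op"
    by (simp_all add: vec_eq_iff)
  show "mscale 4 (T (reindex embed00 (X + Y))) = mscale 4 (T (reindex embed00 X)) + mscale 4 (T (reindex embed00 Y))" for X Y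
    using assms by (simp add: add superoperator_iff) (simp add: vec_eq_iff distrib_left)
  show "mscale 4 (T (reindex embed00 (mscale c X))) = mscale c (mscale 4 (T (reindex embed00 X)))" for c X
    using assms by (simp add: scale superoperator_iff) (simp add: vec_eq_iff)
qed

text \<open>The quadratic form of a compressed block matrix is the original form on vectors extended
  by zero outside the range of \<open>embed00\<close>, so block positivity survives the
  projection.\<close>

lemma completely_positive_hat:
  assumes "completely_positive T"
  shows "completely_positive (\<lambda>X. mscale 4 (T (project00 X)))"
  unfolding completely_positive_def
proof (intro conjI allI impI)
  show "superoperator (\<lambda>X. mscale 4 (T (project00 X)))"
    using assms by (simp add: completely_positive_def superoperator_hat)
  fix k and X :: "nat \<Rightarrow> nat \<Rightarrow> (('a \<times> 2) \<times> ('b \<times> 2)) op"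
  assume X: "block_psd k X"
  have *: "cinner v (reindex embed00 Y *v w) = cinner (\<chi> x. if x \<in> range embed00 then v $ inv embed00 x else 0)
      (Y *v (\<chi> x. if x \<in> range embed00 then w $ inv embed00 x else 0))"
    for Y :: "(('a \<times> 2) \<times> ('b \<times> 2)) op" and v w
  proof -
    let ?w = "\<chi> x. if x \<in> range embed00 then w $ inv embed00 x else 0"
    have "Y $ x $ y * ?w $ y = (if y \<in> range embed00 then Y $ x $ y * w $ inv embed00 y else 0)" for x y
      by simp
    then have Y: "(Y *v ?w) $ x = (\<Sum>j\<in>UNIV. Y $ x $ embed00 j * w $ j)" for x
      by (simp only: matrix_vector_mult_def vec_lambda_beta sum_over_range[OF inj_embed00] inv_f_f[OF inj_embed00])
    have "cinner (\<chi> x. if x \<in> range embed00 then v $ inv embed00 x else 0) z = (\<Sum>i\<in>UNIV. cnj (v $ i) * z $ embed00 i)" for z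
    proof -
      have "cnj ((\<chi> x. if x \<in> range embed00 then v $ inv embed00 x else 0) $ x) * z $ x =
        (if x \<in> range embed00 then cnj (v $ inv embed00 x) * z $ x else 0)" for x by simp
      then show ?thesis by (simp only: cinner_def sum_over_range[OF inj_embed00] inv_f_f[OF inj_embed00])
    qed
    then show ?thesis by (simp add: Y) (simp add: cinner_def matrix_vector_mult_def)
  qed
  have "block_psd k (\<lambda>i j. project00 (X i j))"
  proof -
    have "adj (reindex embed00 Y) = reindex embed00 (adj Y)" for Y :: "(('a \<times> 2) \<times> ('b \<times> 2)) op"
      by (simp add: vec_eq_iff)
    then show ?thesis
      using X unfolding block_psd_def project00_eq * by simp
  qed
  then have "block_psd k (\<lambda>i j. T (project00 (X i j)))"
    using assms by (simp add: completely_positive_def)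
  moreover have "cinner v (mscale 4 Y *v w) = 4 * cinner v (Y *v w)" for Y :: "'c op" and v w
    by (simp add: cinner_def matrix_vector_mult_def sum_distrib_left algebra_simps)
  ultimately show "block_psd k (\<lambda>i j. mscale 4 (T (project00 (X i j))))"
    by (simp add: block_psd_def sum_distrib_left[symmetric] vec_eq_iff del: Re_sum)
qed

lemma reindex_embed00_ketbra:
  "reindex embed00 (ketbra x y) = (if x \<in> range embed00 \<and> y \<in> range embed00 then ketbra (inv embed00 x) (inv embed00 y) else 0)"
proof -
  have E: "embed00 k = z \<longleftrightarrow> z \<in> range embed00 \<and> k = inv embed00 z" for k z
    using inv_f_f[OF inj_embed00, of k] f_inv_into_f[of z embed00 UNIV] by auto
  have "reindex embed00 (ketbra x y) $ k $ l =
      (if x \<in> range embed00 \<and> y \<in> range embed00 then ketbra (inv embed00 x) (inv embed00 y) else 0) $ k $ l" for k l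
    unfolding reindex_nth ketbra_def by (simp add: E[of k x] E[of l y] del: split_paired_All)
  then show ?thesis by (simp only: vec_eq_iff) blast
qed

lemma hat_nth: "hat M $ (x, e) $ (y, f) =
    (if x \<in> range embed00 \<and> y \<in> range embed00 then M $ (inv embed00 x, e) $ (inv embed00 y, f) else 0)"
proof -
  have "inv embed00 ((a, 0), (b, 0)) = (a, b)" for a :: 'a and b :: 'b
    using inv_f_f[OF inj_embed00, of "(a, b)"] by (simp add: embed00_def)
  then show ?thesis
    unfolding range_embed00 by (cases x; cases y) (auto simp: hat_def ketbra_def split: prod.splits)
qed

text \<open>The factor 4 is the ratio of the Choi normalisations: the padded input space has four
  times the dimension of A1 \<otimes> A2.\<close>

lemma inv_choi_hat:
  fixes T :: "('a::finite \<times> 'b::finite) op \<Rightarrow> 'e::finite op"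
  assumes T: "superoperator T"
  shows "inv_choi (hat (choi T)) = (\<lambda>X. mscale 4 (T (project00 X)))"
proof -
  let ?T' = "\<lambda>X :: (('a \<times> 2) \<times> ('b \<times> 2)) op. mscale 4 (T (project00 X))"
  have T': "superoperator ?T'" by (rule superoperator_hat[OF T])
  have T0: "T 0 = 0" using superoperator_apply[OF T, of 0] by (simp add: vec_eq_iff)
  have "choi ?T' = hat (choi T)"
    by (simp add: vec_eq_iff choi_nth[OF T'] choi_nth[OF T] hat_nth)
      (simp add: project00_eq reindex_embed00_ketbra T0)
  with T' show ?thesis
    unfolding inv_choi_def using ex1_inv_choi[of "hat (choi T)"] by (intro the1_equality) auto
qed

lemma psd_ketbra: "psd (ketbra i i)"
proof -
  have "adj (ketbra i i) ** ketbra i i = ketbra i i"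
    by (auto simp: vec_eq_iff matrix_matrix_mult_def ketbra_def if_distrib[of cnj] if_distrib[of "\<lambda>z. z * _"] cong: if_cong)
  then show ?thesis by (metis psd_adj_mult)
qed

text \<open>The blocks \<open>ketbra i j\<close> form an unnormalised maximally entangled
  projection, so their images form a positive block matrix. The trace is an average of traces of
  images of basis states, each at most 1.\<close>

lemma subnormalised_choi:
  fixes T :: "('a::finite \<times> 'b::finite) op \<Rightarrow> 'e::finite op"
  assumes cp: "completely_positive T" and tni: "trace_nonincreasing T"
  shows "subnormalised (choi T)"
proof -
  have T: "superoperator T" using cp by (simp add: completely_positive_def)
  define k n where "k = CARD('a \<times> 'b)" and "n = of_nat (CARD('a) * CARD('b)) * (1::real)"
  have n: "n > 0" "complex_of_nat (CARD('a) * CARD('b)) = of_real n" by (simp_all add: n_def)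
  \<comment> \<open>Complete positivity is stated for blocks indexed by natural numbers, so the
    basis is enumerated.\<close>
  obtain h :: "nat \<Rightarrow> 'a \<times> 'b" where h: "bij_betw h {..<k} UNIV"
    using ex_bij_betw_nat_finite[of "UNIV :: ('a \<times> 'b) set"] by (auto simp: k_def atLeast0LessThan)
  have "block_psd k (\<lambda>i j. ketbra (h i) (h j))"
    unfolding block_psd_def
  proof (intro conjI allI impI)
    show "adj (ketbra (h i) (h j)) = ketbra (h j) (h i)" for i j
      by (auto simp: vec_eq_iff ketbra_def)
    fix v :: "nat \<Rightarrow> complex^('a \<times> 'b)"
    have "cinner (v i) (ketbra (h i) (h j) *v v j) = cnj (v i $ h i) * v j $ h j" for i j
    proof -
      have "(ketbra (h i) (h j) *v v j) $ x = (if x = h i then v j $ h j else 0)" for x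
        by (simp add: matrix_vector_mult_def ketbra_def sum_delta_mult)
      then show ?thesis by (simp add: cinner_def if_mult_sum(2))
    qed
    then have "(\<Sum>i<k. \<Sum>j<k. cinner (v i) (ketbra (h i) (h j) *v v j)) = cnj (\<Sum>j<k. v j $ h j) * (\<Sum>j<k. v j $ h j)"
      by (simp add: sum_product)
    also have "\<dots> = of_real ((cmod (\<Sum>j<k. v j $ h j))\<^sup>2)"
      by (simp only: complex_norm_square mult.commute)
    finally show "0 \<le> Re (\<Sum>i<k. \<Sum>j<k. cinner (v i) (ketbra (h i) (h j) *v v j))" by simp
  qed
  then have bp: "block_psd k (\<lambda>i j. T (ketbra (h i) (h j)))"
    using cp by (simp add: completely_positive_def)
  have herm: "adj (T (ketbra i j)) = T (ketbra j i)" for i j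
  proof -
    obtain i' j' where "i' < k" "j' < k" "i = h i'" "j = h j'"
      using h unfolding bij_betw_def by (metis UNIV_I imageE lessThan_iff)
    then show ?thesis using bp by (simp add: block_psd_def)
  qed
  have "psd (choi T)"
    unfolding psd_def
  proof (intro conjI allI)
    have "cnj (T (ketbra j i) $ f $ e) = T (ketbra i j) $ e $ f" for i j e f
      using arg_cong[OF herm[of j i], of "\<lambda>M. M $ e $ f"] by simp
    then show "adj (choi T) = choi T"
      by (simp add: vec_eq_iff choi_nth[OF T])
    fix v :: "complex^(('a \<times> 'b) \<times> 'e)"
    define w where "w i = (\<chi> e. v $ (i, e))" for i
    have "cinner v (choi T *v v) = (\<Sum>i\<in>UNIV. \<Sum>j\<in>UNIV. cinner (w i) (T (ketbra i j) *v w j)) / of_real n"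
    proof -
      have "cinner v (choi T *v v) = (\<Sum>i\<in>UNIV. \<Sum>e\<in>UNIV. \<Sum>j\<in>UNIV. \<Sum>f\<in>UNIV. cnj (v $ (i, e)) * (T (ketbra i j) $ e $ f * v $ (j, f)) / of_real n)"
        unfolding cinner_sum_mult sum_UNIV_prod[where 'a = "'a \<times> 'b"] choi_nth[OF T] n(2)
        by (intro sum.cong refl) simp
      also have "\<dots> = (\<Sum>i\<in>UNIV. \<Sum>j\<in>UNIV. \<Sum>e\<in>UNIV. \<Sum>f\<in>UNIV. cnj (v $ (i, e)) * (T (ketbra i j) $ e $ f * v $ (j, f)) / of_real n)"
        by (intro sum.cong refl, rule sum.swap)
      also have "\<dots> = (\<Sum>i\<in>UNIV. \<Sum>j\<in>UNIV. cinner (w i) (T (ketbra i j) *v w j)) / of_real n"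
        by (simp add: sum_divide_distrib[symmetric] cinner_def matrix_vector_mult_def w_def sum_distrib_left)
      finally show ?thesis .
    qed
    also have "(\<Sum>i\<in>UNIV. \<Sum>j\<in>UNIV. cinner (w i) (T (ketbra i j) *v w j)) =
      (\<Sum>i<k. \<Sum>j<k. cinner (w (h i)) (T (ketbra (h i) (h j)) *v w (h j)))"
      by (subst sum.reindex_bij_betw[OF h, symmetric], intro sum.cong refl)
         (rule sum.reindex_bij_betw[OF h, symmetric])
    finally have e: "cinner v (choi T *v v) = (\<Sum>i<k. \<Sum>j<k. cinner (w (h i)) (T (ketbra (h i) (h j)) *v w (h j))) / of_real n" .
    have "0 \<le> Re (\<Sum>i<k. \<Sum>j<k. cinner (w (h i)) (T (ketbra (h i) (h j)) *v w (h j)))"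
      by (rule bp[unfolded block_psd_def, THEN conjunct2, rule_format])
    then show "0 \<le> Re (cinner v (choi T *v v))"
      unfolding e Re_divide_of_real using n by simp
  qed
  moreover have "Re (trace (choi T)) \<le> 1"
  proof -
    have "trace (choi T) = (\<Sum>i\<in>UNIV. trace (T (ketbra i i))) / of_real n"
      by (simp add: trace_def sum_UNIV_prod[where 'a = "'a \<times> 'b"] choi_nth[OF T] sum_divide_distrib n(2)[simplified])
    then have "Re (trace (choi T)) = (\<Sum>i\<in>UNIV. Re (trace (T (ketbra i i)))) / n" by simp
    also have "\<dots> \<le> (\<Sum>i\<in>(UNIV :: ('a \<times> 'b) set). 1) / n"
    proof (intro divide_right_mono sum_mono)
      fix i :: "'a \<times> 'b"
      have "Re (trace (T (ketbra i i))) \<le> Re (trace (ketbra i i))"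
        using tni psd_ketbra by (auto simp: trace_nonincreasing_def)
      also have "\<dots> = 1" by (simp add: trace_def ketbra_def)
      finally show "Re (trace (T (ketbra i i))) \<le> 1" .
    qed (use n in simp)
    also have "\<dots> = 1" by (simp add: n_def)
    finally show ?thesis .
  qed
  ultimately show ?thesis by (simp add: subnormalised_def)
qed

section \<open>The kernel of the padded map\<close>

text \<open>The input qubit is 0 because the padded state lives there, the output qubit is 0 because
  the padded map projects onto it. The normalisation by the padded dimension is kept, so the mean is
  still \<open>mat 1\<close>.\<close>

definition projected_kernel :: "('a::finite \<times> 2) op \<Rightarrow> ('a \<times> 'a) op" where
  "projected_kernel U = reindex (\<lambda>p. ((fst p, 0), (snd p, 0))) (haar_kernel U)"

lemma projected_kernel_nth: "projected_kernel U $ p $ q =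
    2 * of_nat CARD('a) * (U $ (fst p, 0) $ (snd p, 0) * cnj (U $ (fst q, 0) $ (snd q, 0)))"
  for U :: "('a::finite \<times> 2) op"
  by (simp add: projected_kernel_def haar_kernel_nth)

lemma psd_projected_kernel: "psd (projected_kernel U)"
  unfolding projected_kernel_def by (intro psd_reindex psd_haar_kernel)

lemma projected_kernel_moments:
  fixes \<mu> :: "('a::finite \<times> 2) op measure"
  assumes \<mu>: "haar_unitary \<mu>"
  shows "bounded_covariance \<mu> (\<lambda>U. projected_kernel U - mat 1) (4/3)"
    and "bounded_measurable \<mu> (\<lambda>U. projected_kernel U $ p $ q)"
    and "(\<integral>U. projected_kernel U $ p $ q \<partial>\<mu>) = (if p = q then 1 else 0)"
proof -
  let ?f = "\<lambda>p :: 'a \<times> 'a. ((fst p, 0 :: 2), (snd p, 0 :: 2))"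
  have inj: "inj ?f" by (auto simp: inj_def prod_eq_iff)
  have "projected_kernel U - mat 1 = reindex ?f (haar_kernel U - mat 1)" for U :: "('a \<times> 2) op"
    using inj by (simp add: vec_eq_iff projected_kernel_def mat_def prod_eq_iff)
  \<comment> \<open>The padding qubit supplies the dimension bound behind the constant 4/3.\<close>
  moreover have "2 \<le> CARD('a \<times> 2)" by (simp add: Suc_leI)
  ultimately show "bounded_covariance \<mu> (\<lambda>U. projected_kernel U - mat 1) (4/3)"
    using bounded_covariance_reindex[OF haar_bounded_covariance[OF \<mu>] inj] by simp
  show "bounded_measurable \<mu> (\<lambda>U. projected_kernel U $ p $ q)"
    unfolding projected_kernel_nth by (intro bounded_measurable_mult bounded_measurable_const bounded_measurable_cnj bounded_measurable_haar_entry \<mu>)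
  show "(\<integral>U. projected_kernel U $ p $ q \<partial>\<mu>) = (if p = q then 1 else 0)"
    by (simp add: projected_kernel_def haar_first_moment[OF \<mu>] prod_eq_iff)
qed

text \<open>The factor 4 of the padded map and the factor |A1||A2| from inverting the Choi matrix
  combine to (2|A1|)(2|A2|), the normalisations of the two kernels.\<close>

lemma tensor_id_hat:
  fixes T :: "('a::finite \<times> 'b::finite) op \<Rightarrow> 'e::finite op" and \<rho> :: "(('a \<times> 'b) \<times> 'r::finite) op"
  assumes T: "superoperator T"
  shows "tensor_id (inv_choi (hat (choi T))) (((U\<^sub>1 \<otimes>\<^sub>m U\<^sub>2) \<otimes>\<^sub>m mat 1) \<circ>\<^sub>m hat \<rho>)
    = contract (kernel_tensor (projected_kernel U\<^sub>1) (projected_kernel U\<^sub>2)) (choi T) \<rho>"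
proof -
  let ?A = "(U\<^sub>1 \<otimes>\<^sub>m U\<^sub>2) \<otimes>\<^sub>m mat 1 :: ((('a \<times> 2) \<times> ('b \<times> 2)) \<times> 'r) op"
  let ?W = "U\<^sub>1 \<otimes>\<^sub>m U\<^sub>2"
  have conj: "(?A \<circ>\<^sub>m hat \<rho>) $ (x, r) $ (y, s) =
    (\<Sum>k\<in>UNIV. \<Sum>l\<in>UNIV. ?W $ x $ embed00 k * \<rho> $ (k, r) $ (l, s) * cnj (?W $ y $ embed00 l))" for x y r s
  proof -
    have left: "(?A ** Y) $ (x, r) $ z = (\<Sum>u\<in>UNIV. ?W $ x $ u * Y $ (u, r) $ z)" for Y :: "((('a \<times> 2) \<times> ('b \<times> 2)) \<times> 'r) op" and x r z
      unfolding matrix_matrix_mult_def sum_UNIV_prod[where 'b = 'r] vec_lambda_beta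
    proof (rule sum.cong[OF refl])
      fix u
      have A: "?A $ (x, r) $ (u, b) = ?W $ x $ u * (if r = b then 1 else 0)" for b by (simp add: mat_def)
      show "(\<Sum>b\<in>UNIV. ?A $ (x, r) $ (u, b) * Y $ (u, b) $ z) = ?W $ x $ u * Y $ (u, r) $ z"
        unfolding A mult.assoc[of "?W $ x $ u"] sum_distrib_left[symmetric] sum_delta_mult mult_1 ..
    qed
    have right: "(Y ** adj ?A) $ z $ (y, s) = (\<Sum>u\<in>UNIV. Y $ z $ (u, s) * cnj (?W $ y $ u))" for Y :: "((('a \<times> 2) \<times> ('b \<times> 2)) \<times> 'r) op" and z y s
    proof -
      have "Y ** adj ?A = adj (?A ** adj Y)" unfolding adj_mult adj_adj ..
      then have "(Y ** adj ?A) $ z $ (y, s) = cnj ((?A ** adj Y) $ (y, s) $ z)"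
        by (simp only: adj_nth)
      then show ?thesis unfolding left by (simp add: mult.commute)
    qed
    have "(?A \<circ>\<^sub>m hat \<rho>) $ (x, r) $ (y, s) =
      (\<Sum>v\<in>UNIV. (\<Sum>u\<in>UNIV. ?W $ x $ u * hat \<rho> $ (u, r) $ (v, s)) * cnj (?W $ y $ v))"
      unfolding conjugate_def right left ..
    also have "\<dots> = (\<Sum>v\<in>UNIV. if v \<in> range embed00 then (\<Sum>u\<in>UNIV. if u \<in> range embed00 then ?W $ x $ u * \<rho> $ (inv embed00 u, r) $ (inv embed00 v, s) else 0) * cnj (?W $ y $ v) else 0)"
      by (intro sum.cong refl) (auto simp: hat_nth intro!: sum.cong)
    also have "\<dots> = (\<Sum>l\<in>UNIV. \<Sum>k\<in>UNIV. ?W $ x $ embed00 k * \<rho> $ (k, r) $ (l, s) * cnj (?W $ y $ embed00 l))"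
      unfolding sum_over_range[OF inj_embed00] inv_f_f[OF inj_embed00] sum_distrib_right ..
    finally show ?thesis by (subst sum.swap)
  qed
  have T_nth: "T Y $ e $ f = (\<Sum>i\<in>UNIV. \<Sum>j\<in>UNIV. of_nat (CARD('a) * CARD('b)) * (Y $ i $ j * choi T $ (i, e) $ (j, f)))" for Y e f
    by (subst superoperator_apply[OF T]) (simp add: choi_nth[OF T])
  have "tensor_id (inv_choi (hat (choi T))) (?A \<circ>\<^sub>m hat \<rho>) $ (e, r) $ (f, s) =
    contract (kernel_tensor (projected_kernel U\<^sub>1) (projected_kernel U\<^sub>2)) (choi T) \<rho> $ (e, r) $ (f, s)" for e r f s
  proof -
    let ?n = "complex_of_nat (CARD('a) * CARD('b))"
    have "tensor_id (inv_choi (hat (choi T))) (?A \<circ>\<^sub>m hat \<rho>) $ (e, r) $ (f, s) =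
      (\<Sum>i\<in>UNIV. \<Sum>j\<in>UNIV. \<Sum>k\<in>UNIV. \<Sum>l\<in>UNIV.
        4 * ?n * (?W $ embed00 i $ embed00 k * \<rho> $ (k, r) $ (l, s) * cnj (?W $ embed00 j $ embed00 l) * choi T $ (i, e) $ (j, f)))"
      unfolding inv_choi_hat[OF T] tensor_id_def
      by (simp add: T_nth project00_eq conj[simplified] sum_distrib_left sum_distrib_right mult.assoc)
    also have "\<dots> = (\<Sum>i\<in>UNIV. \<Sum>k\<in>UNIV. \<Sum>j\<in>UNIV. \<Sum>l\<in>UNIV.
        4 * ?n * (?W $ embed00 i $ embed00 k * \<rho> $ (k, r) $ (l, s) * cnj (?W $ embed00 j $ embed00 l) * choi T $ (i, e) $ (j, f)))"
      by (rule sum.cong[OF refl], rule sum.swap)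
    also have "\<dots> = contract (kernel_tensor (projected_kernel U\<^sub>1) (projected_kernel U\<^sub>2)) (choi T) \<rho> $ (e, r) $ (f, s)"
      unfolding contract_nth sum_UNIV_prod[where 'a = "'a \<times> 'b" and 'b = "'a \<times> 'b"] kernel_tensor_nth projected_kernel_nth
      by (intro sum.cong refl) (simp add: embed00_def)
    finally show ?thesis .
  qed
  then show ?thesis by (simp add: vec_eq_iff)
qed

section \<open>The decoupling bound\<close>


lemma kernel_tensor_diff:
  "kernel_tensor A B - mat 1 = kernel_tensor (A - mat 1) (B - mat 1)
     + kernel_tensor (A - mat 1) (mat 1) + kernel_tensor (mat 1) (B - mat 1)"
  unfolding kernel_tensor_mat_1[symmetric]
  by (simp add: vec_eq_iff kernel_tensor_nth algebra_simps)

text \<open>Bounds from above and below on each factor do not simply multiply. Expanding the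
  products instead, the sum is twice A \<otimes> B + 1 \<otimes> 1 and the difference twice A
  \<otimes> 1 + 1 \<otimes> B, both positive.\<close>

lemma kernel_tensor_dominated:
  assumes "psd A" "psd B"
  shows "psd (kernel_tensor (A + mat 1) (B + mat 1) + kernel_tensor (A - mat 1) (B - mat 1))"
    and "psd (kernel_tensor (A + mat 1) (B + mat 1) - kernel_tensor (A - mat 1) (B - mat 1))"
proof -
  have "kernel_tensor (A + mat 1) (B + mat 1) + kernel_tensor (A - mat 1) (B - mat 1) =
      mscale (of_real 2) (kernel_tensor A B + kernel_tensor (mat 1) (mat 1))"
    "kernel_tensor (A + mat 1) (B + mat 1) - kernel_tensor (A - mat 1) (B - mat 1) =
      mscale (of_real 2) (kernel_tensor A (mat 1) + kernel_tensor (mat 1) B)"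
    by (simp_all add: vec_eq_iff kernel_tensor_nth algebra_simps)
  note eqs = this
  show "psd (kernel_tensor (A + mat 1) (B + mat 1) + kernel_tensor (A - mat 1) (B - mat 1))"
    "psd (kernel_tensor (A + mat 1) (B + mat 1) - kernel_tensor (A - mat 1) (B - mat 1))"
    unfolding eqs by (intro psd_mscale psd_add psd_kernel_tensor psd_mat_1 assms; simp)+
qed

lemma plus_mat_1_dominated:
  assumes "psd A"
  shows "psd ((A + mat 1) + (A - mat 1))" "psd ((A + mat 1) - (A - mat 1))"
  using psd_add[OF assms assms] psd_add[OF psd_mat_1 psd_mat_1] by (simp_all add: algebra_simps)

text \<open>The constants come from covariance 4/3, which gives (1 + 4/3) / 2 = 7/6, and from a
  dominating kernel of mean 2, which gives 2 * 2 = 4.\<close>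

lemma projected_kernel_single_bound:
  fixes \<mu> :: "('a::finite \<times> 2) op measure" and \<tau> :: "('a \<times> 'e::finite) op" and \<rho> :: "('a \<times> 'r::finite) op"
  assumes \<mu>: "haar_unitary \<mu>" and sub: "subnormalised \<tau>" "subnormalised \<rho>" and \<epsilon>: "0 < \<epsilon>"
    and H: "H_min \<epsilon> \<rho> + H_min \<epsilon> \<tau> > ereal (log 2 (1 / \<epsilon>))"
  obtains q where "integrable \<mu> q" "\<And>u. u \<in> space \<mu> \<Longrightarrow> trace_norm (contract (projected_kernel u - mat 1) \<tau> \<rho>) \<le> q u"
    "(\<integral>u. q u \<partial>\<mu>) \<le> 7/6 * sqrt \<epsilon> + 4 * \<epsilon>"
proof -
  interpret prob_space \<mu> by (rule haar_prob_space[OF \<mu>])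
  have D: "bounded_measurable \<mu> (\<lambda>u. (projected_kernel u + mat 1) $ p $ q)"
    "(\<integral>u. (projected_kernel u + mat 1) $ p $ q \<partial>\<mu>) = (if p = q then of_real 2 else 0)" for p q
    using projected_kernel_moments(2,3)[OF \<mu>, of p q] bounded_measurable_integrable[OF projected_kernel_moments(2)[OF \<mu>, of p q]]
    by (auto simp: mat_def prob_space intro!: bounded_measurable_add)
  have nonneg: "0 \<le> (4/3 :: real)" "0 \<le> (2 :: real)" by simp_all
  obtain q where "integrable \<mu> q"
    "\<And>u. u \<in> space \<mu> \<Longrightarrow> trace_norm (contract (projected_kernel u - mat 1) \<tau> \<rho>) \<le> q u"
    "(\<integral>u. q u \<partial>\<mu>) \<le> (1 + 4/3) / 2 * sqrt \<epsilon> + 2 * 2 * \<epsilon>"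
    by (rule smoothed_trace_norm_bound[OF projected_kernel_moments(1)[OF \<mu>] nonneg D
          plus_mat_1_dominated[OF psd_projected_kernel] sub \<epsilon> H]) blast
  then show ?thesis by (intro that) auto
qed

text \<open>No measurability of \<open>f\<close> is needed, because the integral of a non-integrable
  function is 0.\<close>

lemma integral_le_of_dominated:
  fixes f q :: "'u \<Rightarrow> real"
  assumes "integrable M q" "\<And>u. u \<in> space M \<Longrightarrow> f u \<le> q u" "(\<integral>u. q u \<partial>M) \<le> c" "0 \<le> c"
  shows "(\<integral>u. f u \<partial>M) \<le> c"
proof (cases "integrable M f")
  case True
  then show ?thesis using integral_mono[OF True assms(1,2)] assms(3) by simp
next
  case False
  then show ?thesis using assms(4) by (simp add: not_integrable_integral_eq)
qed

text \<open>The coefficients collect the three summands: 67/18 = 7/6 + 7/6 + 25/18 and 16 = 4 + 4 +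
  8. Since 5/7 exceeds sqrt(1/2), the left-hand side is at most (67/18 + 80/7) sqrt \<epsilon>,
  which is below 18 sqrt \<epsilon>.\<close>

lemma smoothing_error_le:
  fixes \<epsilon> :: real
  assumes "0 < \<epsilon>" "\<epsilon> < 1/2"
  shows "67/18 * sqrt \<epsilon> + 16 * \<epsilon> \<le> 18 * \<epsilon> powr (1/128)"
proof -
  define s where "s = sqrt \<epsilon>"
  have s: "0 < s" "s * s = \<epsilon>" using assms by (simp_all add: s_def)
  have "s \<le> 5/7"
    unfolding s_def using assms by (intro real_le_lsqrt) (auto simp: power2_eq_square)
  then have "s * s \<le> s * (5/7)" using s by (intro mult_left_mono) auto
  then have "67/18 * s + 16 * \<epsilon> \<le> 18 * s" using s by simp
  moreover have "s = \<epsilon> powr (1/2)" using assms by (simp add: s_def powr_half_sqrt)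
  moreover have "\<epsilon> powr (1/2) \<le> \<epsilon> powr (1/128)" using assms by (intro powr_mono') auto
  ultimately show ?thesis by (simp add: s_def)
qed

text \<open>Here 2 is the bound on the expected trace norm that holds without any smoothing.\<close>

lemma trivial_error_le:
  fixes \<epsilon> :: real
  assumes "1/2 \<le> \<epsilon>" "\<epsilon> < 1"
  shows "2 \<le> 18 * \<epsilon> powr (1/128)"
proof -
  have "\<epsilon> powr 1 \<le> \<epsilon> powr (1/128)" using assms by (intro powr_mono') auto
  then show ?thesis using assms by simp
qed

lemma decoupling_bound:
  fixes \<mu>\<^sub>1 :: "('a\<^sub>1::finite \<times> 2) op measure" and \<mu>\<^sub>2 :: "('a\<^sub>2::finite \<times> 2) op measure"
    and \<tau> :: "(('a\<^sub>1 \<times> 'a\<^sub>2) \<times> 'e::finite) op" and \<rho> :: "(('a\<^sub>1 \<times> 'a\<^sub>2) \<times> 'r::finite) op"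
  assumes \<mu>: "haar_unitary \<mu>\<^sub>1" "haar_unitary \<mu>\<^sub>2"
    and sub: "subnormalised \<tau>" "subnormalised \<rho>" and \<epsilon>: "0 < \<epsilon>" "\<epsilon> < 1"
    and H1: "H_min \<epsilon> (marginal_1 \<rho>) + H_min \<epsilon> (marginal_1 \<tau>) > ereal (log 2 (1 / \<epsilon>))"
    and H2: "H_min \<epsilon> (marginal_2 \<rho>) + H_min \<epsilon> (marginal_2 \<tau>) > ereal (log 2 (1 / \<epsilon>))"
    and H: "H_min \<epsilon> \<rho> + H_min \<epsilon> \<tau> > ereal (log 2 (1 / \<epsilon>))"
  shows "(\<integral>w. trace_norm (contract (kernel_tensor (projected_kernel (fst w)) (projected_kernel (snd w)) - mat 1) \<tau> \<rho>)
      \<partial>(\<mu>\<^sub>1 \<Otimes>\<^sub>M \<mu>\<^sub>2)) \<le> 18 * \<epsilon> powr (1/128)"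
proof -
  interpret M1: prob_space \<mu>\<^sub>1 by (rule haar_prob_space[OF \<mu>(1)])
  interpret M2: prob_space \<mu>\<^sub>2 by (rule haar_prob_space[OF \<mu>(2)])
  interpret pair_prob_space \<mu>\<^sub>1 \<mu>\<^sub>2 ..
  let ?M = "\<mu>\<^sub>1 \<Otimes>\<^sub>M \<mu>\<^sub>2"
  note k1 = projected_kernel_moments[OF \<mu>(1)] and k2 = projected_kernel_moments[OF \<mu>(2)]
  have psds: "psd \<tau>" "psd \<rho>" and traces: "Re (trace \<tau>) \<le> 1" "Re (trace \<rho>) \<le> 1"
    using sub by (simp_all add: subnormalised_def)
  show ?thesis
  \<comment> \<open>For \<epsilon> near 1 the smoothing estimate approaches 67/18 + 16, which
    exceeds 18; large \<epsilon> is left to the trivial bound.\<close>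
  proof (cases "\<epsilon> < 1/2")
    case True
    obtain q1 where q1: "integrable \<mu>\<^sub>1 q1"
      "\<And>u. u \<in> space \<mu>\<^sub>1 \<Longrightarrow> trace_norm (contract (projected_kernel u - mat 1) (marginal_1 \<tau>) (marginal_1 \<rho>)) \<le> q1 u"
      "(\<integral>u. q1 u \<partial>\<mu>\<^sub>1) \<le> 7/6 * sqrt \<epsilon> + 4 * \<epsilon>"
      using projected_kernel_single_bound[OF \<mu>(1) subnormalised_marginals(1)[OF sub(1)] subnormalised_marginals(1)[OF sub(2)] \<epsilon>(1) H1]
      by blast
    obtain q2 where q2: "integrable \<mu>\<^sub>2 q2"
      "\<And>u. u \<in> space \<mu>\<^sub>2 \<Longrightarrow> trace_norm (contract (projected_kernel u - mat 1) (marginal_2 \<tau>) (marginal_2 \<rho>)) \<le> q2 u"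
      "(\<integral>u. q2 u \<partial>\<mu>\<^sub>2) \<le> 7/6 * sqrt \<epsilon> + 4 * \<epsilon>"
      using projected_kernel_single_bound[OF \<mu>(2) subnormalised_marginals(2)[OF sub(1)] subnormalised_marginals(2)[OF sub(2)] \<epsilon>(1) H2]
      by blast
    let ?N = "\<lambda>w. kernel_tensor (projected_kernel (fst w) - mat 1) (projected_kernel (snd w) - mat 1)"
    let ?D = "\<lambda>w. kernel_tensor (projected_kernel (fst w) + mat 1) (projected_kernel (snd w) + mat 1)"
    have inj: "inj (\<lambda>p :: ('a\<^sub>1 \<times> 'a\<^sub>2) \<times> ('a\<^sub>1 \<times> 'a\<^sub>2). ((fst (fst p), fst (snd p)), (snd (fst p), snd (snd p))))"
      by (auto simp: inj_def prod_eq_iff)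
    have cov: "bounded_covariance ?M ?N (4/3 * (4/3))"
      unfolding kernel_tensor_def
      by (intro bounded_covariance_reindex[OF _ inj] bounded_covariance_tensor k1(1) k2(1)) simp
    have f: "bounded_measurable \<mu>\<^sub>1 (\<lambda>u. (projected_kernel u + mat 1) $ p $ q)"
      "(\<integral>u. (projected_kernel u + mat 1) $ p $ q \<partial>\<mu>\<^sub>1) = (if p = q then 2 else 0)" for p q
      using k1(2,3)[of p q] M1.bounded_measurable_integrable[OF k1(2)[of p q]]
      by (auto simp: mat_def M1.prob_space intro!: bounded_measurable_add)
    have g: "bounded_measurable \<mu>\<^sub>2 (\<lambda>u. (projected_kernel u + mat 1) $ p $ q)"
      "(\<integral>u. (projected_kernel u + mat 1) $ p $ q \<partial>\<mu>\<^sub>2) = (if p = q then 2 else 0)" for p q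
      using k2(2,3)[of p q] M2.bounded_measurable_integrable[OF k2(2)[of p q]]
      by (auto simp: mat_def M2.prob_space intro!: bounded_measurable_add)
    have D: "bounded_measurable ?M (\<lambda>w. ?D w $ p $ q)" for p q
      unfolding kernel_tensor_nth by (intro bounded_measurable_mult bounded_measurable_fst[OF f(1)] bounded_measurable_snd[OF g(1)])
    \<comment> \<open>By independence the mean of the dominating kernel is the product of two means
      2.\<close>
    have ED: "(\<integral>w. ?D w $ p $ q \<partial>?M) = (if p = q then of_real 4 else 0)" for p q
      unfolding kernel_tensor_nth integral_product_bounded_measurable[OF f(1) g(1)] f(2) g(2)
      by (auto simp: prod_eq_iff)
    have nonneg: "0 \<le> (4/3 * (4/3) :: real)" "0 \<le> (4 :: real)" by simp_all
    obtain q12 where q12: "integrable ?M q12"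
      "\<And>w. w \<in> space ?M \<Longrightarrow> trace_norm (contract (?N w) \<tau> \<rho>) \<le> q12 w"
      "(\<integral>w. q12 w \<partial>?M) \<le> (1 + 4/3 * (4/3)) / 2 * sqrt \<epsilon> + 2 * 4 * \<epsilon>"
      by (rule smoothed_trace_norm_bound[OF cov nonneg D ED
            kernel_tensor_dominated[OF psd_projected_kernel psd_projected_kernel] sub \<epsilon>(1) H]) blast
    note i1 = integral_fst_comp[OF q1(1)] and i2 = integral_snd_comp[OF q2(1)]
    show ?thesis
    proof (rule integral_le_of_dominated)
      show "integrable ?M (\<lambda>w. q12 w + q1 (fst w) + q2 (snd w))"
        using q12(1) i1(1) i2(1) by simp
      have "(\<integral>w. q12 w + q1 (fst w) + q2 (snd w) \<partial>?M) = (\<integral>w. q12 w \<partial>?M) + (\<integral>u. q1 u \<partial>\<mu>\<^sub>1) + (\<integral>u. q2 u \<partial>\<mu>\<^sub>2)"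
        using q12(1) i1 i2 by simp
      also have "\<dots> \<le> 67/18 * sqrt \<epsilon> + 16 * \<epsilon>"
        using q12(3) q1(3) q2(3) by simp
      also have "\<dots> \<le> 18 * \<epsilon> powr (1/128)" by (rule smoothing_error_le[OF \<epsilon>(1) True])
      finally show "(\<integral>w. q12 w + q1 (fst w) + q2 (snd w) \<partial>?M) \<le> 18 * \<epsilon> powr (1/128)" .
      show "0 \<le> 18 * \<epsilon> powr (1/128)" by simp
      fix w assume w: "w \<in> space ?M"
      then have w12: "fst w \<in> space \<mu>\<^sub>1" "snd w \<in> space \<mu>\<^sub>2" by (auto simp: space_pair_measure)
      let ?C = "\<lambda>N. contract N \<tau> \<rho>"
      let ?A = "projected_kernel (fst w) - mat 1" and ?B = "projected_kernel (snd w) - mat 1"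
      have adj: "adj (?C (?N w)) = ?C (?N w)"
        by (rule trace_norm_contract_dominated(2)[OF kernel_tensor_dominated[OF psd_projected_kernel psd_projected_kernel] psds])
      have adj1: "adj (?C (kernel_tensor ?A (mat 1))) = ?C (kernel_tensor ?A (mat 1))"
        unfolding contract_kernel_tensor_1
        using subnormalised_marginals(1)[OF sub(1)] subnormalised_marginals(1)[OF sub(2)]
        by (intro trace_norm_contract_dominated(2)[OF plus_mat_1_dominated[OF psd_projected_kernel]]) (auto simp: subnormalised_def)
      have adj2: "adj (?C (kernel_tensor (mat 1) ?B)) = ?C (kernel_tensor (mat 1) ?B)"
        unfolding contract_kernel_tensor_2
        using subnormalised_marginals(2)[OF sub(1)] subnormalised_marginals(2)[OF sub(2)]
        by (intro trace_norm_contract_dominated(2)[OF plus_mat_1_dominated[OF psd_projected_kernel]]) (auto simp: subnormalised_def)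
      have "?C (kernel_tensor (projected_kernel (fst w)) (projected_kernel (snd w)) - mat 1) =
          ?C (?N w) + ?C (kernel_tensor ?A (mat 1)) + ?C (kernel_tensor (mat 1) ?B)"
        unfolding kernel_tensor_diff contract_add1 ..
      then have "trace_norm (?C (kernel_tensor (projected_kernel (fst w)) (projected_kernel (snd w)) - mat 1)) \<le>
          trace_norm (?C (?N w)) + trace_norm (?C (kernel_tensor ?A (mat 1))) + trace_norm (?C (kernel_tensor (mat 1) ?B))"
        using trace_norm_triangle[OF adj adj1] trace_norm_triangle[of "?C (?N w) + ?C (kernel_tensor ?A (mat 1))", OF _ adj2]
        by (simp add: adj_add adj adj1)
      also have "\<dots> \<le> q12 w + q1 (fst w) + q2 (snd w)"
        unfolding contract_kernel_tensor_1 contract_kernel_tensor_2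
        using q12(2)[OF w] q1(2)[OF w12(1)] q2(2)[OF w12(2)] by simp
      finally show "trace_norm (?C (kernel_tensor (projected_kernel (fst w)) (projected_kernel (snd w)) - mat 1))
          \<le> q12 w + q1 (fst w) + q2 (snd w)" .
    qed
  next
    case False
    \<comment> \<open>The product kernel minus 1 is dominated by the product kernel plus 1, whose
      mean is 2, so the expectation is at most 2.\<close>
    let ?N = "\<lambda>w. kernel_tensor (projected_kernel (fst w)) (projected_kernel (snd w))"
    have bounded_measurable: "bounded_measurable ?M (\<lambda>w. ?N w $ p $ q)" for p q
      unfolding kernel_tensor_nth by (intro bounded_measurable_mult bounded_measurable_fst[OF k1(2)] bounded_measurable_snd[OF k2(2)])
    have "(\<integral>w. ?N w $ p $ q \<partial>?M) = (if p = q then 1 else 0)" for p q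
      unfolding kernel_tensor_nth integral_product_bounded_measurable[OF k1(2) k2(2)] k1(3) k2(3)
      by (auto simp: prod_eq_iff)
    then have D: "bounded_measurable ?M (\<lambda>w. (?N w + mat 1) $ p $ q)"
      "(\<integral>w. (?N w + mat 1) $ p $ q \<partial>?M) = (if p = q then of_real 2 else 0)" for p q
      using bounded_measurable[of p q] bounded_measurable_integrable[OF bounded_measurable[of p q]]
      by (auto simp: mat_def prob_space intro!: bounded_measurable_add)
    note t = integral_trace_contract[of "\<lambda>w. ?N w + mat 1", OF D psds]
    show ?thesis
    proof (rule integral_le_of_dominated)
      show "integrable ?M (\<lambda>w. Re (trace (contract (?N w + mat 1) \<tau> \<rho>)))" by (rule t(1))
      have "2 * Re (trace \<tau>) * Re (trace \<rho>) \<le> 2 * 1 * 1"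
        using traces psds by (intro mult_mono) (auto simp: trace_psd_nonneg)
      also have "\<dots> \<le> 18 * \<epsilon> powr (1/128)" using trivial_error_le[of \<epsilon>] \<epsilon> False by simp
      finally show "(\<integral>w. Re (trace (contract (?N w + mat 1) \<tau> \<rho>)) \<partial>?M) \<le> 18 * \<epsilon> powr (1/128)"
        unfolding t(2) .
      show "trace_norm (contract (?N w - mat 1) \<tau> \<rho>) \<le> Re (trace (contract (?N w + mat 1) \<tau> \<rho>))" for w
        by (intro trace_norm_contract_dominated plus_mat_1_dominated psd_kernel_tensor psd_projected_kernel psds)
    qed simp
  qed
qed

theorem theorem3:
  fixes T :: "('a\<^sub>1::finite \<times> 'a\<^sub>2::finite) op \<Rightarrow> 'e::finite op"
    and \<rho> :: "(('a\<^sub>1 \<times> 'a\<^sub>2) \<times> 'r::finite) op"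
  assumes "completely_positive T"
    and "trace_nonincreasing T"
    and "subnormalised \<rho>"
  shows "let \<tau> = choi T; T' = inv_choi (hat \<tau>) in
    completely_positive T' \<and>
    (\<forall>X. T' X = mscale 4 (T (project00 X))) \<and>
    (\<forall>(\<epsilon>::real) (\<mu>\<^sub>1 :: ('a\<^sub>1 \<times> 2) op measure) (\<mu>\<^sub>2 :: ('a\<^sub>2 \<times> 2) op measure).
       0 < \<epsilon> \<longrightarrow> \<epsilon> < 1 \<longrightarrow>
       haar_unitary \<mu>\<^sub>1 \<longrightarrow> haar_unitary \<mu>\<^sub>2 \<longrightarrow>
       H_min \<epsilon> (marginal_1 \<rho>) + H_min \<epsilon> (marginal_1 \<tau>) > ereal (log 2 (1 / \<epsilon>)) \<longrightarrow>
       H_min \<epsilon> (marginal_2 \<rho>) + H_min \<epsilon> (marginal_2 \<tau>) > ereal (log 2 (1 / \<epsilon>)) \<longrightarrow>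
       H_min \<epsilon> \<rho> + H_min \<epsilon> \<tau> > ereal (log 2 (1 / \<epsilon>)) \<longrightarrow>
       real CARD('a\<^sub>1) ^ 2 > 1 / \<epsilon> \<longrightarrow>
       real CARD('a\<^sub>2) ^ 2 > 1 / \<epsilon> \<longrightarrow>
       (\<integral>(U\<^sub>1, U\<^sub>2).
          trace_norm (tensor_id T' (((U\<^sub>1 \<otimes>\<^sub>m U\<^sub>2) \<otimes>\<^sub>m mat 1) \<circ>\<^sub>m hat \<rho>) - ptrace1 \<tau> \<otimes>\<^sub>m ptrace1 \<rho>)
        \<partial>(\<mu>\<^sub>1 \<Otimes>\<^sub>M \<mu>\<^sub>2)) \<le> 18 * \<epsilon> powr (1 / 128))"
proof -
  have T: "superoperator T" using assms(1) by (simp add: completely_positive_def)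
  have X: "tensor_id (inv_choi (hat (choi T))) (((U\<^sub>1 \<otimes>\<^sub>m U\<^sub>2) \<otimes>\<^sub>m mat 1) \<circ>\<^sub>m hat \<rho>) - ptrace1 (choi T) \<otimes>\<^sub>m ptrace1 \<rho>
      = contract (kernel_tensor (projected_kernel U\<^sub>1) (projected_kernel U\<^sub>2) - mat 1) (choi T) \<rho>" for U\<^sub>1 U\<^sub>2
    unfolding tensor_id_hat[OF T] contract_diff1 contract_mat_1 ..
  show ?thesis
    unfolding Let_def case_prod_beta X
    using decoupling_bound[OF _ _ subnormalised_choi[OF assms(1,2)] assms(3)]
      completely_positive_hat[OF assms(1)]
    by (simp add: inv_choi_hat[OF T])
qed

end
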